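(* Let $\Omega\subset\mathbb{R}^n$ ($n\le 3$) be a bounded Lipschitz domain and let $d_1,d_2,d_3,a_1,a_3,b_1,b_2,c_2,c_3,F,G_1,G_2$ be positive constants. Let $\{S(t)\}_{t\ge0}$ be the Oregonator semiflow on $H_+$ generated by $$\frac{\partial u}{\partial t}=d_1\Delta u+a_1u+b_1v-Fu^2-G_1uv,\qquad \frac{\partial v}{\partial t}=d_2\Delta v-b_2v+c_2w-G_2uv,\qquad \frac{\partial w}{\partial t}=d_3\Delta w+a_3u-c_3w$$ on $\Omega$ with $u=v=w=0$ on $\partial\Omega$, and let $\mathscr{A}$ be its global attractor in $H_+$. Then $\mathscr{A}$ is a bounded subset of $[L^\infty(\Omega)]^3$.
   Context: Spaces: $H=[L^2(\Omega)]^3$ with norm $\|\cdot\|$, $E=[H_0^1(\Omega)]^3$ with norm $\|\varphi\|_E=\|\nabla\varphi\|$, $E^*=[H^{-1}(\Omega)]^3$, with $(\cdot,\cdot)$ the $(E^*,E)$ dual product. $H_+=\{\varphi\in H:\varphi_i\ge0 \text{ a.e. in }\Omega,\ i=1,2,3\}$. Operators: $A=\mathrm{diag}(d_1\Delta,d_2\Delta,d_3\Delta)$ with Dirichlet conditions, regarded also as a bounded operator $E\to E^*$, and $f:E\to H$, $f(u,v,w)=(a_1u+b_1v-Fu^2-G_1uv,\,-b_2v+c_2w-G_2uv,\,a_3u-c_3w)$. The system is written as $\frac{dg}{dt}=Ag+f(g)$, $g(0)=g_0$, with $g=(u,v,w)$. Weak solution on $[0,\tau]$: a function $g\in L^2(0,\tau;E)\cap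 C_w([0,\tau];H)$ ($C_w$: weakly continuous) with $g(0)=g_0$ such that for every $\phi\in E$, $\frac{d}{dt}(g,\phi)=(Ag,\phi)+(f(g),\phi)$ for a.e. $t\in[0,\tau]$ (time derivative in the distributional sense). A global weak solution is a function on $[0,\infty)$ that is a weak solution on every $[0,\tau]$. Oregonator semiflow: for every $g_0\in H_+$ there is a unique global weak solution $g(t;g_0)$, and it stays in $H_+$; $S(t)g_0=g(t;g_0)$, $t\ge0$. Global attractor in $H_+$ for $\{S(t)\}_{t\ge0}$: a nonempty compact (in the $H$-norm) subset $\mathscr{A}\subset H_+$ with $S(t)\mathscr{A}=\mathscr{A}$ for all $t\ge0$, and such that for every bounded $B\subset H_+$, $\sup_{x\in B}\inf_{y\in\mathscr{A}}\|S(t)x-y\|\to0$ as $t\to\infty$. Such a set exists for the Oregonator semiflow and is unique. *)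

theory Defs
  imports "HOL-Analysis.Analysis" "HOL-Probability.Essential_Supremum"
begin

text \<open>
  Functions on \<open>\<Omega>\<close> are total functions of which only the values on \<open>\<Omega>\<close> matter. Elements of
  \<open>L\<^sup>2(\<Omega>)\<close>, \<open>H\<^sup>1(\<Omega>)\<close>, ... are represented by functions, not by equivalence classes,
  so that equality in these spaces is equality a.e. in \<open>\<Omega>\<close>. The products
  \<open>[L\<^sup>2(\<Omega>)]\<^sup>3\<close>, \<open>[L\<^sup>\<infinity>(\<Omega>)]\<^sup>3\<close> consist of \<open>\<real>\<^sup>3\<close>-valued functions.
\<close>

subsection \<open>Lipschitz domains\<close>

text \<open>Near each boundary point, and after rotating so that the unit vector \<open>e\<close> becomes the last
  coordinate direction, the domain is the strict epigraph of a Lipschitz function \<open>\<gamma>\<close>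
  of the remaining coordinates, here the points of the hyperplane orthogonal to \<open>e\<close>.\<close>

definition bounded_lipschitz_domain :: "'a::euclidean_space set \<Rightarrow> bool" where
  "bounded_lipschitz_domain \<Omega> \<longleftrightarrow>
     open \<Omega> \<and> connected \<Omega> \<and> \<Omega> \<noteq> {} \<and> bounded \<Omega> \<and>
     (\<forall>p\<in>frontier \<Omega>. \<exists>e \<gamma> L r. norm e = 1 \<and> r > 0 \<and> L-lipschitz_on {y. y \<bullet> e = 0} \<gamma> \<and>
        (\<forall>x\<in>ball p r. x \<in> \<Omega> \<longleftrightarrow> x \<bullet> e > (\<gamma> (x - (x \<bullet> e) *\<^sub>R e) :: real)))"

subsection \<open>Lebesgue spaces\<close>

definition ae_eq :: "'a::euclidean_space set \<Rightarrow> ('a \<Rightarrow> 'b) \<Rightarrow> ('a \<Rightarrow> 'b) \<Rightarrow> bool" where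
  "ae_eq \<Omega> f g \<longleftrightarrow> (AE x in lebesgue_on \<Omega>. f x = g x)"

definition L2 :: "'a::euclidean_space set \<Rightarrow> ('a \<Rightarrow> 'b::euclidean_space) set" where
  "L2 \<Omega> = {f \<in> borel_measurable (lebesgue_on \<Omega>). integrable (lebesgue_on \<Omega>) (\<lambda>x. (norm (f x))\<^sup>2)}"

definition L2_inner ::
  "'a::euclidean_space set \<Rightarrow> ('a \<Rightarrow> 'b::euclidean_space) \<Rightarrow> ('a \<Rightarrow> 'b) \<Rightarrow> real" where
  "L2_inner \<Omega> f g = (LINT x|lebesgue_on \<Omega>. f x \<bullet> g x)"

definition L2_norm :: "'a::euclidean_space set \<Rightarrow> ('a \<Rightarrow> 'b::euclidean_space) \<Rightarrow> real" where
  "L2_norm \<Omega> f = sqrt (L2_inner \<Omega> f f)"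

definition L2_dist ::
  "'a::euclidean_space set \<Rightarrow> ('a \<Rightarrow> 'b::euclidean_space) \<Rightarrow> ('a \<Rightarrow> 'b) \<Rightarrow> real" where
  "L2_dist \<Omega> f g = L2_norm \<Omega> (\<lambda>x. f x - g x)"

text \<open>The distance is only a pseudometric on representatives, which is why the norm topology is
  given by its balls; a set of representatives is compact in it iff the corresponding set of
  equivalence classes is compact.\<close>

definition L2_topology :: "'a::euclidean_space set \<Rightarrow> ('a \<Rightarrow> 'b::euclidean_space) topology" where
  "L2_topology \<Omega> =
     topology_generated_by {{h \<in> L2 \<Omega>. L2_dist \<Omega> f h < r} | f r. f \<in> L2 \<Omega> \<and> r > 0}"

definition Linf_norm :: "'a::euclidean_space set \<Rightarrow> ('a \<Rightarrow> 'b::euclidean_space) \<Rightarrow> ereal" where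
  "Linf_norm \<Omega> f = esssup (lebesgue_on \<Omega>) (\<lambda>x. ereal (norm (f x)))"

definition Linf :: "'a::euclidean_space set \<Rightarrow> ('a \<Rightarrow> 'b::euclidean_space) set" where
  "Linf \<Omega> = {f \<in> borel_measurable (lebesgue_on \<Omega>). Linf_norm \<Omega> f < \<infinity>}"

subsection \<open>Test functions and distributional derivatives\<close>

definition dir_deriv :: "'a::euclidean_space \<Rightarrow> ('a \<Rightarrow> real) \<Rightarrow> 'a \<Rightarrow> real" where
  "dir_deriv b f x = frechet_derivative f (at x) b"

primrec C_diff :: "nat \<Rightarrow> ('a::euclidean_space \<Rightarrow> real) \<Rightarrow> bool" where
  "C_diff 0 f \<longleftrightarrow> continuous_on UNIV f"
| "C_diff (Suc k) f \<longleftrightarrow>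
     (\<forall>x. f differentiable (at x)) \<and> (\<forall>b\<in>Basis. C_diff k (dir_deriv b f))"

definition test_functions :: "'a::euclidean_space set \<Rightarrow> ('a \<Rightarrow> real) set" where
  "test_functions U =
     {\<theta>. (\<forall>k. C_diff k \<theta>) \<and> compact (closure {x. \<theta> x \<noteq> 0}) \<and> closure {x. \<theta> x \<noteq> 0} \<subseteq> U}"

definition locally_integrable :: "'a::euclidean_space set \<Rightarrow> ('a \<Rightarrow> real) \<Rightarrow> bool" where
  "locally_integrable U u \<longleftrightarrow> (\<forall>K. compact K \<and> K \<subseteq> U \<longrightarrow> u absolutely_integrable_on K)"

definition has_weak_deriv ::
  "'a::euclidean_space set \<Rightarrow> 'a \<Rightarrow> ('a \<Rightarrow> real) \<Rightarrow> ('a \<Rightarrow> real) \<Rightarrow> bool" where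
  "has_weak_deriv U b u w \<longleftrightarrow> locally_integrable U u \<and> locally_integrable U w \<and>
     (\<forall>\<theta>\<in>test_functions U.
        (LINT x|lebesgue_on U. u x * dir_deriv b \<theta> x) = - (LINT x|lebesgue_on U. w x * \<theta> x))"

subsection \<open>Sobolev spaces\<close>

definition is_weak_grad ::
  "'a::euclidean_space set \<Rightarrow> ('a \<Rightarrow> real) \<Rightarrow> ('a \<Rightarrow> 'a) \<Rightarrow> bool" where
  "is_weak_grad \<Omega> u G \<longleftrightarrow> (\<forall>b\<in>Basis. has_weak_deriv \<Omega> b u (\<lambda>x. G x \<bullet> b))"

definition H1 :: "'a::euclidean_space set \<Rightarrow> ('a \<Rightarrow> real) set" where
  "H1 \<Omega> = {u \<in> L2 \<Omega>. \<exists>G\<in>L2 \<Omega>. is_weak_grad \<Omega> u G}"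

definition weak_grad :: "'a::euclidean_space set \<Rightarrow> ('a \<Rightarrow> real) \<Rightarrow> 'a \<Rightarrow> 'a" where
  "weak_grad \<Omega> u = (SOME G. G \<in> L2 \<Omega> \<and> is_weak_grad \<Omega> u G)"

definition H1_norm :: "'a::euclidean_space set \<Rightarrow> ('a \<Rightarrow> real) \<Rightarrow> real" where
  "H1_norm \<Omega> u = sqrt ((L2_norm \<Omega> u)\<^sup>2 + (L2_norm \<Omega> (weak_grad \<Omega> u))\<^sup>2)"

definition H10 :: "'a::euclidean_space set \<Rightarrow> ('a \<Rightarrow> real) set" where
  "H10 \<Omega> = {u \<in> H1 \<Omega>. \<forall>\<epsilon>>0. \<exists>\<psi>\<in>test_functions \<Omega>. H1_norm \<Omega> (\<lambda>x. u x - \<psi> x) < \<epsilon>}"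

subsection \<open>Phase spaces and weak solutions\<close>

definition H_plus :: "'a::euclidean_space set \<Rightarrow> ('a \<Rightarrow> real^3) set" where
  "H_plus \<Omega> = {\<phi> \<in> L2 \<Omega>. \<forall>i. AE x in lebesgue_on \<Omega>. 0 \<le> \<phi> x $ i}"

definition E_space :: "'a::euclidean_space set \<Rightarrow> ('a \<Rightarrow> real^3) set" where
  "E_space \<Omega> = {\<phi>. \<forall>i. (\<lambda>x. \<phi> x $ i) \<in> H10 \<Omega>}"

definition E_norm :: "'a::euclidean_space set \<Rightarrow> ('a \<Rightarrow> real^3) \<Rightarrow> real" where
  "E_norm \<Omega> \<phi> = sqrt (\<Sum>i\<in>UNIV. (L2_norm \<Omega> (weak_grad \<Omega> (\<lambda>x. \<phi> x $ i)))\<^sup>2)"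

text \<open>The operator \<open>A = diag(d\<^sub>1\<Delta>, d\<^sub>2\<Delta>, d\<^sub>3\<Delta>)\<close> from \<open>E\<close> to \<open>E\<^sup>*\<close>; \<open>A_op \<Omega> d g \<phi>\<close> is the
  dual product \<open>(A g, \<phi>)\<close>.\<close>

definition A_op ::
  "'a::euclidean_space set \<Rightarrow> real^3 \<Rightarrow> ('a \<Rightarrow> real^3) \<Rightarrow> ('a \<Rightarrow> real^3) \<Rightarrow> real" where
  "A_op \<Omega> d g \<phi> = - (\<Sum>i\<in>UNIV. d $ i *
     L2_inner \<Omega> (weak_grad \<Omega> (\<lambda>x. g x $ i)) (weak_grad \<Omega> (\<lambda>x. \<phi> x $ i)))"

text \<open>\<open>L\<^sup>2(0,\<tau>;E)\<close> in the sense of Bochner: strongly measurable \<open>E\<close>-valued functions, i.e. a.e. limits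
  of simple functions in the norm of \<open>E\<close>, with square integrable norm. Such a function takes
  values in \<open>E\<close> for a.e. \<open>t\<close> only.\<close>

definition L2_time_E :: "'a::euclidean_space set \<Rightarrow> real \<Rightarrow> (real \<Rightarrow> 'a \<Rightarrow> real^3) set" where
  "L2_time_E \<Omega> \<tau> = {g.
     (\<exists>s. (\<forall>k. simple_function (lebesgue_on {0..\<tau>}) (s k) \<and> s k ` {0..\<tau>} \<subseteq> E_space \<Omega>) \<and>
          (AE t in lebesgue_on {0..\<tau>}. g t \<in> E_space \<Omega> \<and>
             (\<lambda>k. E_norm \<Omega> (\<lambda>x. s k t x - g t x)) \<longlonglongrightarrow> 0)) \<and>
     integrable (lebesgue_on {0..\<tau>}) (\<lambda>t. (E_norm \<Omega> (g t))\<^sup>2)}"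

definition Cw_H :: "'a::euclidean_space set \<Rightarrow> real \<Rightarrow> (real \<Rightarrow> 'a \<Rightarrow> real^3) set" where
  "Cw_H \<Omega> \<tau> = {g. (\<forall>t\<in>{0..\<tau>}. g t \<in> L2 \<Omega>) \<and>
     (\<forall>h\<in>L2 \<Omega>. continuous_on {0..\<tau>} (\<lambda>t. L2_inner \<Omega> (g t) h))}"

text \<open>Weak solutions of \<open>dg/dt = A g + f(g)\<close>, \<open>g(0) = g\<^sub>0\<close>, on \<open>[0,\<tau>]\<close>.\<close>

definition weak_solution ::
  "'a::euclidean_space set \<Rightarrow> real^3 \<Rightarrow> (real^3 \<Rightarrow> real^3) \<Rightarrow> real \<Rightarrow>
   ('a \<Rightarrow> real^3) \<Rightarrow> (real \<Rightarrow> 'a \<Rightarrow> real^3) \<Rightarrow> bool" where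
  "weak_solution \<Omega> d f \<tau> g0 g \<longleftrightarrow>
     g \<in> L2_time_E \<Omega> \<tau> \<inter> Cw_H \<Omega> \<tau> \<and> ae_eq \<Omega> (g 0) g0 \<and>
     (\<forall>\<phi>\<in>E_space \<Omega>. has_weak_deriv {0<..<\<tau>} 1 (\<lambda>t. L2_inner \<Omega> (g t) \<phi>)
        (\<lambda>t. A_op \<Omega> d (g t) \<phi> + L2_inner \<Omega> (\<lambda>x. f (g t x)) \<phi>))"

definition global_weak_solution ::
  "'a::euclidean_space set \<Rightarrow> real^3 \<Rightarrow> (real^3 \<Rightarrow> real^3) \<Rightarrow>
   ('a \<Rightarrow> real^3) \<Rightarrow> (real \<Rightarrow> 'a \<Rightarrow> real^3) \<Rightarrow> bool" where
  "global_weak_solution \<Omega> d f g0 g \<longleftrightarrow> (\<forall>\<tau>>0. weak_solution \<Omega> d f \<tau> g0 g)"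

subsection \<open>Semiflow and global attractor\<close>

text \<open>\<open>S t g0\<close> is the value at time \<open>t\<close> of the unique global weak solution starting at \<open>g0\<close>, which
  stays in \<open>H\<^sub>+\<close>. This determines \<open>S t g0\<close> up to equality a.e.\<close>

definition is_weak_semiflow ::
  "'a::euclidean_space set \<Rightarrow> real^3 \<Rightarrow> (real^3 \<Rightarrow> real^3) \<Rightarrow>
   (real \<Rightarrow> ('a \<Rightarrow> real^3) \<Rightarrow> ('a \<Rightarrow> real^3)) \<Rightarrow> bool" where
  "is_weak_semiflow \<Omega> d f S \<longleftrightarrow> (\<forall>g0\<in>H_plus \<Omega>.
     global_weak_solution \<Omega> d f g0 (\<lambda>t. S t g0) \<and>
     (\<forall>g. global_weak_solution \<Omega> d f g0 g \<longrightarrow> (\<forall>t\<ge>0. ae_eq \<Omega> (g t) (S t g0))) \<and>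
     (\<forall>t\<ge>0. S t g0 \<in> H_plus \<Omega>))"

definition ae_closure :: "'a::euclidean_space set \<Rightarrow> ('a \<Rightarrow> 'b) set \<Rightarrow> ('a \<Rightarrow> 'b) set" where
  "ae_closure \<Omega> X = {f. \<exists>g\<in>X. ae_eq \<Omega> f g}"

text \<open>Passing to \<open>ae_closure\<close> expresses \<open>S(t)\<A> = \<A>\<close> as sets of equivalence classes. The supremum and
  infimum are taken in the extended nonnegative reals, so that they exist for every \<open>B\<close>.\<close>

definition is_global_attractor ::
  "'a::euclidean_space set \<Rightarrow> (real \<Rightarrow> ('a \<Rightarrow> real^3) \<Rightarrow> ('a \<Rightarrow> real^3)) \<Rightarrow>
   ('a \<Rightarrow> real^3) set \<Rightarrow> bool" where
  "is_global_attractor \<Omega> S \<A> \<longleftrightarrow>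
     \<A> \<noteq> {} \<and> \<A> \<subseteq> H_plus \<Omega> \<and> compactin (L2_topology \<Omega>) \<A> \<and>
     (\<forall>t\<ge>0. ae_closure \<Omega> (S t ` \<A>) = ae_closure \<Omega> \<A>) \<and>
     (\<forall>B. B \<subseteq> H_plus \<Omega> \<and> (\<exists>R. \<forall>x\<in>B. L2_norm \<Omega> x \<le> R) \<longrightarrow>
        ((\<lambda>t. SUP x\<in>B. INF y\<in>\<A>. ennreal (L2_dist \<Omega> (S t x) y)) \<longlongrightarrow> 0) at_top)"

subsection \<open>The Oregonator reaction term\<close>

definition oregonator_f ::
  "real \<Rightarrow> real \<Rightarrow> real \<Rightarrow> real \<Rightarrow> real \<Rightarrow> real \<Rightarrow> real \<Rightarrow> real \<Rightarrow> real \<Rightarrow> real^3 \<Rightarrow> real^3" where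
  "oregonator_f a1 a3 b1 b2 c2 c3 F G1 G2 p = (let u = p $ 1; v = p $ 2; w = p $ 3 in
     vector [a1 * u + b1 * v - F * u\<^sup>2 - G1 * u * v,
             - b2 * v + c2 * w - G2 * u * v,
             a3 * u - c3 * w])"

end

(* The nonnegative solutions satisfy u_t <= d1 Lap u + a1 u + b1 v, v_t <= d2 Lap v + c2 w,
   w_t <= d3 Lap w + a3 u, and the attractor consists of end points of such solutions which stay in a
   fixed ball of L^2. So each component y is a subsolution of a heat equation with a source bounded in
   L^2, and since the Dirichlet heat semigroup maps L^2 to L^oo with norm O(t^(-n/4)), which is
   integrable at 0 for n <= 3, y is bounded after a fixed time.

   The semigroup estimate is used in its dual form: y is tested against the solution z >= 0 of the
   backward heat equation with a final datum psi of mass at most 1/2, for which the L^2 norm decays like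
   t^(-3/4) by Nash's inequality. This z is replaced by implicit Euler steps, each of them an almost
   minimiser of a quadratic functional among the test functions, interpolated linearly in time.
   Everything on the dual side is thus a smooth function of compact support, and neither the
   completeness of H10 nor the existence of the semigroup is needed. The errors vanish with the step
   size because y belongs to L^2(0,3;E). *)

theory Submission
  imports Defs
begin

subsection \<open>Smooth functions\<close>

text \<open>The weak equation can be tested only with functions fixed in time, and \<open>y\<close>
  is merely weakly continuous with gradients for almost every \<open>t\<close>. Linear interpolation
  fits this: on each step it amounts to weighting two fixed test functions with affine functions of
  \<open>t\<close>. Its defect is the gradient jump between consecutive Euler steps paired with the
  gradient of \<open>y\<close>; the squared jumps sum to a bound free of the number \<open>N\<close>
  of steps, and a factor \<open>1 / N\<close> remains. The rate 3/4 is n/4 for n = 3; smaller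
  dimensions are subsumed because Nash's inequality is applied only with cubes of side at most 1.
  The mass starts at 1/2, not 1, so that the almost minimisers may gain mass and still stay below 1.
  The final datum has no uniform \<open>L\<^sup>2\<close> bound, but its norm decides only how large
  \<open>N\<close> must be, not the constants. Solutions are observed on [0,3] and estimated at time
  2, with dual steps running back to time 1: the weak derivative in time is given on the open
  interval only, so both ends are kept at a distance.\<close>

definition smooth :: "('a::euclidean_space \<Rightarrow> real) \<Rightarrow> bool" where
  "smooth f \<longleftrightarrow> (\<forall>k. C_diff k f)"

lemma C_diff_Suc_imp: "C_diff (Suc k) f \<Longrightarrow> C_diff k f"
proof (induction k arbitrary: f)
  case 0
  then show ?case
    by (auto intro!: differentiable_imp_continuous_on simp: differentiable_on_def
        intro: differentiable_at_withinI)
next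
  case (Suc k)
  then show ?case by (metis C_diff.simps(2))
qed

lemma smooth_differentiable: "smooth f \<Longrightarrow> f differentiable (at x)"
  unfolding smooth_def by (meson C_diff.simps(2))

lemma smooth_dir_deriv: "smooth f \<Longrightarrow> b \<in> Basis \<Longrightarrow> smooth (dir_deriv b f)"
  unfolding smooth_def by (meson C_diff.simps(2))

lemma smooth_continuous: "smooth f \<Longrightarrow> continuous_on S f"
  unfolding smooth_def using C_diff.simps(1) continuous_on_subset by blast

lemma dir_deriv_eq: "(f has_derivative f') (at x) \<Longrightarrow> dir_deriv b f x = f' b"
  unfolding dir_deriv_def using frechet_derivative_at by fastforce

lemma has_derivative_dir_deriv:
  "f differentiable (at x) \<Longrightarrow> (f has_derivative (\<lambda>h. dir_deriv h f x)) (at x)"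
  unfolding dir_deriv_def using frechet_derivative_works[of f "at x"] by simp

lemma dir_deriv_add:
  "f differentiable (at x) \<Longrightarrow> g differentiable (at x) \<Longrightarrow>
    dir_deriv b (\<lambda>x. f x + g x) x = dir_deriv b f x + dir_deriv b g x"
  by (rule dir_deriv_eq[OF has_derivative_add[OF has_derivative_dir_deriv has_derivative_dir_deriv]])

lemma dir_deriv_mult:
  fixes f g :: "'a::euclidean_space \<Rightarrow> real"
  shows "f differentiable (at x) \<Longrightarrow> g differentiable (at x) \<Longrightarrow>
    dir_deriv b (\<lambda>x. f x * g x) x = f x * dir_deriv b g x + dir_deriv b f x * g x"
  by (rule dir_deriv_eq[OF has_derivative_mult[OF has_derivative_dir_deriv has_derivative_dir_deriv]])

lemma dir_deriv_compose:
  fixes f :: "'a::euclidean_space \<Rightarrow> real"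
  assumes "f differentiable (at x)" "(\<beta> has_real_derivative d) (at (f x))"
  shows "dir_deriv b (\<lambda>x. \<beta> (f x)) x = d * dir_deriv b f x"
  by (rule dir_deriv_eq[OF has_derivative_compose[OF has_derivative_dir_deriv[OF assms(1)]
        assms(2)[unfolded has_field_derivative_def]]])

lemma dir_deriv_real: "(\<beta> has_real_derivative d) (at x) \<Longrightarrow> dir_deriv b \<beta> x = d * b"
  unfolding has_field_derivative_def by (rule dir_deriv_eq)

lemma dir_deriv_const [simp]: "dir_deriv b (\<lambda>x. c) = (\<lambda>x. 0)"
  by (rule ext, rule dir_deriv_eq[OF has_derivative_const])

lemma C_diff_const: "C_diff k (\<lambda>x. c)"
  by (induction k arbitrary: c) auto

lemma C_diff_add: "C_diff k f \<Longrightarrow> C_diff k g \<Longrightarrow> C_diff k (\<lambda>x. f x + g x)"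
proof (induction k arbitrary: f g)
  case 0
  then show ?case by (simp add: continuous_on_add)
next
  case (Suc k)
  then have "dir_deriv b (\<lambda>x. f x + g x) = (\<lambda>x. dir_deriv b f x + dir_deriv b g x)" for b
    by (simp add: dir_deriv_add fun_eq_iff)
  with Suc show ?case by simp
qed

lemma C_diff_mult: "C_diff k f \<Longrightarrow> C_diff k g \<Longrightarrow> C_diff k (\<lambda>x. f x * g x)"
proof (induction k arbitrary: f g)
  case 0
  then show ?case by (simp add: continuous_on_mult)
next
  case (Suc k)
  then have "dir_deriv b (\<lambda>x. f x * g x) = (\<lambda>x. f x * dir_deriv b g x + dir_deriv b f x * g x)" for b
    by (simp add: dir_deriv_mult fun_eq_iff)
  with Suc C_diff_Suc_imp[of k f] C_diff_Suc_imp[of k g] show ?case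
    by (simp add: C_diff_add)
qed

lemma C_diff_compose: "C_diff k \<beta> \<Longrightarrow> C_diff k f \<Longrightarrow> C_diff k (\<lambda>x. \<beta> (f x))"
proof (induction k arbitrary: \<beta> f)
  case 0
  then show ?case
    using continuous_on_compose2[of UNIV \<beta> UNIV f] by simp
next
  case (Suc k)
  have d: "(\<beta> has_real_derivative dir_deriv 1 \<beta> y) (at y)" for y
  proof -
    have "\<beta> differentiable (at y)" using Suc by simp
    then obtain c where "(\<beta> has_real_derivative c) (at y)"
      using real_differentiable_def by blast
    with dir_deriv_real[OF this, of 1] show ?thesis by simp
  qed
  then have "dir_deriv b (\<lambda>x. \<beta> (f x)) = (\<lambda>x. dir_deriv 1 \<beta> (f x) * dir_deriv b f x)" for b
    using Suc by (simp add: dir_deriv_compose fun_eq_iff)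
  moreover have "(\<lambda>x. \<beta> (f x)) differentiable (at x)" for x
    using Suc differentiable_chain_at[of f x \<beta>] by (simp add: o_def)
  ultimately show ?case
    using Suc C_diff_Suc_imp[of k f] by (simp add: C_diff_mult)
qed

lemma smooth_const [simp]: "smooth (\<lambda>x. c)"
  by (simp add: smooth_def C_diff_const)

lemma smooth_add: "smooth f \<Longrightarrow> smooth g \<Longrightarrow> smooth (\<lambda>x. f x + g x)"
  and smooth_mult: "smooth f \<Longrightarrow> smooth g \<Longrightarrow> smooth (\<lambda>x. f x * g x)"
  and smooth_compose: "smooth \<beta> \<Longrightarrow> smooth f \<Longrightarrow> smooth (\<lambda>x. \<beta> (f x))"
  by (simp_all add: smooth_def C_diff_add C_diff_mult C_diff_compose)

lemma smooth_sum: "(\<And>i. i \<in> I \<Longrightarrow> smooth (f i)) \<Longrightarrow> smooth (\<lambda>x. \<Sum>i\<in>I. f i x)"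
  by (induction I rule: infinite_finite_induct) (simp_all add: smooth_add)

lemma smooth_realI:
  assumes "\<And>x. (f has_real_derivative f' x) (at x)" "smooth f'"
  shows "smooth f"
proof -
  have "C_diff k f" for k
  proof (cases k)
    case 0
    have "continuous_on UNIV f"
      by (rule DERIV_continuous_on) (rule has_field_derivative_at_within[OF assms(1)])
    with 0 show ?thesis by simp
  next
    case (Suc k)
    have "dir_deriv 1 f = f'" using dir_deriv_real[OF assms(1)] by auto
    moreover have "\<forall>x. f differentiable (at x)"
      using assms(1) real_differentiable_def by blast
    ultimately show ?thesis using Suc assms(2) by (simp add: smooth_def)
  qed
  then show ?thesis by (simp add: smooth_def)
qed

lemma smooth_linear:
  assumes "bounded_linear f"
  shows "smooth f"
proof -
  have d: "(f has_derivative f) (at x)" for x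
    using assms by (rule bounded_linear_imp_has_derivative)
  have dd: "dir_deriv b f = (\<lambda>x. f b)" for b using dir_deriv_eq[OF d] by auto
  have "C_diff k f" for k
  proof (cases k)
    case 0
    then show ?thesis using assms by (simp add: linear_continuous_on)
  next
    case (Suc k)
    moreover have "\<forall>x. f differentiable (at x)"
      using d differentiable_def by blast
    ultimately show ?thesis by (simp add: dd C_diff_const)
  qed
  then show ?thesis by (simp add: smooth_def)
qed

text \<open>The exponent is kept general because differentiation lowers it: the derivative is
  \<open>2 * c * s\<close> times the same expression with exponent \<open>c - 1\<close>. The case
  \<open>1/2\<close>, a regularised absolute value, is the one wanted.\<close>

lemma smooth_powr_quadratic:
  fixes \<delta> c :: real
  assumes "\<delta> > 0"
  shows "smooth (\<lambda>s. (s\<^sup>2 + \<delta>\<^sup>2) powr c)"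
proof -
  have pos: "s\<^sup>2 + \<delta>\<^sup>2 > 0" for s :: real
    using assms by (simp add: add_nonneg_pos)
  have D: "((\<lambda>s. (s\<^sup>2 + \<delta>\<^sup>2) powr c) has_real_derivative (2 * c * s) * (s\<^sup>2 + \<delta>\<^sup>2) powr (c - 1)) (at s)" for s c
    by (rule derivative_eq_intros refl pos | simp add: power2_eq_square)+
  have "C_diff k (\<lambda>s. (s\<^sup>2 + \<delta>\<^sup>2) powr c)" for k
  proof (induction k arbitrary: c)
    case 0
    have "continuous_on UNIV (\<lambda>s. (s\<^sup>2 + \<delta>\<^sup>2) powr c)"
      by (rule DERIV_continuous_on) (rule has_field_derivative_at_within[OF D])
    then show ?case by simp
  next
    case (Suc k)
    have "dir_deriv 1 (\<lambda>s. (s\<^sup>2 + \<delta>\<^sup>2) powr c) = (\<lambda>s. (2 * c * s) * (s\<^sup>2 + \<delta>\<^sup>2) powr (c - 1))"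
      using dir_deriv_real[OF D] by auto
    moreover have "smooth (\<lambda>s. 2 * c * s)" by (intro smooth_linear bounded_linear_mult_right)
    moreover have "\<forall>s. (\<lambda>s. (s\<^sup>2 + \<delta>\<^sup>2) powr c) differentiable (at s)"
      using D real_differentiable_def by blast
    ultimately show ?case
      using Suc[of "c - 1"] by (simp add: C_diff_mult smooth_def)
  qed
  then show ?thesis by (simp add: smooth_def)
qed

lemma smooth_sqrt_quadratic: "\<delta> > 0 \<Longrightarrow> smooth (\<lambda>s::real. sqrt (s\<^sup>2 + \<delta>\<^sup>2))"
  using smooth_powr_quadratic[of \<delta> "1/2"] by (simp add: powr_half_sqrt)

text \<open>All derivatives of \<open>exp (- 1 / s)\<close> have the form \<open>p (1 / s) * exp (- 1 / s)\<close> with a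
  polynomial \<open>p\<close>.\<close>

definition flat_exp :: "real poly \<Rightarrow> real \<Rightarrow> real" where
  "flat_exp p s = (if s > 0 then poly p (1 / s) * exp (- (1 / s)) else 0)"

lemma flat_exp_tendsto_0: "((\<lambda>s. poly p (1 / s) * exp (- (1 / s))) \<longlongrightarrow> (0::real)) (at_right 0)"
proof -
  have "((\<lambda>x. poly p x * exp (- x)) \<longlongrightarrow> 0) at_top"
  proof -
    have "((\<lambda>x. (\<Sum>i\<le>degree p. coeff p i * (x ^ i / exp x))) \<longlongrightarrow> (\<Sum>i\<le>degree p. coeff p i * 0)) at_top"
      by (intro tendsto_sum tendsto_mult tendsto_const) (rule tendsto_power_div_exp_0)
    then show ?thesis
      by (simp add: poly_altdef sum_divide_distrib sum_distrib_right exp_minus divide_inverse mult.assoc)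
  qed
  from filterlim_compose[OF this filterlim_inverse_at_top_right]
  show ?thesis by (simp add: divide_inverse)
qed

text \<open>With \<open>x = 1 / s\<close>, the derivative of \<open>p x * exp (- x)\<close> in
  \<open>s\<close> is \<open>x\<^sup>2 * (p x - p' x) * exp (- x)\<close>, again of the same form;
  hence the factor \<open>[:0, 0, 1:]\<close>.\<close>

lemma flat_exp_has_derivative:
  "(flat_exp p has_real_derivative flat_exp ([:0, 0, 1:] * (p - pderiv p)) s) (at s)"
proof -
  consider "s > 0" | "s < 0" | "s = 0" by linarith
  then show ?thesis
  proof cases
    case 1
    have "((\<lambda>s. poly p (1 / s) * exp (- (1 / s))) has_real_derivative
      flat_exp ([:0, 0, 1:] * (p - pderiv p)) s) (at s)"
      using 1 unfolding flat_exp_def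
      by (auto intro!: derivative_eq_intros poly_DERIV[THEN DERIV_chain2] simp: field_simps power2_eq_square)
    then show ?thesis
      by (rule DERIV_cong_ev[THEN iffD2, rotated 3])
        (use 1 in \<open>auto simp: flat_exp_def intro!: eventually_mono[OF eventually_nhds_in_open[of "{0<..}"]]\<close>)
  next
    case 2
    have "((\<lambda>s. 0::real) has_real_derivative 0) (at s)" by simp
    then have "(flat_exp p has_real_derivative 0) (at s)"
      by (rule DERIV_cong_ev[THEN iffD2, rotated 3])
        (use 2 in \<open>auto simp: flat_exp_def intro!: eventually_mono[OF eventually_nhds_in_open[of "{..<0}"]]\<close>)
    then show ?thesis using 2 by (simp add: flat_exp_def)
  next
    case 3
    have "((\<lambda>h. flat_exp p h / h) \<longlongrightarrow> 0) (at 0)"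
    proof (rule filterlim_split_at)
      show "((\<lambda>h. flat_exp p h / h) \<longlongrightarrow> 0) (at_left 0)"
        by (rule tendsto_eventually) (auto simp: flat_exp_def eventually_at_filter)
      \<comment> \<open>Dividing by \<open>h\<close> only multiplies the polynomial by its variable,
        so the limit at 0 covers the difference quotient as well.\<close>
      have "((\<lambda>s. poly ([:0, 1:] * p) (1 / s) * exp (- (1 / s))) \<longlongrightarrow> 0) (at_right 0)"
        by (rule flat_exp_tendsto_0)
      then show "((\<lambda>h. flat_exp p h / h) \<longlongrightarrow> 0) (at_right 0)"
        by (rule filterlim_cong[THEN iffD1, rotated 3])
          (auto simp: flat_exp_def eventually_at_filter)
    qed
    then show ?thesis using 3
      by (simp add: flat_exp_def DERIV_def)
  qed
qed

lemma smooth_flat_exp: "smooth (flat_exp p)"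
proof -
  have "C_diff k (flat_exp p)" for k
  proof (induction k arbitrary: p)
    case 0
    have "continuous_on UNIV (flat_exp p)"
      by (rule DERIV_continuous_on) (rule has_field_derivative_at_within[OF flat_exp_has_derivative])
    then show ?case by simp
  next
    case (Suc k)
    have "dir_deriv 1 (flat_exp p) = flat_exp ([:0, 0, 1:] * (p - pderiv p))"
      using dir_deriv_real[OF flat_exp_has_derivative] by auto
    moreover have "\<forall>s. flat_exp p differentiable (at s)"
      using flat_exp_has_derivative real_differentiable_def by blast
    ultimately show ?case
      using Suc by (simp del: mult_pCons_left)
  qed
  then show ?thesis by (simp add: smooth_def)
qed

text \<open>The classical bump \<open>exp (- 1 / (r\<^sup>2 - (norm (x - c))\<^sup>2))\<close> on
  the ball, unnormalised. The inner product keeps the argument polynomial in the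
  coordinates.\<close>

definition bump :: "'a::euclidean_space \<Rightarrow> real \<Rightarrow> 'a \<Rightarrow> real" where
  "bump c r x = flat_exp 1 (r\<^sup>2 - (x - c) \<bullet> (x - c))"

lemma smooth_inner_diff: "smooth (\<lambda>x. (x - c) \<bullet> b)"
proof -
  have "smooth (\<lambda>x. x \<bullet> b + (- (c \<bullet> b)))"
    by (intro smooth_add smooth_const smooth_linear bounded_linear_inner_left)
  then show ?thesis by (simp add: inner_diff_left)
qed

lemma smooth_bump: "smooth (bump c r)"
proof -
  have "smooth (\<lambda>x. flat_exp 1 (r\<^sup>2 + (- 1) * (\<Sum>b\<in>Basis. ((x - c) \<bullet> b) * ((x - c) \<bullet> b))))"
    by (intro smooth_compose[OF smooth_flat_exp] smooth_add smooth_const smooth_mult smooth_sum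
        smooth_inner_diff)
  moreover have "bump c r = (\<lambda>x. flat_exp 1 (r\<^sup>2 + (- 1) * (\<Sum>b\<in>Basis. ((x - c) \<bullet> b) * ((x - c) \<bullet> b))))"
    unfolding bump_def by (subst euclidean_inner) simp
  ultimately show ?thesis by simp
qed

lemma bump_nonneg: "bump c r x \<ge> 0"
  by (simp add: bump_def flat_exp_def)

lemma bump_pos_iff: "r > 0 \<Longrightarrow> bump c r x > 0 \<longleftrightarrow> x \<in> ball c r"
proof -
  assume r: "r > 0"
  have "bump c r x > 0 \<longleftrightarrow> (norm (x - c))\<^sup>2 < r\<^sup>2"
    by (auto simp: bump_def flat_exp_def power2_norm_eq_inner)
  also have "\<dots> \<longleftrightarrow> norm (x - c) < r"
    using r by (metis abs_le_square_iff abs_norm_cancel abs_of_pos not_less)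
  finally show ?thesis by (simp add: dist_norm norm_minus_commute)
qed

lemma bump_eq_0_iff: "r > 0 \<Longrightarrow> bump c r x = 0 \<longleftrightarrow> x \<notin> ball c r"
  using bump_pos_iff[of r c x] bump_nonneg[of c r x] by auto

subsection \<open>The Hilbert space structure of \<open>L\<^sup>2\<close>\<close>

lemma L2_measurable: "f \<in> L2 \<Omega> \<Longrightarrow> f \<in> borel_measurable (lebesgue_on \<Omega>)"
  and L2_integrable_power2: "f \<in> L2 \<Omega> \<Longrightarrow> integrable (lebesgue_on \<Omega>) (\<lambda>x. (norm (f x))\<^sup>2)"
  by (simp_all add: L2_def)

lemma L2_integrable_inner:
  assumes "f \<in> L2 \<Omega>" "g \<in> L2 \<Omega>"
  shows "integrable (lebesgue_on \<Omega>) (\<lambda>x. f x \<bullet> g x)"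
proof (rule Bochner_Integration.integrable_bound)
  show "integrable (lebesgue_on \<Omega>) (\<lambda>x. (norm (f x))\<^sup>2 + (norm (g x))\<^sup>2)"
    using assms by (simp add: L2_def)
  show "(\<lambda>x. f x \<bullet> g x) \<in> borel_measurable (lebesgue_on \<Omega>)"
    using assms by (intro borel_measurable_inner L2_measurable)
  have "\<bar>f x \<bullet> g x\<bar> \<le> (norm (f x))\<^sup>2 + (norm (g x))\<^sup>2" for x
    using Cauchy_Schwarz_ineq2[of "f x" "g x"] sum_squares_bound[of "norm (f x)" "norm (g x)"]
      mult_nonneg_nonneg[of "norm (f x)" "norm (g x)"] norm_ge_zero[of "f x"] norm_ge_zero[of "g x"]
    by linarith
  then show "AE x in lebesgue_on \<Omega>. norm (f x \<bullet> g x) \<le> norm ((norm (f x))\<^sup>2 + (norm (g x))\<^sup>2)"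
    by (intro AE_I2) simp
qed

lemma L2_I:
  assumes "f \<in> borel_measurable (lebesgue_on \<Omega>)" "integrable (lebesgue_on \<Omega>) h"
    "\<And>x. x \<in> \<Omega> \<Longrightarrow> (norm (f x))\<^sup>2 \<le> h x"
  shows "f \<in> L2 \<Omega>"
proof -
  have "integrable (lebesgue_on \<Omega>) (\<lambda>x. (norm (f x))\<^sup>2)"
  proof (rule Bochner_Integration.integrable_bound[OF assms(2)])
    show "(\<lambda>x. (norm (f x))\<^sup>2) \<in> borel_measurable (lebesgue_on \<Omega>)"
      using assms(1) by measurable
    show "AE x in lebesgue_on \<Omega>. norm ((norm (f x))\<^sup>2) \<le> norm (h x)"
      using assms(3) abs_ge_self order_trans by (intro AE_I2) (simp, blast)
  qed
  then show ?thesis using assms(1) by (simp add: L2_def)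
qed

lemma L2_zero [simp]: "(\<lambda>x. 0) \<in> L2 \<Omega>"
  by (simp add: L2_def)

lemma L2_add: "f \<in> L2 \<Omega> \<Longrightarrow> g \<in> L2 \<Omega> \<Longrightarrow> (\<lambda>x. f x + g x) \<in> L2 \<Omega>"
proof (rule L2_I[where h = "\<lambda>x. 2 * (norm (f x))\<^sup>2 + 2 * (norm (g x))\<^sup>2"])
  fix x
  have "(norm (f x + g x))\<^sup>2 \<le> (norm (f x) + norm (g x))\<^sup>2"
    by (intro power_mono norm_triangle_ineq norm_ge_zero)
  then show "(norm (f x + g x))\<^sup>2 \<le> 2 * (norm (f x))\<^sup>2 + 2 * (norm (g x))\<^sup>2"
    using sum_squares_bound[of "norm (f x)" "norm (g x)"] by (simp add: power2_sum)
qed (simp_all add: L2_def borel_measurable_add)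

lemma L2_scale: "f \<in> L2 \<Omega> \<Longrightarrow> (\<lambda>x. c *\<^sub>R f x) \<in> L2 \<Omega>"
  unfolding L2_def by (simp add: power_mult_distrib borel_measurable_scaleR)

lemma L2_diff: "f \<in> L2 \<Omega> \<Longrightarrow> g \<in> L2 \<Omega> \<Longrightarrow> (\<lambda>x. f x - g x) \<in> L2 \<Omega>"
  using L2_add[OF _ L2_scale[of g \<Omega> "-1"], of f] by simp

lemma L2_inner_commute: "L2_inner \<Omega> f g = L2_inner \<Omega> g f"
  by (simp add: L2_inner_def inner_commute)

lemma L2_inner_add_left:
  "f \<in> L2 \<Omega> \<Longrightarrow> g \<in> L2 \<Omega> \<Longrightarrow> h \<in> L2 \<Omega> \<Longrightarrow>
    L2_inner \<Omega> (\<lambda>x. f x + g x) h = L2_inner \<Omega> f h + L2_inner \<Omega> g h"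
  by (simp add: L2_inner_def inner_add_left L2_integrable_inner)

lemma L2_inner_diff_left:
  "f \<in> L2 \<Omega> \<Longrightarrow> g \<in> L2 \<Omega> \<Longrightarrow> h \<in> L2 \<Omega> \<Longrightarrow>
    L2_inner \<Omega> (\<lambda>x. f x - g x) h = L2_inner \<Omega> f h - L2_inner \<Omega> g h"
  by (simp add: L2_inner_def inner_diff_left L2_integrable_inner)

lemma L2_inner_scale_left:
  "f \<in> L2 \<Omega> \<Longrightarrow> h \<in> L2 \<Omega> \<Longrightarrow> L2_inner \<Omega> (\<lambda>x. c *\<^sub>R f x) h = c * L2_inner \<Omega> f h"
  by (simp add: L2_inner_def)

lemma L2_inner_mult_left:
  "L2_inner \<Omega> (\<lambda>x. c * f x) h = c * L2_inner \<Omega> f h" for f :: "'a::euclidean_space \<Rightarrow> real"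
  by (simp add: L2_inner_def mult.assoc)

lemma L2_inner_add_right:
  "f \<in> L2 \<Omega> \<Longrightarrow> g \<in> L2 \<Omega> \<Longrightarrow> h \<in> L2 \<Omega> \<Longrightarrow>
    L2_inner \<Omega> h (\<lambda>x. f x + g x) = L2_inner \<Omega> h f + L2_inner \<Omega> h g"
  using L2_inner_add_left[of f \<Omega> g h] by (simp add: L2_inner_commute)

lemma L2_inner_diff_right:
  "f \<in> L2 \<Omega> \<Longrightarrow> g \<in> L2 \<Omega> \<Longrightarrow> h \<in> L2 \<Omega> \<Longrightarrow>
    L2_inner \<Omega> h (\<lambda>x. f x - g x) = L2_inner \<Omega> h f - L2_inner \<Omega> h g"
  using L2_inner_diff_left[of f \<Omega> g h] by (simp add: L2_inner_commute)

lemma L2_inner_scale_right: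
  "f \<in> L2 \<Omega> \<Longrightarrow> h \<in> L2 \<Omega> \<Longrightarrow> L2_inner \<Omega> h (\<lambda>x. c *\<^sub>R f x) = c * L2_inner \<Omega> h f"
  using L2_inner_scale_left[of f \<Omega> h c] by (simp add: L2_inner_commute)

lemma L2_inner_cong:
  assumes "f \<in> L2 \<Omega>" "f' \<in> L2 \<Omega>" "g \<in> L2 \<Omega>" "g' \<in> L2 \<Omega>"
    "AE x in lebesgue_on \<Omega>. f x = f' x" "AE x in lebesgue_on \<Omega>. g x = g' x"
  shows "L2_inner \<Omega> f g = L2_inner \<Omega> f' g'"
  unfolding L2_inner_def
proof (rule integral_cong_AE)
  show "(\<lambda>x. f x \<bullet> g x) \<in> borel_measurable (lebesgue_on \<Omega>)"
    and "(\<lambda>x. f' x \<bullet> g' x) \<in> borel_measurable (lebesgue_on \<Omega>)"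
    by (intro borel_measurable_inner L2_measurable assms)+
  show "AE x in lebesgue_on \<Omega>. f x \<bullet> g x = f' x \<bullet> g' x"
    using assms(5,6) by eventually_elim simp
qed

lemma L2_inner_self_nonneg [simp]: "0 \<le> L2_inner \<Omega> f f"
  by (simp add: L2_inner_def)

lemma L2_norm_nonneg [simp]: "0 \<le> L2_norm \<Omega> f"
  by (simp add: L2_norm_def)

lemma L2_norm_power2: "(L2_norm \<Omega> f)\<^sup>2 = L2_inner \<Omega> f f"
  by (simp add: L2_norm_def)

lemma L2_norm_cong:
  assumes "f \<in> L2 \<Omega>" "f' \<in> L2 \<Omega>" "AE x in lebesgue_on \<Omega>. f x = f' x"
  shows "L2_norm \<Omega> f = L2_norm \<Omega> f'"
  using L2_inner_cong[OF assms(1,2,1,2,3,3)] by (simp add: L2_norm_def)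

text \<open>Evaluate at the minimising \<open>s = - b / c\<close>. Besides Cauchy-Schwarz it turns
  almost minimality of a quadratic functional into a bound on the first variation; there
  \<open>a\<close> is the gap to the infimum.\<close>

lemma quadratic_nonneg_discriminant:
  fixes a b c :: real
  assumes "\<And>s. 0 \<le> a + 2 * s * b + s\<^sup>2 * c" "0 \<le> c"
  shows "b\<^sup>2 \<le> a * c"
proof (cases "c = 0")
  case True
  have "b = 0"
  proof (rule ccontr)
    assume "b \<noteq> 0"
    \<comment> \<open>With \<open>c = 0\<close> this \<open>s\<close> gives the value -1.\<close>
    then show False using assms(1)[of "- (a + 1) / (2 * b)"] True by (simp add: field_simps)
  qed
  then show ?thesis using True by simp
next
  case False
  then have "c > 0" using assms(2) by simp
  have "0 \<le> c * (a + 2 * (- b / c) * b + (- b / c)\<^sup>2 * c)"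
    by (rule mult_nonneg_nonneg[OF assms(2) assms(1)])
  also have "\<dots> = a * c + (- 2) * (b * b) + (b * b) * (c / c) * (c / c)"
    using \<open>c > 0\<close> by (simp add: field_simps power2_eq_square)
  also have "\<dots> = a * c - b\<^sup>2"
    using \<open>c > 0\<close> by (simp add: power2_eq_square)
  finally show ?thesis by simp
qed

lemma L2_inner_add_scale_self:
  assumes "f \<in> L2 \<Omega>" "g \<in> L2 \<Omega>"
  shows "L2_inner \<Omega> (\<lambda>x. f x + s *\<^sub>R g x) (\<lambda>x. f x + s *\<^sub>R g x) =
    L2_inner \<Omega> f f + 2 * s * L2_inner \<Omega> f g + s\<^sup>2 * L2_inner \<Omega> g g"
  using assms L2_scale[OF assms(2), of s]
  by (simp add: L2_inner_add_left L2_inner_add_right L2_inner_scale_left L2_inner_scale_right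
      L2_add L2_inner_commute[of \<Omega> g f] power2_eq_square)

lemma L2_Cauchy_Schwarz:
  assumes "f \<in> L2 \<Omega>" "g \<in> L2 \<Omega>"
  shows "\<bar>L2_inner \<Omega> f g\<bar> \<le> L2_norm \<Omega> f * L2_norm \<Omega> g"
proof -
  have "(L2_inner \<Omega> f g)\<^sup>2 \<le> L2_inner \<Omega> f f * L2_inner \<Omega> g g"
    by (rule quadratic_nonneg_discriminant)
      (simp_all flip: L2_inner_add_scale_self[OF assms])
  then have "(L2_inner \<Omega> f g)\<^sup>2 \<le> (L2_norm \<Omega> f * L2_norm \<Omega> g)\<^sup>2"
    by (simp add: L2_norm_power2 power_mult_distrib)
  then have "\<bar>L2_inner \<Omega> f g\<bar> \<le> \<bar>L2_norm \<Omega> f * L2_norm \<Omega> g\<bar>"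
    by (simp only: abs_le_square_iff)
  then show ?thesis by (simp add: abs_mult)
qed

lemma L2_triangle:
  assumes "f \<in> L2 \<Omega>" "g \<in> L2 \<Omega>"
  shows "L2_norm \<Omega> (\<lambda>x. f x + g x) \<le> L2_norm \<Omega> f + L2_norm \<Omega> g"
proof -
  have "(L2_norm \<Omega> (\<lambda>x. f x + g x))\<^sup>2 = (L2_norm \<Omega> f)\<^sup>2 + 2 * L2_inner \<Omega> f g + (L2_norm \<Omega> g)\<^sup>2"
    using L2_inner_add_scale_self[OF assms, of 1] by (simp add: L2_norm_power2)
  also have "\<dots> \<le> (L2_norm \<Omega> f + L2_norm \<Omega> g)\<^sup>2"
    using L2_Cauchy_Schwarz[OF assms] by (simp add: power2_sum)
  finally show ?thesis
    by (rule power2_le_imp_le) simp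
qed

lemma L2_norm_scale: "L2_norm \<Omega> (\<lambda>x. c *\<^sub>R f x) = \<bar>c\<bar> * L2_norm \<Omega> f"
proof -
  have "L2_inner \<Omega> (\<lambda>x. c *\<^sub>R f x) (\<lambda>x. c *\<^sub>R f x) = c\<^sup>2 * L2_inner \<Omega> f f"
    by (simp add: L2_inner_def power2_eq_square mult.assoc)
  then show ?thesis
    by (simp add: L2_norm_def real_sqrt_mult)
qed

lemma L2_norm_diff_le:
  assumes "f \<in> L2 \<Omega>" "g \<in> L2 \<Omega>"
  shows "L2_norm \<Omega> f \<le> L2_norm \<Omega> g + L2_norm \<Omega> (\<lambda>x. f x - g x)"
  using L2_triangle[OF assms(2) L2_diff[OF assms]] by simp

lemma L2_component:
  fixes f :: "'a::euclidean_space \<Rightarrow> real^'m"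
  assumes "f \<in> L2 \<Omega>"
  shows "(\<lambda>x. f x $ i) \<in> L2 \<Omega>"
proof (rule L2_I[OF _ L2_integrable_power2[OF assms]])
  have "(\<lambda>x. f x \<bullet> axis i 1) \<in> borel_measurable (lebesgue_on \<Omega>)"
    using assms by (intro borel_measurable_inner L2_measurable borel_measurable_const)
  then show "(\<lambda>x. f x $ i) \<in> borel_measurable (lebesgue_on \<Omega>)"
    by (simp add: inner_axis)
  show "(norm (f x $ i))\<^sup>2 \<le> (norm (f x))\<^sup>2" for x
    using power_mono[OF component_le_norm_cart[of "f x" i] abs_ge_zero, of 2] by simp
qed

lemma L2_norm_component_le:
  fixes f :: "'a::euclidean_space \<Rightarrow> real^'m"
  assumes "f \<in> L2 \<Omega>"
  shows "L2_norm \<Omega> (\<lambda>x. f x $ i) \<le> L2_norm \<Omega> f"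
proof -
  have "L2_inner \<Omega> (\<lambda>x. f x $ i) (\<lambda>x. f x $ i) \<le> L2_inner \<Omega> f f"
    unfolding L2_inner_def
  proof (rule integral_mono)
    show "integrable (lebesgue_on \<Omega>) (\<lambda>x. (f x $ i) \<bullet> (f x $ i))"
      and "integrable (lebesgue_on \<Omega>) (\<lambda>x. f x \<bullet> f x)"
      using assms L2_component[OF assms] L2_integrable_inner by blast+
    show "(f x $ i) \<bullet> (f x $ i) \<le> f x \<bullet> f x" for x
      using power_mono[OF component_le_norm_cart[of "f x" i] abs_ge_zero, of 2]
      by (simp add: power2_norm_eq_inner[symmetric] power2_eq_square)
  qed
  then show ?thesis by (simp add: L2_norm_def)
qed

subsection \<open>Test functions\<close>

text \<open>The classical gradient. \<open>weak_grad\<close> is a choice among representatives and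
  agrees with it only almost everywhere, so pointwise calculus on test functions goes through
  \<open>grad\<close>.\<close>

definition grad :: "('a::euclidean_space \<Rightarrow> real) \<Rightarrow> 'a \<Rightarrow> 'a" where
  "grad f x = (\<Sum>b\<in>Basis. dir_deriv b f x *\<^sub>R b)"

lemma grad_inner_Basis: "b \<in> Basis \<Longrightarrow> grad f x \<bullet> b = dir_deriv b f x"
  by (simp add: grad_def inner_sum_left inner_Basis if_distrib cong: if_cong)

lemma has_derivative_grad:
  assumes "f differentiable (at x)"
  shows "(f has_derivative (\<lambda>h. grad f x \<bullet> h)) (at x)"
proof -
  have D: "(f has_derivative (\<lambda>h. dir_deriv h f x)) (at x)"
    using assms by (rule has_derivative_dir_deriv)
  then interpret bounded_linear "\<lambda>h. dir_deriv h f x" by (rule has_derivative_bounded_linear)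
  have "dir_deriv h f x = grad f x \<bullet> h" for h
  proof -
    have "dir_deriv h f x = dir_deriv (\<Sum>b\<in>Basis. (h \<bullet> b) *\<^sub>R b) f x"
      by (simp add: euclidean_representation)
    also have "\<dots> = (\<Sum>b\<in>Basis. (h \<bullet> b) * dir_deriv b f x)"
      by (simp add: sum scaleR)
    also have "\<dots> = grad f x \<bullet> h"
      by (simp add: grad_def inner_sum_left inner_commute[of h] mult.commute)
    finally show ?thesis .
  qed
  with D show ?thesis by simp
qed

lemma grad_eqI: "(f has_derivative (\<lambda>h. v \<bullet> h)) (at x) \<Longrightarrow> grad f x = v"
  by (simp add: grad_def dir_deriv_eq euclidean_representation[of v] cong: sum.cong)

lemma grad_add:
  assumes "f differentiable (at x)" "g differentiable (at x)"
  shows "grad (\<lambda>x. f x + g x) x = grad f x + grad g x"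
  by (rule grad_eqI) (use has_derivative_add[OF assms[THEN has_derivative_grad]] in
    \<open>simp add: inner_add_left\<close>)

lemma grad_mult:
  assumes "f differentiable (at x)"
  shows "grad (\<lambda>x. c * f x) x = c *\<^sub>R grad f x"
  by (rule grad_eqI) (use has_derivative_mult_right[OF has_derivative_grad[OF assms], of c] in simp)

lemma grad_compose:
  assumes "f differentiable (at x)" "(\<beta> has_real_derivative d) (at (f x))"
  shows "grad (\<lambda>x. \<beta> (f x)) x = d *\<^sub>R grad f x"
  by (rule grad_eqI) (use has_derivative_compose[OF has_derivative_grad[OF assms(1)]
        assms(2)[unfolded has_field_derivative_def]] in simp)

lemma continuous_on_grad: "smooth f \<Longrightarrow> continuous_on S (grad f)"
  unfolding grad_def
  by (intro continuous_on_sum continuous_on_scaleR continuous_on_const smooth_continuous smooth_dir_deriv)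

lemma test_functionsI:
  assumes "smooth \<theta>" "compact K" "K \<subseteq> U" "\<And>x. x \<notin> K \<Longrightarrow> \<theta> x = 0"
  shows "\<theta> \<in> test_functions U"
proof -
  have sub: "{x. \<theta> x \<noteq> 0} \<subseteq> K" using assms(4) by blast
  then have "closure {x. \<theta> x \<noteq> 0} \<subseteq> K"
    using assms(2) by (simp add: closure_minimal compact_imp_closed)
  moreover have "compact (closure {x. \<theta> x \<noteq> 0})"
    using sub assms(2) bounded_subset compact_closure compact_imp_bounded by blast
  ultimately show ?thesis
    using assms by (auto simp: test_functions_def smooth_def)
qed

lemma test_smooth: "\<theta> \<in> test_functions U \<Longrightarrow> smooth \<theta>"
  by (simp add: test_functions_def smooth_def)

lemma test_differentiable: "\<theta> \<in> test_functions U \<Longrightarrow> \<theta> differentiable (at x)"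
  by (simp add: test_smooth smooth_differentiable)

lemma test_support:
  assumes "\<theta> \<in> test_functions U"
  shows "\<exists>K. compact K \<and> K \<subseteq> U \<and>
    (\<forall>x. x \<notin> K \<longrightarrow> \<theta> x = 0 \<and> grad \<theta> x = 0 \<and> (\<forall>b. dir_deriv b \<theta> x = 0))"
proof (intro exI conjI allI impI)
  let ?K = "closure {x. \<theta> x \<noteq> 0}"
  show "compact ?K" "?K \<subseteq> U" using assms by (auto simp: test_functions_def)
  show "x \<notin> ?K \<Longrightarrow> \<theta> x = 0" for x using closure_subset[of "{x. \<theta> x \<noteq> 0}"] by blast
  have D: "(\<theta> has_derivative (\<lambda>h. 0)) (at x)" if "x \<notin> ?K" for x
  proof (rule has_derivative_transform_within_open[OF has_derivative_const])
    show "open (- ?K)" "x \<in> - ?K" using that by auto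
    show "y \<in> - ?K \<Longrightarrow> 0 = \<theta> y" for y using closure_subset[of "{x. \<theta> x \<noteq> 0}"] by auto
  qed
  show "x \<notin> ?K \<Longrightarrow> grad \<theta> x = 0" for x
    by (rule grad_eqI) (simp add: D)
  show "x \<notin> ?K \<Longrightarrow> dir_deriv b \<theta> x = 0" for x b
    using dir_deriv_eq[OF D] by simp
qed

lemma test_zero [simp]: "(\<lambda>x. 0) \<in> test_functions U"
  by (rule test_functionsI[of _ "{}"]) auto

lemma test_mono: "\<theta> \<in> test_functions U \<Longrightarrow> U \<subseteq> V \<Longrightarrow> \<theta> \<in> test_functions V"
  by (auto simp: test_functions_def)

lemma test_add:
  assumes "\<theta> \<in> test_functions U" "\<eta> \<in> test_functions U"
  shows "(\<lambda>x. \<theta> x + \<eta> x) \<in> test_functions U"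
proof -
  obtain K where "compact K" "K \<subseteq> U" "\<And>x. x \<notin> K \<Longrightarrow> \<theta> x = 0"
    using test_support[OF assms(1)] by blast
  moreover obtain L where "compact L" "L \<subseteq> U" "\<And>x. x \<notin> L \<Longrightarrow> \<eta> x = 0"
    using test_support[OF assms(2)] by blast
  ultimately show ?thesis
    using assms by (intro test_functionsI[where K = "K \<union> L"]) (auto intro: smooth_add test_smooth)
qed

lemma test_smooth_mult:
  assumes "\<theta> \<in> test_functions U" "smooth \<eta>"
  shows "(\<lambda>x. \<eta> x * \<theta> x) \<in> test_functions U"
proof -
  obtain K where "compact K" "K \<subseteq> U" "\<And>x. x \<notin> K \<Longrightarrow> \<theta> x = 0"
    using test_support[OF assms(1)] by blast
  then show ?thesis
    using assms by (intro test_functionsI[where K = K]) (auto intro: smooth_mult test_smooth)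
qed

lemma test_mult: "\<theta> \<in> test_functions U \<Longrightarrow> (\<lambda>x. c * \<theta> x) \<in> test_functions U"
  by (rule test_smooth_mult) simp_all

lemma test_diff:
  assumes "\<theta> \<in> test_functions U" "\<eta> \<in> test_functions U"
  shows "(\<lambda>x. \<theta> x - \<eta> x) \<in> test_functions U"
  using test_add[OF assms(1) test_mult[OF assms(2), of "-1"]] by simp

lemma test_sum:
  "(\<And>i. i \<in> I \<Longrightarrow> f i \<in> test_functions U) \<Longrightarrow> (\<lambda>x. \<Sum>i\<in>I. f i x) \<in> test_functions U"
  by (induction I rule: infinite_finite_induct) (simp_all add: test_add)

lemma test_compose:
  assumes "\<theta> \<in> test_functions U" "smooth \<beta>" "\<beta> 0 = 0"
  shows "(\<lambda>x. \<beta> (\<theta> x)) \<in> test_functions U"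
proof -
  obtain K where "compact K" "K \<subseteq> U" "\<And>x. x \<notin> K \<Longrightarrow> \<theta> x = 0"
    using test_support[OF assms(1)] by blast
  then show ?thesis
    using assms by (intro test_functionsI[where K = K]) (auto intro: smooth_compose test_smooth)
qed

lemma test_dir_deriv:
  assumes "\<theta> \<in> test_functions U" "b \<in> Basis"
  shows "dir_deriv b \<theta> \<in> test_functions U"
proof -
  obtain K where "compact K" "K \<subseteq> U" "\<And>x. x \<notin> K \<Longrightarrow> dir_deriv b \<theta> x = 0"
    using test_support[OF assms(1)] by blast
  then show ?thesis
    using assms by (intro test_functionsI[where K = K]) (auto intro: smooth_dir_deriv test_smooth)
qed

lemma bump_test:
  assumes "r > 0" "cball c r \<subseteq> U"
  shows "bump c r \<in> test_functions U"
  using assms by (intro test_functionsI[where K = "cball c r"])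
    (auto simp: smooth_bump bump_eq_0_iff)

lemma grad_diff_test:
  assumes "\<theta> \<in> test_functions U" "\<eta> \<in> test_functions U"
  shows "grad (\<lambda>x. \<theta> x - \<eta> x) x = grad \<theta> x - grad \<eta> x"
  using grad_add[OF test_differentiable[OF assms(1)] test_differentiable[OF test_mult[OF assms(2), of "-1"]], of x]
    grad_mult[OF test_differentiable[OF assms(2)], of "-1"]
  by simp

text \<open>Integrals over \<open>\<Omega>\<close> of continuous functions with compact support in \<open>\<Omega>\<close> are integrals for
  \<open>lborel\<close>, which is invariant under translations.\<close>

definition ccs :: "'a::euclidean_space set \<Rightarrow> ('a \<Rightarrow> 'b::euclidean_space) \<Rightarrow> bool" where
  "ccs U f \<longleftrightarrow> continuous_on UNIV f \<and> (\<exists>K. compact K \<and> K \<subseteq> U \<and> (\<forall>x. x \<notin> K \<longrightarrow> f x = 0))"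

lemma ccsI: "continuous_on UNIV f \<Longrightarrow> compact K \<Longrightarrow> K \<subseteq> U \<Longrightarrow> (\<And>x. x \<notin> K \<Longrightarrow> f x = 0) \<Longrightarrow> ccs U f"
  by (auto simp: ccs_def)

lemma ccs_test: "\<theta> \<in> test_functions U \<Longrightarrow> ccs U \<theta>"
  using test_support[of \<theta> U] smooth_continuous[OF test_smooth[of \<theta> U]] unfolding ccs_def by blast

lemma ccs_grad: "\<theta> \<in> test_functions U \<Longrightarrow> ccs U (grad \<theta>)"
  using test_support[of \<theta> U] continuous_on_grad[OF test_smooth[of \<theta> U]] unfolding ccs_def by blast

lemma ccs_mono: "ccs U f \<Longrightarrow> U \<subseteq> V \<Longrightarrow> ccs V f"
  unfolding ccs_def by blast

lemma ccs_compose: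
  assumes "ccs U f" "continuous_on UNIV F" "F 0 = 0"
  shows "ccs U (\<lambda>x. F (f x))"
proof -
  have "continuous_on UNIV (\<lambda>x. F (f x))"
    using assms continuous_on_compose2[of UNIV F UNIV f] by (simp add: ccs_def)
  with assms show ?thesis unfolding ccs_def by metis
qed

lemma ccs_inner:
  assumes "ccs U f" "continuous_on UNIV g"
  shows "ccs U (\<lambda>x. f x \<bullet> g x)"
proof -
  have "continuous_on UNIV (\<lambda>x. f x \<bullet> g x)"
    using assms by (simp add: ccs_def continuous_on_inner)
  with assms show ?thesis unfolding ccs_def by (metis inner_zero_left)
qed

lemma ccs_diff:
  assumes "ccs U f" "ccs U g"
  shows "ccs U (\<lambda>x. f x - g x)"
proof -
  obtain K where "compact K" "K \<subseteq> U" "\<And>x. x \<notin> K \<Longrightarrow> f x = 0"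
    using assms(1) unfolding ccs_def by blast
  moreover obtain L where "compact L" "L \<subseteq> U" "\<And>x. x \<notin> L \<Longrightarrow> g x = 0"
    using assms(2) unfolding ccs_def by blast
  moreover have "continuous_on UNIV (\<lambda>x. f x - g x)"
    using assms by (simp add: ccs_def continuous_on_diff)
  ultimately show ?thesis by (intro ccsI[where K = "K \<union> L"]) auto
qed

lemma ccs_translate:
  assumes "ccs UNIV f"
  shows "ccs UNIV (\<lambda>x. f (x + y))"
proof -
  obtain K where K: "compact K" "\<And>x. x \<notin> K \<Longrightarrow> f x = 0" and c: "continuous_on UNIV f"
    using assms by (auto simp: ccs_def)
  have "compact ((\<lambda>x. x - y) ` K)"
    by (intro compact_continuous_image K continuous_intros)
  moreover have "f (x + y) = 0" if "x \<notin> (\<lambda>x. x - y) ` K" for x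
  proof (rule K)
    show "x + y \<notin> K" using that by (metis add_diff_cancel imageI)
  qed
  moreover have "continuous_on UNIV (\<lambda>x. f (x + y))"
    by (rule continuous_on_compose2[OF c]) (auto intro!: continuous_intros)
  ultimately show ?thesis by (auto intro: ccsI)
qed

lemma ccs_integrable_lborel:
  assumes "ccs U f"
  shows "integrable lborel f"
proof -
  obtain K where K: "compact K" "\<And>x. x \<notin> K \<Longrightarrow> f x = 0" and c: "continuous_on UNIV f"
    using assms by (auto simp: ccs_def)
  have "integrable lborel (\<lambda>x. indicator K x *\<^sub>R f x)"
    by (intro borel_integrable_compact K continuous_on_subset[OF c]) auto
  moreover have "(\<lambda>x. indicator K x *\<^sub>R f x) = f"
    using K(2) by (auto simp: indicator_def fun_eq_iff)
  ultimately show ?thesis by simp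
qed

lemma ccs_bounded:
  assumes "ccs U f"
  obtains B where "B \<ge> 0" "\<And>x. norm (f x) \<le> B"
proof -
  obtain K where K: "compact K" "\<And>x. x \<notin> K \<Longrightarrow> f x = 0" and c: "continuous_on UNIV f"
    using assms by (auto simp: ccs_def)
  have "compact (f ` K)"
    by (intro compact_continuous_image K continuous_on_subset[OF c]) auto
  then obtain B where B: "\<And>y. y \<in> f ` K \<Longrightarrow> norm y \<le> B"
    using compact_imp_bounded bounded_iff by metis
  have "norm (f x) \<le> max B 0" for x
    using B[of "f x"] K(2)[of x] by (cases "x \<in> K") auto
  then show ?thesis using that[of "max B 0"] by auto
qed

lemma
  fixes f :: "'a::euclidean_space \<Rightarrow> 'b::euclidean_space"
  assumes "ccs \<Omega> f" "\<Omega> \<in> sets lebesgue"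
  shows ccs_integrable_on: "integrable (lebesgue_on \<Omega>) f"
    and ccs_integral_on: "(LINT x|lebesgue_on \<Omega>. f x) = (LINT x|lborel. f x)"
proof -
  have f: "(\<lambda>x. indicator \<Omega> x *\<^sub>R f x) = f"
    using assms(1) by (auto simp: ccs_def indicator_def fun_eq_iff)
  have m: "f \<in> borel_measurable lborel"
    using ccs_integrable_lborel[OF assms(1)] by auto
  show "integrable (lebesgue_on \<Omega>) f"
    using assms(2) ccs_integrable_lborel[OF assms(1)]
    by (subst integrable_restrict_space) (auto simp: f integrable_completion[OF m])
  show "(LINT x|lebesgue_on \<Omega>. f x) = (LINT x|lborel. f x)"
    using assms(2) by (subst integral_restrict_space) (auto simp: f integral_completion[OF m])
qed

lemma ccs_L2:
  assumes "ccs \<Omega> f" "\<Omega> \<in> sets lebesgue"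
  shows "f \<in> L2 \<Omega>"
proof (rule L2_I)
  show "f \<in> borel_measurable (lebesgue_on \<Omega>)"
    using ccs_integrable_on[OF assms] by auto
  show "integrable (lebesgue_on \<Omega>) (\<lambda>x. (norm (f x))\<^sup>2)"
    by (rule ccs_integrable_on[OF _ assms(2)])
      (rule ccs_compose[OF assms(1)], auto intro!: continuous_intros)
qed simp

lemma L2_inner_ccs:
  assumes "ccs \<Omega> f" "ccs \<Omega> g" "\<Omega> \<in> sets lebesgue"
  shows "L2_inner \<Omega> f g = (LINT x|lborel. f x \<bullet> g x)"
  unfolding L2_inner_def using assms
  by (intro ccs_integral_on ccs_inner) (auto simp: ccs_def)

lemma test_L2: "\<theta> \<in> test_functions \<Omega> \<Longrightarrow> open \<Omega> \<Longrightarrow> \<theta> \<in> L2 \<Omega>"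
  by (simp add: ccs_L2 ccs_test)

lemma grad_L2: "\<theta> \<in> test_functions \<Omega> \<Longrightarrow> open \<Omega> \<Longrightarrow> grad \<theta> \<in> L2 \<Omega>"
  by (simp add: ccs_L2 ccs_grad)

subsection \<open>Translations and integration by parts\<close>

lemma integral_translate_lborel:
  fixes f :: "'a::euclidean_space \<Rightarrow> 'b::euclidean_space"
  assumes "ccs U f"
  shows "(LINT x|lborel. f (x + y)) = (LINT x|lborel. f x)"
proof -
  have m: "f \<in> borel_measurable lborel"
    using ccs_integrable_lborel[OF assms] by auto
  have "(LINT x|lborel. f x) = (LINT x|distr lborel borel ((+) y). f x)"
    by (simp add: lborel_distr_plus)
  also have "\<dots> = (LINT x|lborel. f (y + x))"
    using m by (intro integral_distr) auto
  finally show ?thesis by (simp add: add.commute)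
qed

lemma has_derivative_along_line:
  assumes "f differentiable (at (x + t *\<^sub>R y))"
  shows "((\<lambda>t. f (x + t *\<^sub>R y)) has_real_derivative grad f (x + t *\<^sub>R y) \<bullet> y) (at t)"
proof -
  have "((\<lambda>t. x + t *\<^sub>R y) has_derivative (\<lambda>h. h *\<^sub>R y)) (at t)"
    by (auto intro!: derivative_eq_intros)
  from has_derivative_compose[OF this has_derivative_grad[OF assms]]
  show ?thesis
    by (simp add: has_field_derivative_def mult_commute_abs)
qed

lemma difference_bound:
  assumes "smooth p" "\<And>z. norm (grad p z) \<le> B" "B \<ge> 0"
  shows "\<bar>p (x + h *\<^sub>R y) - p x\<bar> \<le> B * norm y * \<bar>h\<bar>"
proof -
  have D: "((\<lambda>t. p (x + t *\<^sub>R y)) has_real_derivative grad p (x + t *\<^sub>R y) \<bullet> y) (at t)" for t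
    using assms(1) by (intro has_derivative_along_line smooth_differentiable)
  have "norm (p (x + h *\<^sub>R y) - p (x + 0 *\<^sub>R y)) \<le> (B * norm y) * norm (h - 0)"
  proof (rule field_differentiable_bound[of UNIV])
    fix t
    show "((\<lambda>t. p (x + t *\<^sub>R y)) has_real_derivative grad p (x + t *\<^sub>R y) \<bullet> y) (at t within UNIV)"
      by (rule D)
    have "\<bar>grad p (x + t *\<^sub>R y) \<bullet> y\<bar> \<le> norm (grad p (x + t *\<^sub>R y)) * norm y"
      by (rule Cauchy_Schwarz_ineq2)
    also have "\<dots> \<le> B * norm y"
      by (intro mult_right_mono assms norm_ge_zero)
    finally show "norm (grad p (x + t *\<^sub>R y) \<bullet> y) \<le> B * norm y" by simp
  qed auto
  then show ?thesis by simp
qed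

text \<open>With \<open>F\<close> the identity this gives the vanishing integral of a gradient, with
  \<open>F\<close> the square the translation estimate. The quotients are bounded by the gradient,
  so dominated convergence only asks for a common compact support.\<close>

lemma difference_quotient_integral_tendsto:
  fixes p :: "'a::euclidean_space \<Rightarrow> real" and F :: "real \<Rightarrow> real"
  assumes p: "p \<in> test_functions U" and F: "continuous_on UNIV F" "F 0 = 0"
  shows "(\<lambda>n. LINT x|lborel. F (real (Suc n) * (p (x + (1 / real (Suc n)) *\<^sub>R y) - p x)))
    \<longlonglongrightarrow> (LINT x|lborel. F (grad p x \<bullet> y))"
proof -
  obtain B where B: "B \<ge> 0" "\<And>x. norm (grad p x) \<le> B"
    using ccs_bounded[OF ccs_grad[OF p]] by blast
  obtain K where K: "compact K" "\<And>x. x \<notin> K \<Longrightarrow> p x = 0"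
    using test_support[OF p] by blast
  \<comment> \<open>All translates of the support by \<open>- t *\<^sub>R y\<close> with
    \<open>t\<close> in [0,1]; outside this set every difference quotient vanishes.\<close>
  define L where "L = (\<lambda>(x, t). x - t *\<^sub>R y) ` (K \<times> {0..1})"
  have L: "compact L"
    unfolding L_def using K(1)
    by (intro compact_continuous_image compact_Times compact_Icc)
      (auto intro!: continuous_intros simp: case_prod_unfold)
  define C where "C = B * norm y"
  have "compact (F ` {-C..C})"
    by (intro compact_continuous_image continuous_on_subset[OF F(1)]) auto
  then obtain M where M: "\<And>s. s \<in> {-C..C} \<Longrightarrow> \<bar>F s\<bar> \<le> M"
    using compact_imp_bounded bounded_iff by (metis imageI real_norm_def)
  define q where "q n x = real (Suc n) * (p (x + (1 / real (Suc n)) *\<^sub>R y) - p x)" for n x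
  have qb: "\<bar>q n x\<bar> \<le> C" for n x
  proof -
    have "\<bar>p (x + (1 / real (Suc n)) *\<^sub>R y) - p x\<bar> \<le> C * \<bar>1 / real (Suc n)\<bar>"
      unfolding C_def using difference_bound[OF test_smooth[OF p] B(2,1)] .
    then have "real (Suc n) * \<bar>p (x + (1 / real (Suc n)) *\<^sub>R y) - p x\<bar> \<le> C"
      by (simp add: field_simps)
    then show ?thesis by (simp add: q_def abs_mult)
  qed
  have q0: "q n x = 0" if "x \<notin> L" for n x
  proof -
    have "x + (1 / real (Suc n)) *\<^sub>R y \<notin> K"
    proof
      assume "x + (1 / real (Suc n)) *\<^sub>R y \<in> K"
      then have "(x + (1 / real (Suc n)) *\<^sub>R y) - (1 / real (Suc n)) *\<^sub>R y \<in> L"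
        unfolding L_def by (intro image_eqI[where x = "(x + (1 / real (Suc n)) *\<^sub>R y, 1 / real (Suc n))"]) auto
      with that show False by simp
    qed
    moreover have "x \<notin> K"
    proof
      assume "x \<in> K"
      then have "x - 0 *\<^sub>R y \<in> L"
        unfolding L_def by (intro image_eqI[where x = "(x, 0)"]) auto
      with that show False by simp
    qed
    ultimately show ?thesis by (simp add: q_def K(2))
  qed
  have pc: "continuous_on UNIV p" using p by (simp add: smooth_continuous test_smooth)
  have qc: "continuous_on UNIV (q n)" for n
    unfolding q_def
    by (intro continuous_intros continuous_on_compose2[OF pc]) auto
  have ql: "(\<lambda>n. q n x) \<longlonglongrightarrow> grad p x \<bullet> y" for x
  proof -
    have "((\<lambda>t. p (x + t *\<^sub>R y)) has_real_derivative grad p (x + 0 *\<^sub>R y) \<bullet> y) (at 0)"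
      by (intro has_derivative_along_line test_differentiable[OF p])
    then have "((\<lambda>h. (p (x + h *\<^sub>R y) - p x) / h) \<longlongrightarrow> grad p x \<bullet> y) (at 0)"
      by (simp add: DERIV_def)
    moreover have "filterlim (\<lambda>n. 1 / real (Suc n)) (at 0) sequentially"
      by (rule filterlim_atI[OF LIMSEQ_Suc[OF lim_1_over_n]]) auto
    ultimately have "(\<lambda>n. (p (x + (1 / real (Suc n)) *\<^sub>R y) - p x) / (1 / real (Suc n)))
        \<longlonglongrightarrow> grad p x \<bullet> y"
      by (rule filterlim_compose)
    then show ?thesis by (simp add: q_def mult.commute)
  qed
  have cF: "continuous_on UNIV (\<lambda>x. F (q n x))" for n
    using continuous_on_compose2[OF F(1) qc] by simp
  have "(\<lambda>n. LINT x|lborel. F (q n x)) \<longlonglongrightarrow> (LINT x|lborel. F (grad p x \<bullet> y))"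
  proof (rule integral_dominated_convergence[where w = "\<lambda>x. indicator L x *\<^sub>R M"])
    show "integrable lborel (\<lambda>x. indicator L x *\<^sub>R M)"
      by (intro borel_integrable_compact L continuous_on_const)
    show "(\<lambda>x. F (q n x)) \<in> borel_measurable lborel" for n
      using cF[of n] by (simp add: borel_measurable_continuous_onI)
    have "continuous_on UNIV (\<lambda>x. F (grad p x \<bullet> y))"
      using continuous_on_compose2[OF F(1), of UNIV "\<lambda>x. grad p x \<bullet> y"]
        continuous_on_grad[OF test_smooth[OF p], of UNIV] by (simp add: continuous_on_inner)
    then show "(\<lambda>x. F (grad p x \<bullet> y)) \<in> borel_measurable lborel"
      by (simp add: borel_measurable_continuous_onI)
    show "AE x in lborel. (\<lambda>n. F (q n x)) \<longlonglongrightarrow> F (grad p x \<bullet> y)"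
    proof (rule AE_I2)
      fix x
      show "(\<lambda>n. F (q n x)) \<longlonglongrightarrow> F (grad p x \<bullet> y)"
        using continuous_on_tendsto_compose[OF F(1) ql[of x]] by simp
    qed
    show "AE x in lborel. norm (F (q n x)) \<le> indicator L x *\<^sub>R M" for n
    proof (rule AE_I2)
      fix x
      show "norm (F (q n x)) \<le> indicator L x *\<^sub>R M"
        using M[of "q n x"] qb[of n x] q0[of x n] F(2) by (cases "x \<in> L") (auto simp: abs_le_iff)
    qed
  qed
  then show ?thesis by (simp add: q_def)
qed

text \<open>Difference quotients have integral zero by translation invariance. Applied to a product
  of test functions this is integration by parts in any dimension, without iterated
  integrals.\<close>

lemma integral_grad_zero:
  fixes p :: "'a::euclidean_space \<Rightarrow> real"
  assumes p: "p \<in> test_functions U"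
  shows "(LINT x|lborel. grad p x \<bullet> y) = 0"
proof (rule LIMSEQ_unique)
  show "(\<lambda>n. LINT x|lborel. real (Suc n) * (p (x + (1 / real (Suc n)) *\<^sub>R y) - p x))
    \<longlonglongrightarrow> (LINT x|lborel. grad p x \<bullet> y)"
    using difference_quotient_integral_tendsto[OF p, of "\<lambda>s. s"] by simp
  have c: "ccs UNIV p" using ccs_mono[OF ccs_test[OF p]] by simp
  have "(LINT x|lborel. real (Suc n) * (p (x + (1 / real (Suc n)) *\<^sub>R y) - p x)) = 0" for n
    using ccs_integrable_lborel[OF c] ccs_integrable_lborel[OF ccs_translate[OF c]]
    by (simp add: integral_translate_lborel[OF c])
  then show "(\<lambda>n. LINT x|lborel. real (Suc n) * (p (x + (1 / real (Suc n)) *\<^sub>R y) - p x)) \<longlonglongrightarrow> 0"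
    by simp
qed

lemma integration_by_parts:
  assumes "\<phi> \<in> test_functions U" "\<theta> \<in> test_functions U" "b \<in> Basis"
  shows "(LINT x|lborel. \<phi> x * dir_deriv b \<theta> x) = - (LINT x|lborel. dir_deriv b \<phi> x * \<theta> x)"
proof -
  have s: "smooth \<phi>" using assms by (simp add: test_smooth)
  have t: "(\<lambda>x. \<phi> x * \<theta> x) \<in> test_functions U"
    by (rule test_smooth_mult[OF assms(2) s])
  have "grad (\<lambda>x. \<phi> x * \<theta> x) x \<bullet> b = \<phi> x * dir_deriv b \<theta> x + dir_deriv b \<phi> x * \<theta> x" for x
    using assms by (simp add: grad_inner_Basis dir_deriv_mult test_differentiable)
  with integral_grad_zero[OF t, of b]
  have "(LINT x|lborel. \<phi> x * dir_deriv b \<theta> x + dir_deriv b \<phi> x * \<theta> x) = 0" by simp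
  moreover have "integrable lborel (\<lambda>x. \<phi> x * dir_deriv b \<theta> x)"
    using ccs_integrable_lborel[OF ccs_test[OF test_smooth_mult[OF test_dir_deriv[OF assms(2,3)] s]]] .
  moreover have "integrable lborel (\<lambda>x. dir_deriv b \<phi> x * \<theta> x)"
    using ccs_integrable_lborel[OF ccs_test[OF test_smooth_mult[OF assms(2) smooth_dir_deriv[OF s assms(3)]]]] .
  ultimately show ?thesis by simp
qed

text \<open>The shift by \<open>y\<close> is cut into \<open>n + 1\<close> equal shifts. The
  triangle inequality and translation invariance bound the whole difference by the norm of a
  difference quotient, for every \<open>n\<close>, and the limit is the derivative along
  \<open>y\<close>. This replaces Minkowski's integral inequality along the segment.\<close>

lemma translation_estimate:
  fixes p :: "'a::euclidean_space \<Rightarrow> real"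
  assumes p: "p \<in> test_functions U"
  shows "L2_norm UNIV (\<lambda>x. p (x + y) - p x) \<le> norm y * L2_norm UNIV (grad p)"
proof -
  have U: "UNIV \<in> sets lebesgue" by simp
  have c: "ccs UNIV p" using ccs_mono[OF ccs_test[OF p]] by simp
  have cd: "ccs UNIV (\<lambda>x. p (x + z) - p (x + w))" for z w
    by (rule ccs_diff[OF ccs_translate[OF c] ccs_translate[OF c]])
  have L: "(\<lambda>x. p (x + z) - p (x + w)) \<in> L2 UNIV" for z w
    by (rule ccs_L2[OF cd U])
  have shift: "L2_norm UNIV (\<lambda>x. p (x + (z + w)) - p (x + w)) = L2_norm UNIV (\<lambda>x. p (x + z) - p x)" for z w
  proof -
    have cc: "ccs UNIV (\<lambda>x. (p (x + z) - p x)\<^sup>2)"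
      using ccs_compose[OF cd[of z 0], of "\<lambda>s. s\<^sup>2"] by (simp add: continuous_on_power)
    show ?thesis
      using L2_inner_ccs[OF cd cd U, of "z + w" w "z + w" w] L2_inner_ccs[OF cd cd U, of z 0 z 0]
        integral_translate_lborel[OF cc, of w]
      by (simp add: L2_norm_def power2_eq_square add.assoc add.commute[of w])
  qed
  have multi: "L2_norm UNIV (\<lambda>x. p (x + real n *\<^sub>R z) - p x) \<le> real n * L2_norm UNIV (\<lambda>x. p (x + z) - p x)" for n z
  proof (induction n)
    case 0
    then show ?case by (simp add: L2_norm_def L2_inner_def)
  next
    case (Suc n)
    have "L2_norm UNIV (\<lambda>x. p (x + real (Suc n) *\<^sub>R z) - p x)
      = L2_norm UNIV (\<lambda>x. (p (x + (z + real n *\<^sub>R z)) - p (x + real n *\<^sub>R z)) + (p (x + real n *\<^sub>R z) - p (x + 0)))"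
      by (simp add: algebra_simps)
    also have "\<dots> \<le> L2_norm UNIV (\<lambda>x. p (x + (z + real n *\<^sub>R z)) - p (x + real n *\<^sub>R z))
        + L2_norm UNIV (\<lambda>x. p (x + real n *\<^sub>R z) - p (x + 0))"
      by (rule L2_triangle[OF L L])
    also have "\<dots> \<le> L2_norm UNIV (\<lambda>x. p (x + z) - p x) + real n * L2_norm UNIV (\<lambda>x. p (x + z) - p x)"
      using Suc by (simp add: shift)
    finally show ?case by (simp add: algebra_simps)
  qed
  define q where "q n x = real (Suc n) * (p (x + (1 / real (Suc n)) *\<^sub>R y) - p x)" for n x
  have le: "L2_norm UNIV (\<lambda>x. p (x + y) - p x) \<le> sqrt (LINT x|lborel. (q n x)\<^sup>2)" for n
  proof -
    have "L2_norm UNIV (\<lambda>x. p (x + y) - p x)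
      \<le> real (Suc n) * L2_norm UNIV (\<lambda>x. p (x + (1 / real (Suc n)) *\<^sub>R y) - p x)"
      using multi[of "Suc n" "(1 / real (Suc n)) *\<^sub>R y"] by (simp del: of_nat_Suc)
    also have "\<dots> = L2_norm UNIV (q n)"
      using L2_norm_scale[of UNIV "real (Suc n)" "\<lambda>x. p (x + (1 / real (Suc n)) *\<^sub>R y) - p x"]
      unfolding q_def by (simp only: real_scaleR_def abs_of_nat)
    also have "\<dots> = sqrt (LINT x|lborel. (q n x)\<^sup>2)"
    proof -
      have "ccs UNIV (q n)"
        unfolding q_def using ccs_compose[OF cd[of "(1 / real (Suc n)) *\<^sub>R y" 0], of "\<lambda>s. real (Suc n) * s"]
        by (simp add: continuous_on_mult_left del: of_nat_Suc)
      from L2_inner_ccs[OF this this U] show ?thesis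
        by (simp add: L2_norm_def power2_eq_square)
    qed
    finally show ?thesis .
  qed
  have "(\<lambda>n. LINT x|lborel. (q n x)\<^sup>2) \<longlonglongrightarrow> (LINT x|lborel. (grad p x \<bullet> y)\<^sup>2)"
    using difference_quotient_integral_tendsto[OF p, of "\<lambda>s. s\<^sup>2" y]
    by (simp add: q_def continuous_on_power del: of_nat_Suc)
  then have "(\<lambda>n. sqrt (LINT x|lborel. (q n x)\<^sup>2)) \<longlonglongrightarrow> sqrt (LINT x|lborel. (grad p x \<bullet> y)\<^sup>2)"
    by (rule tendsto_real_sqrt)
  then have "L2_norm UNIV (\<lambda>x. p (x + y) - p x) \<le> sqrt (LINT x|lborel. (grad p x \<bullet> y)\<^sup>2)"
    by (rule LIMSEQ_le_const) (use le in blast)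
  also have "\<dots> \<le> sqrt ((norm y)\<^sup>2 * L2_inner UNIV (grad p) (grad p))"
  proof -
    have g: "ccs UNIV (grad p)" using ccs_mono[OF ccs_grad[OF p]] by simp
    have gy: "ccs UNIV (\<lambda>x. grad p x \<bullet> y)" by (rule ccs_inner[OF g continuous_on_const])
    have "(LINT x|lborel. (grad p x \<bullet> y)\<^sup>2) \<le> (LINT x|lborel. (norm y)\<^sup>2 * (grad p x \<bullet> grad p x))"
    proof (rule integral_mono)
      show "integrable lborel (\<lambda>x. (grad p x \<bullet> y)\<^sup>2)"
        using ccs_integrable_lborel[OF ccs_compose[OF gy, of "\<lambda>s. s\<^sup>2"]] by (simp add: continuous_on_power)
      have "integrable lborel (\<lambda>x. grad p x \<bullet> grad p x)"
        using g by (intro ccs_integrable_lborel[of UNIV] ccs_inner[OF g]) (simp add: ccs_def)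
      then show "integrable lborel (\<lambda>x. (norm y)\<^sup>2 * (grad p x \<bullet> grad p x))" by simp
      show "(grad p x \<bullet> y)\<^sup>2 \<le> (norm y)\<^sup>2 * (grad p x \<bullet> grad p x)" for x
        using Cauchy_Schwarz_ineq[of "grad p x" y] by (simp add: power2_norm_eq_inner mult.commute)
    qed
    then show ?thesis by (simp add: L2_inner_ccs[OF g g U])
  qed
  also have "\<dots> = norm y * L2_norm UNIV (grad p)"
    by (simp add: real_sqrt_mult L2_norm_def)
  finally show ?thesis .
qed

subsection \<open>A Nash inequality\<close>

lemma L2_norm_UNIV_test:
  assumes "ccs \<Omega> f" "open \<Omega>"
  shows "L2_norm UNIV f = L2_norm \<Omega> f"
proof -
  have "ccs UNIV f" by (rule ccs_mono[OF assms(1)]) simp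
  then show ?thesis
    using assms by (simp add: L2_norm_def L2_inner_ccs)
qed

text \<open>Compare \<open>p\<close> with its averages over cubes of side \<open>r\<close>: the error is bounded by the gradient,
  the averages are bounded by \<open>r\<close> to the power \<open>- DIM('a)\<close> times the mass.\<close>

lemma Nash_inequality:
  fixes p :: "'a::euclidean_space \<Rightarrow> real"
  assumes p: "p \<in> test_functions \<Omega>" and \<Omega>: "open \<Omega>" and r: "r > 0"
  shows "(L2_norm \<Omega> p)\<^sup>2 \<le> (real DIM('a) * r)\<^sup>2 * (L2_norm \<Omega> (grad p))\<^sup>2
    + 2 / r ^ DIM('a) * (LINT x|lebesgue_on \<Omega>. \<bar>p x\<bar>)\<^sup>2"
proof -
  define P where "P = L2_norm UNIV p"
  define G where "G = L2_norm UNIV (grad p)"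
  define m where "m = (LINT x|lborel. \<bar>p x\<bar>)"
  define n where "n = real DIM('a)"
  define Q where "Q = cbox 0 (r *\<^sub>R One :: 'a)"
  have U: "UNIV \<in> sets lebesgue" by simp
  have c: "ccs UNIV p" using ccs_mono[OF ccs_test[OF p]] by simp
  have pc: "continuous_on UNIV p" using p by (simp add: smooth_continuous test_smooth)
  have meas_Q: "measure lborel Q = r ^ DIM('a)"
    using r by (simp add: Q_def measure_lborel_cbox_eq)
  have norm_Q: "norm y \<le> n * r" if "y \<in> Q" for y
  proof -
    have "norm y \<le> (\<Sum>b\<in>Basis. \<bar>y \<bullet> b\<bar>)" by (rule norm_le_l1)
    also have "\<dots> \<le> (\<Sum>b\<in>(Basis::'a set). r)"
      using that by (intro sum_mono) (auto simp: Q_def mem_box)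
    finally show ?thesis by (simp add: n_def)
  qed
  have iabs: "integrable lborel (\<lambda>x. \<bar>p x\<bar>)"
    using ccs_integrable_lborel[OF c] by simp
  have m0: "m \<ge> 0" by (simp add: m_def)
  obtain K where K: "compact K" "\<And>x. x \<notin> K \<Longrightarrow> p x = 0"
    using test_support[OF p] by blast
  \<comment> \<open>On the cube, \<open>(p x)\<^sup>2\<close> splits as
    \<open>p x * (p x - p (x + y)) + p x * p (x + y)\<close>: \<open>h\<close> carries the
    oscillation, \<open>k\<close> the average.\<close>
  define h where "h x y = indicator Q y * (p x * (p x - p (x + y)))" for x y
  define k where "k x y = indicator Q y * (p x * p (x + y))" for x y
  have int2: "integrable (lborel \<Otimes>\<^sub>M lborel) (\<lambda>(x, y). indicator Q y * (p x * F x y))"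
    if F: "continuous_on UNIV (\<lambda>z. F (fst z) (snd z))" for F
  proof -
    have "integrable lborel (\<lambda>z. indicator (K \<times> Q) z *\<^sub>R (p (fst z) * F (fst z) (snd z)))"
      by (intro borel_integrable_compact compact_Times K continuous_on_mult
          continuous_on_compose2[OF pc] continuous_on_subset[OF F] continuous_on_fst continuous_on_id)
        (auto simp: Q_def)
    moreover have "(\<lambda>z. indicator (K \<times> Q) z *\<^sub>R (p (fst z) * F (fst z) (snd z))) =
        (\<lambda>(x, y). indicator Q y * (p x * F x y))"
      using K(2) by (auto simp: fun_eq_iff indicator_def)
    ultimately show ?thesis by (simp add: lborel_prod)
  qed
  have cpp: "continuous_on UNIV (\<lambda>z. p (fst z + snd z))"
    by (intro continuous_on_compose2[OF pc] continuous_intros) auto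
  have ih: "integrable (lborel \<Otimes>\<^sub>M lborel) (\<lambda>(x, y). h x y)"
    unfolding h_def by (intro int2 continuous_on_diff cpp continuous_on_compose2[OF pc] continuous_intros) auto
  have ik: "integrable (lborel \<Otimes>\<^sub>M lborel) (\<lambda>(x, y). k x y)"
    unfolding k_def by (intro int2 cpp)
  have iQ: "integrable lborel (\<lambda>y. indicator Q y * f y)" if "continuous_on UNIV f" for f :: "'a \<Rightarrow> real"
    using borel_integrable_compact[of Q f] that continuous_on_subset[of UNIV f Q] by (simp add: Q_def)
  have sum: "r ^ DIM('a) * (p x)\<^sup>2 = (LINT y|lborel. h x y) + (LINT y|lborel. k x y)" for x
  proof -
    have "(LINT y|lborel. h x y) + (LINT y|lborel. k x y) = (LINT y|lborel. h x y + k x y)"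
      unfolding h_def k_def
      by (intro Bochner_Integration.integral_add[symmetric] iQ continuous_intros
          continuous_on_compose2[OF pc]) auto
    also have "\<dots> = (LINT y|lborel. (p x)\<^sup>2 * indicator Q y)"
      by (intro Bochner_Integration.integral_cong)
        (auto simp: h_def k_def indicator_def power2_eq_square algebra_simps)
    also have "\<dots> = r ^ DIM('a) * (p x)\<^sup>2"
      by (simp add: meas_Q[symmetric] mult.commute)
    finally show ?thesis by simp
  qed
  have I1: "(LINT x|lborel. LINT y|lborel. h x y) \<le> r ^ DIM('a) * (P * (n * r * G))"
  proof -
    \<comment> \<open>With \<open>x\<close> innermost, each fixed shift \<open>y\<close> is handled
      by Cauchy-Schwarz and the translation estimate.\<close>
    have "(LINT x|lborel. LINT y|lborel. h x y) = (LINT y|lborel. LINT x|lborel. h x y)"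
      using lborel_pair.Fubini_integral[of "\<lambda>x y. h x y"] ih by simp
    also have "\<dots> \<le> (LINT y|lborel. indicator Q y * (P * (n * r * G)))"
    proof (rule integral_mono)
      show "integrable lborel (\<lambda>y. LINT x|lborel. h x y)"
        using lborel_pair.integrable_snd[OF ih] by simp
      show "integrable lborel (\<lambda>y. indicator Q y * (P * (n * r * G)))"
        by (intro iQ continuous_on_const)
      fix y
      show "(LINT x|lborel. h x y) \<le> indicator Q y * (P * (n * r * G))"
      proof (cases "y \<in> Q")
        case True
        have cd: "ccs UNIV (\<lambda>x. p (x + y) - p x)"
          by (rule ccs_diff[OF ccs_translate[OF c] c])
        have "(LINT x|lborel. h x y) = - L2_inner UNIV p (\<lambda>x. p (x + y) - p x)"
          using True by (simp add: L2_inner_ccs[OF c cd U] h_def flip: integral_minus)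
            (simp add: algebra_simps)
        also have "\<dots> \<le> P * L2_norm UNIV (\<lambda>x. p (x + y) - p x)"
          using L2_Cauchy_Schwarz[OF ccs_L2[OF c U] ccs_L2[OF cd U]] by (simp add: P_def)
        also have "\<dots> \<le> P * (norm y * G)"
          unfolding G_def P_def by (intro mult_left_mono translation_estimate[OF p]) simp
        also have "\<dots> \<le> P * (n * r * G)"
          unfolding G_def P_def by (intro mult_left_mono mult_right_mono norm_Q True) simp_all
        finally show ?thesis using True by simp
      qed (simp add: h_def)
    qed
    also have "\<dots> = r ^ DIM('a) * (P * (n * r * G))"
      by (simp add: meas_Q[symmetric])
    finally show ?thesis .
  qed
  have I2: "(LINT x|lborel. LINT y|lborel. k x y) \<le> m\<^sup>2"
  proof -
    have "(LINT x|lborel. LINT y|lborel. k x y) \<le> (LINT x|lborel. \<bar>p x\<bar> * m)"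
    proof (rule integral_mono)
      show "integrable lborel (\<lambda>x. LINT y|lborel. k x y)"
        using lborel_pair.integrable_fst[OF ik] by simp
      show "integrable lborel (\<lambda>x. \<bar>p x\<bar> * m)" using iabs by simp
      fix x
      have ca: "ccs UNIV (\<lambda>x. \<bar>p x\<bar>)"
        by (rule ccs_compose[OF c]) (auto intro: continuous_on_rabs)
      have "(LINT y|lborel. k x y) \<le> (LINT y|lborel. \<bar>p x\<bar> * \<bar>p (y + x)\<bar>)"
      proof (rule integral_mono)
        show "integrable lborel (\<lambda>y. k x y)"
          unfolding k_def by (intro iQ continuous_intros continuous_on_compose2[OF pc]) auto
        show "integrable lborel (\<lambda>y. \<bar>p x\<bar> * \<bar>p (y + x)\<bar>)"
          using ccs_integrable_lborel[OF ccs_translate[OF ca, of x]] by simp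
        show "k x y \<le> \<bar>p x\<bar> * \<bar>p (y + x)\<bar>" for y
          using abs_ge_self[of "p x * p (x + y)"]
          by (auto simp: k_def indicator_def abs_mult add.commute)
      qed
      also have "\<dots> = \<bar>p x\<bar> * m"
        by (simp add: m_def integral_translate_lborel[OF ca])
      finally show "(LINT y|lborel. k x y) \<le> \<bar>p x\<bar> * m" .
    qed
    then show ?thesis by (simp add: m_def power2_eq_square)
  qed
  have "r ^ DIM('a) * P\<^sup>2 = (LINT x|lborel. r ^ DIM('a) * (p x)\<^sup>2)"
    unfolding P_def L2_norm_power2 using L2_inner_ccs[OF c c U] by (simp add: power2_eq_square)
  also have "\<dots> = (LINT x|lborel. LINT y|lborel. h x y) + (LINT x|lborel. LINT y|lborel. k x y)"
    unfolding sum using lborel_pair.integrable_fst[OF ih] lborel_pair.integrable_fst[OF ik]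
    by (intro Bochner_Integration.integral_add) simp_all
  also have "\<dots> \<le> r ^ DIM('a) * (P * (n * r * G)) + m\<^sup>2"
    using I1 I2 by simp
  finally have "P\<^sup>2 \<le> P * (n * r * G) + m\<^sup>2 / r ^ DIM('a)"
    using r by (simp add: field_simps)
  \<comment> \<open>Half of \<open>P\<^sup>2\<close> is absorbed on the left; this doubles the mass
    term, whence the factor 2 in the statement.\<close>
  moreover have "P * (n * r * G) \<le> P\<^sup>2 / 2 + (n * r * G)\<^sup>2 / 2"
    using sum_squares_bound[of P "n * r * G"] by simp
  ultimately have "P\<^sup>2 \<le> (n * r)\<^sup>2 * G\<^sup>2 + 2 / r ^ DIM('a) * m\<^sup>2"
    by (simp add: power_mult_distrib)
  moreover have "ccs \<Omega> (\<lambda>x. \<bar>p x\<bar>)"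
    by (rule ccs_compose[OF ccs_test[OF p]]) (auto intro: continuous_on_rabs)
  ultimately show ?thesis
    unfolding P_def G_def m_def n_def
    using \<Omega> L2_norm_UNIV_test[OF ccs_test[OF p] \<Omega>] L2_norm_UNIV_test[OF ccs_grad[OF p] \<Omega>]
    by (simp add: ccs_integral_on)
qed

subsection \<open>The fundamental lemma of the calculus of variations\<close>

text \<open>Meant for \<open>s \<ge> 0\<close>, where it increases from 0 towards 1 with slope at
  most \<open>1 / \<delta>\<close>; for negative \<open>s\<close> it is unbounded below. Unlike a
  compactly varying cutoff it has an explicit derivative.\<close>

definition sat :: "real \<Rightarrow> real \<Rightarrow> real" where
  "sat \<delta> s = 1 - (sqrt (s\<^sup>2 + \<delta>\<^sup>2) - s) / \<delta>"

lemma sat_zero [simp]: "\<delta> > 0 \<Longrightarrow> sat \<delta> 0 = 0"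
  by (simp add: sat_def)

lemma smooth_sat:
  assumes "\<delta> > 0"
  shows "smooth (sat \<delta>)"
proof -
  have "smooth (\<lambda>s. 1 + ((- 1 / \<delta>) * sqrt (s\<^sup>2 + \<delta>\<^sup>2) + (1 / \<delta>) * s))"
    by (intro smooth_add smooth_const smooth_mult smooth_sqrt_quadratic assms smooth_linear
        bounded_linear_ident)
  moreover have "sat \<delta> = (\<lambda>s. 1 + ((- 1 / \<delta>) * sqrt (s\<^sup>2 + \<delta>\<^sup>2) + (1 / \<delta>) * s))"
    by (simp add: fun_eq_iff sat_def diff_divide_distrib)
  ultimately show ?thesis by simp
qed

lemma sqrt_quadratic_has_derivative:
  assumes "\<delta> > 0"
  shows "((\<lambda>s. sqrt (s\<^sup>2 + \<delta>\<^sup>2)) has_real_derivative s / sqrt (s\<^sup>2 + \<delta>\<^sup>2)) (at s)"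
proof -
  have "s\<^sup>2 + \<delta>\<^sup>2 > 0" using assms by (simp add: add_nonneg_pos)
  then show ?thesis by (auto intro!: derivative_eq_intros simp: field_simps)
qed

lemma sat_has_derivative:
  assumes "\<delta> > 0"
  shows "(sat \<delta> has_real_derivative (1 - s / sqrt (s\<^sup>2 + \<delta>\<^sup>2)) / \<delta>) (at s)"
proof -
  have "((\<lambda>s. 1 - (sqrt (s\<^sup>2 + \<delta>\<^sup>2) - s) / \<delta>) has_real_derivative
      0 - (s / sqrt (s\<^sup>2 + \<delta>\<^sup>2) - 1) / \<delta>) (at s)"
    by (intro DERIV_diff DERIV_const DERIV_cdivide DERIV_ident sqrt_quadratic_has_derivative assms)
  then show ?thesis by (simp add: sat_def[abs_def] diff_divide_distrib)
qed

lemma abs_less_sqrt_quadratic: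
  fixes s \<delta> :: real
  assumes "\<delta> > 0"
  shows "\<bar>s\<bar> < sqrt (s\<^sup>2 + \<delta>\<^sup>2)"
  using assms by (intro real_less_rsqrt) simp

lemma sqrt_quadratic_le:
  fixes s \<delta> :: real
  assumes "\<delta> > 0"
  shows "sqrt (s\<^sup>2 + \<delta>\<^sup>2) \<le> \<bar>s\<bar> + \<delta>"
  using assms by (intro real_le_lsqrt) (auto simp: power2_sum)

lemma sat_deriv_nonneg:
  assumes "\<delta> > 0"
  shows "0 \<le> (1 - s / sqrt (s\<^sup>2 + \<delta>\<^sup>2)) / \<delta>"
proof -
  have "s / sqrt (s\<^sup>2 + \<delta>\<^sup>2) \<le> 1"
    using abs_less_sqrt_quadratic[OF assms, of s] assms
    by (subst divide_le_eq_1_pos) (auto simp: add_nonneg_pos)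
  then show ?thesis using assms by simp
qed

lemma sat_deriv_le:
  assumes "\<delta> > 0" "s \<ge> 0"
  shows "(1 - s / sqrt (s\<^sup>2 + \<delta>\<^sup>2)) / \<delta> \<le> 1 / \<delta>"
  using assms by (intro divide_right_mono) auto

lemma sat_bounds:
  assumes "\<delta> > 0" "s \<ge> 0"
  shows "0 \<le> sat \<delta> s" "sat \<delta> s \<le> 1"
  using assms abs_less_sqrt_quadratic[OF assms(1), of s] sqrt_quadratic_le[OF assms(1), of s]
  by (auto simp: sat_def divide_le_eq)

text \<open>With \<open>q = sqrt (s\<^sup>2 + \<delta>\<^sup>2)\<close> one has
  \<open>(q + s) * (q - s) = \<delta>\<^sup>2\<close>, so the loss
  \<open>s * (q - s) / \<delta>\<close> is at most \<open>\<delta>\<close>, uniformly in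
  \<open>s\<close>. Hence recovering a mass from a saturated test costs only \<open>\<delta>\<close>
  times the measure of the domain.\<close>

lemma mult_sat_ge:
  assumes "\<delta> > 0" "s \<ge> 0"
  shows "s \<le> s * sat \<delta> s + \<delta>"
proof -
  define q where "q = sqrt (s\<^sup>2 + \<delta>\<^sup>2)"
  have q: "s < q" using abs_less_sqrt_quadratic[OF assms(1), of s] assms by (simp add: q_def)
  have "s * (q - s) \<le> (q + s) * (q - s)"
    using q assms by (intro mult_right_mono) auto
  also have "\<dots> = \<delta>\<^sup>2"
    using assms by (simp add: q_def algebra_simps flip: power2_eq_square)
  finally have "s * (q - s) / \<delta> \<le> \<delta>"
    using assms by (simp add: divide_le_eq power2_eq_square)
  moreover have "sat \<delta> s = 1 - (q - s) / \<delta>" by (simp add: sat_def q_def)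
  ultimately show ?thesis by (simp add: right_diff_distrib)
qed

lemma sat_tendsto:
  assumes "s > 0"
  shows "(\<lambda>n. sat (1 / real (Suc n)) s) \<longlonglongrightarrow> 1"
proof (rule tendsto_sandwich[OF _ _ _ tendsto_const])
  have "(\<lambda>n. 1 - (1 / real (Suc n)) / s) \<longlonglongrightarrow> 1 - 0 / s"
    by (intro tendsto_intros LIMSEQ_Suc[OF lim_1_over_n]) (use assms in auto)
  then show "(\<lambda>n. 1 - (1 / real (Suc n)) / s) \<longlonglongrightarrow> 1" by simp
  show "\<forall>\<^sub>F n in sequentially. 1 - (1 / real (Suc n)) / s \<le> sat (1 / real (Suc n)) s"
  proof (rule always_eventually, rule allI)
    fix n
    have "s * (1 - (1 / real (Suc n)) / s) \<le> s * sat (1 / real (Suc n)) s"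
    proof -
      have "s * ((1 / real (Suc n)) / s) = 1 / real (Suc n)" using assms by simp
      then show ?thesis
        using mult_sat_ge[of "1 / real (Suc n)" s] assms by (simp add: right_diff_distrib del: of_nat_Suc)
    qed
    then show "1 - (1 / real (Suc n)) / s \<le> sat (1 / real (Suc n)) s"
      using assms by (subst (asm) mult_le_cancel_left_pos)
  qed
  show "\<forall>\<^sub>F n in sequentially. sat (1 / real (Suc n)) s \<le> 1"
    using assms by (intro always_eventually allI sat_bounds) auto
qed

text \<open>A finite sum of bumps is positive exactly on a union \<open>V\<close> of balls, and
  \<open>sat\<close> with parameter tending to 0 turns it into the indicator of \<open>V\<close>.
  The limit is thus an open neighbourhood of \<open>K\<close>, not \<open>K\<close> itself.\<close>

lemma test_approximates_indicator:
  fixes K U :: "'a::euclidean_space set"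
  assumes "compact K" "open U" "K \<subseteq> U"
  obtains V \<psi> where "open V" "K \<subseteq> V" "V \<subseteq> U" "\<And>n. \<psi> n \<in> test_functions U"
    "\<And>n x. 0 \<le> \<psi> n x" "\<And>n x. \<psi> n x \<le> 1"
    "\<And>x. (\<lambda>n::nat. \<psi> n x) \<longlonglongrightarrow> indicator V x"
proof -
  have "\<exists>r>0. cball x r \<subseteq> U" if "x \<in> K" for x
    using assms that by (meson open_contains_cball subsetD)
  then obtain r where r: "\<And>x. x \<in> K \<Longrightarrow> r x > 0" "\<And>x. x \<in> K \<Longrightarrow> cball x (r x) \<subseteq> U"
    by metis
  have "K \<subseteq> (\<Union>x\<in>K. ball x (r x))" using r(1) by force
  then obtain X where X: "X \<subseteq> K" "finite X" "K \<subseteq> (\<Union>x\<in>X. ball x (r x))"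
    using compactE_image[OF assms(1), of K "\<lambda>x. ball x (r x)"] by blast
  define \<sigma> where "\<sigma> z = (\<Sum>x\<in>X. bump x (r x) z)" for z
  have \<sigma>t: "\<sigma> \<in> test_functions U"
    unfolding \<sigma>_def using X(1) r by (intro test_sum bump_test) blast+
  have \<sigma>0: "\<sigma> z \<ge> 0" for z unfolding \<sigma>_def by (intro sum_nonneg bump_nonneg)
  define V where "V = (\<Union>x\<in>X. ball x (r x))"
  have \<sigma>V: "\<sigma> z > 0" if zV: "z \<in> V" for z
  proof -
    obtain x where x: "x \<in> X" "z \<in> ball x (r x)" using zV unfolding V_def by blast
    then have "bump x (r x) z > 0" using X r by (subst bump_pos_iff) auto
    also have "bump x (r x) z \<le> \<sigma> z"
      unfolding \<sigma>_def using x X bump_nonneg by (intro member_le_sum) auto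
    finally show ?thesis .
  qed
  have \<sigma>V0: "\<sigma> z = 0" if "z \<notin> V" for z
    unfolding \<sigma>_def
  proof (rule sum.neutral, rule ballI)
    fix x assume "x \<in> X"
    then show "bump x (r x) z = 0"
      using that X r by (subst bump_eq_0_iff) (auto simp: V_def)
  qed
  show ?thesis
  proof (rule that[of V "\<lambda>n z. sat (1 / real (Suc n)) (\<sigma> z)"])
    show "open V" "K \<subseteq> V" using X by (auto simp: V_def)
    show "V \<subseteq> U" using X(1) r(2) ball_subset_cball unfolding V_def by fast
    show "(\<lambda>z. sat (1 / real (Suc n)) (\<sigma> z)) \<in> test_functions U" for n
      using test_compose[OF \<sigma>t smooth_sat[of "1 / real (Suc n)"]] by simp
    show "0 \<le> sat (1 / real (Suc n)) (\<sigma> x)" "sat (1 / real (Suc n)) (\<sigma> x) \<le> 1" for n x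
      using sat_bounds[OF _ \<sigma>0[of x], of "1 / real (Suc n)"] by simp_all
    show "(\<lambda>n. sat (1 / real (Suc n)) (\<sigma> x)) \<longlonglongrightarrow> indicator V x" for x
      using sat_tendsto[OF \<sigma>V[of x]] \<sigma>V0[of x] by (cases "x \<in> V") simp_all
  qed
qed

text \<open>Two limits: test functions tend to the indicator of an open \<open>V k\<close> that
  contains \<open>K\<close> and lies within distance \<open>1 / (k + 1)\<close> of it, then
  \<open>V k\<close> shrinks to \<open>K\<close>. Both are dominated by the integrable
  \<open>w\<close>.\<close>

lemma integral_compact_nonneg:
  fixes w :: "'a::euclidean_space \<Rightarrow> real"
  assumes U: "open U" and w: "integrable (lebesgue_on U) w"
    and pos: "\<And>\<psi>. \<psi> \<in> test_functions U \<Longrightarrow> (\<And>x. \<psi> x \<ge> 0) \<Longrightarrow> (LINT x|lebesgue_on U. w x * \<psi> x) \<ge> 0"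
    and K: "compact K" "K \<subseteq> U"
  shows "(LINT x|lebesgue_on U. indicator K x * w x) \<ge> 0"
proof (cases "K = {}")
  case True
  then show ?thesis by simp
next
  case False
  have wm: "w \<in> borel_measurable (lebesgue_on U)" using w by simp
  have meas: "(\<lambda>x. indicator A x * w x) \<in> borel_measurable (lebesgue_on U)" if "A \<in> sets borel" for A
  proof -
    have "(indicator A :: 'a \<Rightarrow> real) \<in> borel_measurable lebesgue"
      using that by (intro borel_measurable_indicator sets_completionI_sets) simp
    then show ?thesis
      using wm by (intro borel_measurable_times measurable_restrict_space1[of "indicator A"]) auto
  qed
  define B where "B k = U \<inter> {x. infdist x K < 1 / real (Suc k)}" for k
  have B: "open (B k)" for k
    unfolding B_def using U
    by (intro open_Int open_Collect_less) (auto intro!: continuous_intros)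
  have KB: "K \<subseteq> B k" for k
    using K by (auto simp: B_def)
  have "\<exists>V. open V \<and> K \<subseteq> V \<and> V \<subseteq> B k \<and> (LINT x|lebesgue_on U. indicator V x * w x) \<ge> 0" for k
  proof -
    obtain V \<psi> where V: "open V" "K \<subseteq> V" "V \<subseteq> B k" "\<And>n. \<psi> n \<in> test_functions (B k)"
      and \<psi>: "\<And>n x. 0 \<le> \<psi> n x" "\<And>n x. \<psi> n x \<le> 1"
      and lim: "\<And>x. (\<lambda>n::nat. \<psi> n x) \<longlonglongrightarrow> indicator V x"
      using test_approximates_indicator[OF K(1) B KB] by blast
    have \<psi>t: "\<psi> n \<in> test_functions U" for n
      by (rule test_mono[OF V(4)]) (simp add: B_def)
    have "(\<lambda>n. LINT x|lebesgue_on U. w x * \<psi> n x) \<longlonglongrightarrow> (LINT x|lebesgue_on U. indicator V x * w x)"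
    proof (rule integral_dominated_convergence[where w = "\<lambda>x. norm (w x)"])
      show "(\<lambda>x. indicator V x * w x) \<in> borel_measurable (lebesgue_on U)"
        using V by (intro meas) simp
      show "(\<lambda>x. w x * \<psi> n x) \<in> borel_measurable (lebesgue_on U)" for n
        using wm ccs_integrable_on[OF ccs_test[OF \<psi>t[of n]]] U by (intro borel_measurable_times) auto
      show "AE x in lebesgue_on U. (\<lambda>n. w x * \<psi> n x) \<longlonglongrightarrow> indicator V x * w x"
        using tendsto_mult_left[OF lim] by (intro AE_I2) (simp add: mult.commute)
      show "AE x in lebesgue_on U. norm (w x * \<psi> n x) \<le> norm (w x)" for n
      proof (rule AE_I2)
        fix x
        show "norm (w x * \<psi> n x) \<le> norm (w x)"
          using mult_left_mono[OF \<psi>(2), of "\<bar>w x\<bar>" n x] \<psi>(1)[of n x] by (simp add: abs_mult)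
      qed
    qed (use w in simp)
    then have "0 \<le> (LINT x|lebesgue_on U. indicator V x * w x)"
      by (rule LIMSEQ_le_const) (use pos[OF \<psi>t \<psi>(1)] in blast)
    with V show ?thesis by blast
  qed
  then obtain V where V: "\<And>k. open (V k)" "\<And>k. K \<subseteq> V k" "\<And>k. V k \<subseteq> B k"
    "\<And>k. (LINT x|lebesgue_on U. indicator (V k) x * w x) \<ge> 0"
    by metis
  have "(\<lambda>k. LINT x|lebesgue_on U. indicator (V k) x * w x) \<longlonglongrightarrow> (LINT x|lebesgue_on U. indicator K x * w x)"
  proof (rule integral_dominated_convergence[where w = "\<lambda>x. norm (w x)"])
    show "(\<lambda>x. indicator K x * w x) \<in> borel_measurable (lebesgue_on U)"
      using K by (intro meas) (simp add: compact_imp_closed)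
    show "(\<lambda>x. indicator (V k) x * w x) \<in> borel_measurable (lebesgue_on U)" for k
      using V by (intro meas) simp
    show "AE x in lebesgue_on U. (\<lambda>k. indicator (V k) x * w x) \<longlonglongrightarrow> indicator K x * w x"
    proof (rule AE_I2)
      fix x
      show "(\<lambda>k. indicator (V k) x * w x) \<longlonglongrightarrow> indicator K x * w x"
      proof (cases "x \<in> K")
        case True
        then have "x \<in> V k" for k using V(2) by blast
        with True show ?thesis by simp
      next
        case False
        then have "infdist x K > 0"
          using K \<open>K \<noteq> {}\<close> in_closed_iff_infdist_zero[of K x] infdist_nonneg[of x K]
          by (simp add: compact_imp_closed less_le)
        then have "\<forall>\<^sub>F k in sequentially. 1 / real (Suc k) < infdist x K"
          using order_tendstoD(2)[OF LIMSEQ_Suc[OF lim_1_over_n]] by blast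
        then have "\<forall>\<^sub>F k in sequentially. indicator (V k) x * w x = 0"
        proof eventually_elim
          case (elim k)
          then have "x \<notin> B k" by (simp add: B_def)
          then have "x \<notin> V k" using V(3) by blast
          then show ?case by simp
        qed
        with False show ?thesis by (simp add: tendsto_eventually)
      qed
    qed
    show "AE x in lebesgue_on U. norm (indicator (V k) x * w x) \<le> norm (w x)" for k
      by (intro AE_I2) (auto simp: indicator_def)
  qed (use w in simp)
  then show ?thesis
    by (rule LIMSEQ_le_const) (use V(4) in blast)
qed

text \<open>Up to a null set, the set where \<open>w\<close> is negative is a countable union of
  compact sets. On each of them the integral of \<open>w\<close> is nonnegative although
  \<open>w < 0\<close> there, so it is null. The one-sided form is what later turns a dual bound
  into a pointwise one.\<close>

lemma fundamental_lemma_nonneg: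
  fixes w :: "'a::euclidean_space \<Rightarrow> real"
  assumes U: "open U" and w: "integrable (lebesgue_on U) w"
    and pos: "\<And>\<psi>. \<psi> \<in> test_functions U \<Longrightarrow> (\<And>x. \<psi> x \<ge> 0) \<Longrightarrow> (LINT x|lebesgue_on U. w x * \<psi> x) \<ge> 0"
  shows "AE x in lebesgue_on U. w x \<ge> 0"
proof -
  have wm: "w \<in> borel_measurable (lebesgue_on U)" using w by simp
  define N where "N = {x \<in> U. w x < 0}"
  have "{x \<in> space (lebesgue_on U). w x < 0} \<in> sets (lebesgue_on U)"
    using wm by measurable
  then have "N \<in> sets (lebesgue_on U)" by (simp add: N_def)
  then have N: "N \<in> sets lebesgue"
    using U by (auto simp: sets_restrict_space)
  then obtain C T where CT: "fsigma C" "T \<in> null_sets lebesgue" "C \<union> T = N"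
    using lebesgue_set_almost_fsigma by metis
  have cpt: "AE x in lebesgue_on U. x \<notin> K" if K: "compact K" "K \<subseteq> N" for K
  proof -
    have KU: "K \<subseteq> U" using K by (auto simp: N_def)
    have ik: "integrable (lebesgue_on U) (\<lambda>x. indicator K x * w x)"
    proof (rule Bochner_Integration.integrable_bound[OF w])
      have "(indicator K :: 'a \<Rightarrow> real) \<in> borel_measurable lebesgue"
        using K by (intro borel_measurable_indicator sets_completionI_sets) (simp add: borel_compact)
      then show "(\<lambda>x. indicator K x * w x) \<in> borel_measurable (lebesgue_on U)"
        using wm by (intro borel_measurable_times measurable_restrict_space1[of "indicator K"]) auto
    qed (intro AE_I2, auto simp: indicator_def)
    have np: "AE x in lebesgue_on U. 0 \<le> - (indicator K x * w x)"
      using K by (intro AE_I2) (auto simp: indicator_def N_def less_imp_le)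
    have "(LINT x|lebesgue_on U. - (indicator K x * w x)) = 0"
      using integral_compact_nonneg[OF U w pos K(1) KU] integral_nonneg_AE[OF np] by simp
    then have "AE x in lebesgue_on U. - (indicator K x * w x) = 0"
      by (subst (asm) integral_nonneg_eq_0_iff_AE) (use ik np in auto)
    then show ?thesis
      by (rule AE_mp) (use K in \<open>auto intro!: AE_I2 simp: indicator_def N_def\<close>)
  qed
  obtain F where F: "\<And>n::nat. closed (F n)" "C = (\<Union>n. F n)"
    using CT(1) by (auto simp: fsigma.simps)
  have "AE x in lebesgue_on U. x \<notin> F n \<inter> cball 0 (real j)" for n j
    using CT(3) F by (intro cpt closed_Int_compact compact_cball) auto
  then have "AE x in lebesgue_on U. \<forall>n j. x \<notin> F n \<inter> cball 0 (real j)"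
    by (subst AE_all_countable, intro allI, subst AE_all_countable, intro allI)
  then have 1: "AE x in lebesgue_on U. x \<notin> C"
  proof eventually_elim
    case (elim x)
    obtain j where "norm x \<le> real j" using real_arch_simple by blast
    with elim show ?case by (auto simp: F(2))
  qed
  have "AE x in lebesgue. x \<notin> T" using CT(2) by (rule AE_not_in)
  then have 2: "AE x in lebesgue_on U. x \<notin> T"
    using U by (subst AE_restrict_space_iff) auto
  show ?thesis
    using 1 2 AE_space[of "lebesgue_on U"]
  proof eventually_elim
    case (elim x)
    then have "x \<notin> N" "x \<in> U" using CT(3) by auto
    then show ?case by (simp add: N_def not_less)
  qed
qed

lemma fundamental_lemma:
  fixes w :: "'a::euclidean_space \<Rightarrow> real"
  assumes U: "open U" and w: "integrable (lebesgue_on U) w"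
    and zero: "\<And>\<psi>. \<psi> \<in> test_functions U \<Longrightarrow> (LINT x|lebesgue_on U. w x * \<psi> x) = 0"
  shows "AE x in lebesgue_on U. w x = 0"
proof -
  have "AE x in lebesgue_on U. w x \<ge> 0"
    by (rule fundamental_lemma_nonneg[OF U w]) (simp add: zero)
  moreover have "AE x in lebesgue_on U. - w x \<ge> 0"
    using w by (intro fundamental_lemma_nonneg[OF U]) (simp_all add: zero)
  ultimately show ?thesis by eventually_elim simp
qed

subsection \<open>Weak gradients\<close>

lemma L2_integrable:
  fixes f :: "'a::euclidean_space \<Rightarrow> real"
  assumes "f \<in> L2 \<Omega>" "open \<Omega>" "bounded \<Omega>"
  shows "integrable (lebesgue_on \<Omega>) f"
proof (rule Bochner_Integration.integrable_bound)
  have "\<Omega> \<in> lmeasurable" using assms by (simp add: lmeasurable_open)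
  then interpret finite_measure "lebesgue_on \<Omega>" by (rule finite_measure_lebesgue_on)
  show "integrable (lebesgue_on \<Omega>) (\<lambda>x. 1 + (norm (f x))\<^sup>2)"
    using L2_integrable_power2[OF assms(1)] by simp
  show "f \<in> borel_measurable (lebesgue_on \<Omega>)" using assms(1) by (rule L2_measurable)
  have "\<bar>f x\<bar> \<le> 1 + (f x)\<^sup>2" for x
    using sum_squares_bound[of 1 "\<bar>f x\<bar>"] abs_ge_zero[of "f x"] by simp
  then show "AE x in lebesgue_on \<Omega>. norm (f x) \<le> norm (1 + (norm (f x))\<^sup>2)"
    by (intro AE_I2) simp
qed

lemma ccs_locally_integrable:
  fixes f :: "'a::euclidean_space \<Rightarrow> real"
  assumes "ccs \<Omega> f"
  shows "locally_integrable \<Omega> f"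
  unfolding locally_integrable_def
proof (intro allI impI)
  fix K :: "'a set" assume "compact K \<and> K \<subseteq> \<Omega>"
  then have K: "K \<in> sets lebesgue" by (simp add: borel_compact sets_completionI_sets)
  have "ccs UNIV f" by (rule ccs_mono[OF assms]) simp
  then have "integrable lebesgue f"
    using ccs_integrable_on[of UNIV f] by (simp add: lebesgue_on_UNIV_eq)
  then show "f absolutely_integrable_on K"
    unfolding set_integrable_def by (rule integrable_mult_indicator[OF K])
qed

lemma has_weak_deriv_test:
  assumes "\<phi> \<in> test_functions \<Omega>" "open \<Omega>" "b \<in> Basis"
  shows "has_weak_deriv \<Omega> b \<phi> (dir_deriv b \<phi>)"
  unfolding has_weak_deriv_def
proof (intro conjI ballI)
  show "locally_integrable \<Omega> \<phi>" "locally_integrable \<Omega> (dir_deriv b \<phi>)"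
    using assms by (intro ccs_locally_integrable ccs_test test_dir_deriv; simp)+
  fix \<theta> assume \<theta>: "\<theta> \<in> test_functions \<Omega>"
  have "ccs \<Omega> (\<lambda>x. \<phi> x * dir_deriv b \<theta> x)" "ccs \<Omega> (\<lambda>x. dir_deriv b \<phi> x * \<theta> x)"
    using assms \<theta> by (auto intro!: ccs_test test_smooth_mult intro: test_smooth test_dir_deriv)
  then show "(LINT x|lebesgue_on \<Omega>. \<phi> x * dir_deriv b \<theta> x) = - (LINT x|lebesgue_on \<Omega>. dir_deriv b \<phi> x * \<theta> x)"
    using assms integration_by_parts[OF assms(1) \<theta> assms(3)] by (simp add: ccs_integral_on)
qed

lemma is_weak_grad_test:
  "\<phi> \<in> test_functions \<Omega> \<Longrightarrow> open \<Omega> \<Longrightarrow> is_weak_grad \<Omega> \<phi> (grad \<phi>)"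
  by (simp add: is_weak_grad_def grad_inner_Basis has_weak_deriv_test)

lemma L2_inner_Basis:
  assumes "G \<in> L2 \<Omega>"
  shows "(\<lambda>x. G x \<bullet> b) \<in> L2 \<Omega>"
proof (rule L2_I)
  show "(\<lambda>x. G x \<bullet> b) \<in> borel_measurable (lebesgue_on \<Omega>)"
    using assms by (intro borel_measurable_inner L2_measurable borel_measurable_const)
  show "integrable (lebesgue_on \<Omega>) (\<lambda>x. (norm b)\<^sup>2 * (norm (G x))\<^sup>2)"
    using L2_integrable_power2[OF assms] by simp
  show "(norm (G x \<bullet> b))\<^sup>2 \<le> (norm b)\<^sup>2 * (norm (G x))\<^sup>2" for x
    using Cauchy_Schwarz_ineq[of "G x" b] by (simp add: power2_norm_eq_inner[of b] power2_norm_eq_inner[of "G x"] mult.commute)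
qed

lemma L2_integrable_mult:
  fixes f g :: "'a::euclidean_space \<Rightarrow> real"
  shows "f \<in> L2 \<Omega> \<Longrightarrow> g \<in> L2 \<Omega> \<Longrightarrow> integrable (lebesgue_on \<Omega>) (\<lambda>x. f x * g x)"
  using L2_integrable_inner[of f \<Omega> g] by simp

lemma is_weak_grad_diff:
  assumes "is_weak_grad \<Omega> u G" "is_weak_grad \<Omega> v H" "u \<in> L2 \<Omega>" "v \<in> L2 \<Omega>" "G \<in> L2 \<Omega>" "H \<in> L2 \<Omega>"
    and "open \<Omega>"
  shows "is_weak_grad \<Omega> (\<lambda>x. u x - v x) (\<lambda>x. G x - H x)"
  unfolding is_weak_grad_def has_weak_deriv_def
proof (intro ballI conjI)
  fix b :: 'a assume b: "b \<in> Basis"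
  have u: "locally_integrable \<Omega> u" "locally_integrable \<Omega> (\<lambda>x. G x \<bullet> b)"
    "\<And>\<theta>. \<theta> \<in> test_functions \<Omega> \<Longrightarrow>
      (LINT x|lebesgue_on \<Omega>. u x * dir_deriv b \<theta> x) = - (LINT x|lebesgue_on \<Omega>. G x \<bullet> b * \<theta> x)"
    using assms(1) b by (auto simp: is_weak_grad_def has_weak_deriv_def)
  have v: "locally_integrable \<Omega> v" "locally_integrable \<Omega> (\<lambda>x. H x \<bullet> b)"
    "\<And>\<theta>. \<theta> \<in> test_functions \<Omega> \<Longrightarrow>
      (LINT x|lebesgue_on \<Omega>. v x * dir_deriv b \<theta> x) = - (LINT x|lebesgue_on \<Omega>. H x \<bullet> b * \<theta> x)"
    using assms(2) b by (auto simp: is_weak_grad_def has_weak_deriv_def)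
  show "locally_integrable \<Omega> (\<lambda>x. u x - v x)"
    using u v unfolding locally_integrable_def by (auto intro: set_integral_diff(1))
  show "locally_integrable \<Omega> (\<lambda>x. (G x - H x) \<bullet> b)"
    using u v unfolding locally_integrable_def inner_diff_left by (auto intro: set_integral_diff(1))
  fix \<theta> assume \<theta>: "\<theta> \<in> test_functions \<Omega>"
  have t: "\<theta> \<in> L2 \<Omega>" "dir_deriv b \<theta> \<in> L2 \<Omega>"
    using \<theta> b assms(7) by (auto intro!: test_L2 test_dir_deriv)
  show "(LINT x|lebesgue_on \<Omega>. (u x - v x) * dir_deriv b \<theta> x) = - (LINT x|lebesgue_on \<Omega>. (G x - H x) \<bullet> b * \<theta> x)"
    using u(3)[OF \<theta>] v(3)[OF \<theta>] L2_integrable_mult[OF assms(3) t(2)] L2_integrable_mult[OF assms(4) t(2)]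
      L2_integrable_mult[OF L2_inner_Basis[OF assms(5), of b] t(1)]
      L2_integrable_mult[OF L2_inner_Basis[OF assms(6), of b] t(1)]
    by (simp add: left_diff_distrib inner_diff_left)
qed

text \<open>What makes the arbitrary choice in \<open>weak_grad\<close> harmless: all
  representatives agree almost everywhere, by the fundamental lemma in each coordinate.\<close>

lemma weak_grad_unique:
  assumes G: "is_weak_grad \<Omega> u G" "G \<in> L2 \<Omega>" and H: "is_weak_grad \<Omega> u H" "H \<in> L2 \<Omega>"
    and \<Omega>: "open \<Omega>" "bounded \<Omega>"
  shows "AE x in lebesgue_on \<Omega>. G x = H x"
proof -
  have "AE x in lebesgue_on \<Omega>. G x \<bullet> b - H x \<bullet> b = 0" if b: "b \<in> Basis" for b
  proof (rule fundamental_lemma[OF \<Omega>(1)])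
    have L: "(\<lambda>x. G x \<bullet> b) \<in> L2 \<Omega>" "(\<lambda>x. H x \<bullet> b) \<in> L2 \<Omega>"
      using G H by (auto intro: L2_inner_Basis)
    show "integrable (lebesgue_on \<Omega>) (\<lambda>x. G x \<bullet> b - H x \<bullet> b)"
      by (intro L2_integrable L2_diff L \<Omega>)
    fix \<theta> assume \<theta>: "\<theta> \<in> test_functions \<Omega>"
    have "- (LINT x|lebesgue_on \<Omega>. G x \<bullet> b * \<theta> x) = - (LINT x|lebesgue_on \<Omega>. H x \<bullet> b * \<theta> x)"
      using G(1) H(1) b \<theta> by (simp add: is_weak_grad_def has_weak_deriv_def)
    then show "(LINT x|lebesgue_on \<Omega>. (G x \<bullet> b - H x \<bullet> b) * \<theta> x) = 0"
      using L2_integrable_mult[OF L(1) test_L2[OF \<theta> \<Omega>(1)]] L2_integrable_mult[OF L(2) test_L2[OF \<theta> \<Omega>(1)]]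
      by (simp add: left_diff_distrib)
  qed
  then have "AE x in lebesgue_on \<Omega>. \<forall>b\<in>Basis. G x \<bullet> b - H x \<bullet> b = 0"
    by (intro eventually_ball_finite) auto
  then show ?thesis
    by eventually_elim (rule euclidean_eqI, simp)
qed

lemma weak_grad_H1:
  assumes "u \<in> H1 \<Omega>"
  shows "weak_grad \<Omega> u \<in> L2 \<Omega>" "is_weak_grad \<Omega> u (weak_grad \<Omega> u)"
proof -
  have "\<exists>G. G \<in> L2 \<Omega> \<and> is_weak_grad \<Omega> u G" using assms by (auto simp: H1_def)
  from someI_ex[OF this] show "weak_grad \<Omega> u \<in> L2 \<Omega>" "is_weak_grad \<Omega> u (weak_grad \<Omega> u)"
    by (auto simp: weak_grad_def)
qed

lemma weak_grad_eq:
  assumes "u \<in> L2 \<Omega>" "G \<in> L2 \<Omega>" "is_weak_grad \<Omega> u G" "open \<Omega>" "bounded \<Omega>"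
  shows "u \<in> H1 \<Omega>" "AE x in lebesgue_on \<Omega>. weak_grad \<Omega> u x = G x"
proof -
  show u: "u \<in> H1 \<Omega>" using assms by (auto simp: H1_def)
  show "AE x in lebesgue_on \<Omega>. weak_grad \<Omega> u x = G x"
    by (rule weak_grad_unique[OF weak_grad_H1(2,1)[OF u] assms(3,2,4,5)])
qed

lemma weak_grad_test:
  assumes "\<phi> \<in> test_functions \<Omega>" "open \<Omega>" "bounded \<Omega>"
  shows "\<phi> \<in> H1 \<Omega>" "AE x in lebesgue_on \<Omega>. weak_grad \<Omega> \<phi> x = grad \<phi> x"
  using weak_grad_eq[OF test_L2 grad_L2 is_weak_grad_test] assms by blast+

lemma weak_grad_diff_test:
  assumes y: "y \<in> H1 \<Omega>" and \<psi>: "\<psi> \<in> test_functions \<Omega>" and \<Omega>: "open \<Omega>" "bounded \<Omega>"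
  shows "L2_norm \<Omega> (weak_grad \<Omega> (\<lambda>x. y x - \<psi> x)) = L2_norm \<Omega> (\<lambda>x. weak_grad \<Omega> y x - grad \<psi> x)"
proof -
  have L: "y \<in> L2 \<Omega>" "\<psi> \<in> L2 \<Omega>" "weak_grad \<Omega> y \<in> L2 \<Omega>" "grad \<psi> \<in> L2 \<Omega>"
    using y weak_grad_H1[OF y] test_L2[OF \<psi> \<Omega>(1)] grad_L2[OF \<psi> \<Omega>(1)] by (auto simp: H1_def)
  have W: "is_weak_grad \<Omega> (\<lambda>x. y x - \<psi> x) (\<lambda>x. weak_grad \<Omega> y x - grad \<psi> x)"
    by (intro is_weak_grad_diff weak_grad_H1 y is_weak_grad_test \<psi> \<Omega> L)
  have H: "(\<lambda>x. y x - \<psi> x) \<in> H1 \<Omega>"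
    and E: "AE x in lebesgue_on \<Omega>. weak_grad \<Omega> (\<lambda>x. y x - \<psi> x) x = weak_grad \<Omega> y x - grad \<psi> x"
    by (intro weak_grad_eq[OF _ _ W] L2_diff L \<Omega>)+
  show ?thesis
    by (intro L2_norm_cong weak_grad_H1(1) H L2_diff L E)
qed

lemma L2_norm_zero [simp]: "L2_norm \<Omega> (\<lambda>x. 0) = 0"
  by (simp add: L2_norm_def L2_inner_def)

text \<open>The difference of the function with itself is zero, but \<open>weak_grad\<close> of zero
  is still a chosen representative; that its norm vanishes rests on uniqueness of weak
  gradients.\<close>

lemma test_H10:
  assumes "\<phi> \<in> test_functions \<Omega>" "open \<Omega>" "bounded \<Omega>"
  shows "\<phi> \<in> H10 \<Omega>"
proof -
  have "H1_norm \<Omega> (\<lambda>x. \<phi> x - \<phi> x) = 0"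
  proof -
    have "L2_norm \<Omega> (\<lambda>x. weak_grad \<Omega> \<phi> x - grad \<phi> x) = L2_norm \<Omega> (\<lambda>x. 0 :: 'a)"
      using weak_grad_test[OF assms] weak_grad_H1(1)[OF weak_grad_test(1)[OF assms]] grad_L2[OF assms(1,2)]
      by (intro L2_norm_cong L2_diff) auto
    then have "L2_norm \<Omega> (weak_grad \<Omega> (\<lambda>x. \<phi> x - \<phi> x)) = 0"
      using weak_grad_diff_test[OF weak_grad_test(1)[OF assms] assms] by simp
    then show ?thesis by (simp add: H1_norm_def)
  qed
  then show ?thesis
    using assms weak_grad_test(1)[OF assms] unfolding H10_def by (auto intro!: bexI[of _ \<phi>])
qed

lemma H10_approx:
  assumes y: "y \<in> H10 \<Omega>" and \<Omega>: "open \<Omega>" "bounded \<Omega>" and "\<epsilon> > 0"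
  obtains \<psi> where "\<psi> \<in> test_functions \<Omega>" "L2_norm \<Omega> (\<lambda>x. y x - \<psi> x) < \<epsilon>"
    "L2_norm \<Omega> (\<lambda>x. weak_grad \<Omega> y x - grad \<psi> x) < \<epsilon>"
proof -
  obtain \<psi> where \<psi>: "\<psi> \<in> test_functions \<Omega>" "H1_norm \<Omega> (\<lambda>x. y x - \<psi> x) < \<epsilon>"
    using assms by (auto simp: H10_def)
  have y1: "y \<in> H1 \<Omega>" using y by (simp add: H10_def)
  let ?a = "L2_norm \<Omega> (\<lambda>x. y x - \<psi> x)" and ?b = "L2_norm \<Omega> (weak_grad \<Omega> (\<lambda>x. y x - \<psi> x))"
  have "?a \<le> sqrt (?a\<^sup>2 + ?b\<^sup>2)" "?b \<le> sqrt (?a\<^sup>2 + ?b\<^sup>2)"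
    by (auto intro: real_le_rsqrt)
  then have "?a < \<epsilon>" "?b < \<epsilon>" using \<psi>(2) unfolding H1_norm_def by linarith+
  then show ?thesis
    using that[OF \<psi>(1)] weak_grad_diff_test[OF y1 \<psi>(1) \<Omega>] by simp
qed

lemma H10_L2: "y \<in> H10 \<Omega> \<Longrightarrow> y \<in> L2 \<Omega>" "y \<in> H10 \<Omega> \<Longrightarrow> weak_grad \<Omega> y \<in> L2 \<Omega>"
  by (auto simp: H10_def H1_def weak_grad_H1)

text \<open>The weak form of \<open>z - \<mu> \<Delta> z = x\<close> up to a defect of size
  \<open>\<epsilon>\<close> in the dual of the norm
  \<open>L2_norm \<Omega> \<phi> + L2_norm \<Omega> (grad \<phi>)\<close>. With \<open>x\<close> the
  previous iterate it is one implicit Euler step.\<close>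

definition residual_le ::
  "'a::euclidean_space set \<Rightarrow> real \<Rightarrow> real \<Rightarrow> ('a \<Rightarrow> real) \<Rightarrow> ('a \<Rightarrow> real) \<Rightarrow> bool" where
  "residual_le \<Omega> \<mu> \<epsilon> x z \<longleftrightarrow> (\<forall>\<phi>\<in>test_functions \<Omega>.
    \<bar>L2_inner \<Omega> (\<lambda>y. z y - x y) \<phi> + \<mu> * L2_inner \<Omega> (grad z) (grad \<phi>)\<bar>
      \<le> \<epsilon> * (L2_norm \<Omega> \<phi> + L2_norm \<Omega> (grad \<phi>)))"

text \<open>Extends the residual bound from test functions to values of a solution, by density: both
  sides are continuous in the norm of \<open>H1\<close>, and \<open>H10\<close> is defined as a
  closure. The constant \<open>C\<close> gathers every coefficient of the approximation error
  \<open>\<eta>\<close>.\<close>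

lemma residual_bound_H10:
  assumes z: "z \<in> test_functions \<Omega>" and x: "x \<in> test_functions \<Omega>" and \<Omega>: "open \<Omega>" "bounded \<Omega>"
    and "\<epsilon> \<ge> 0" and res: "residual_le \<Omega> \<mu> \<epsilon> x z"
    and y: "y \<in> H10 \<Omega>"
  shows "\<bar>L2_inner \<Omega> (\<lambda>t. z t - x t) y + \<mu> * L2_inner \<Omega> (grad z) (weak_grad \<Omega> y)\<bar>
    \<le> \<epsilon> * (L2_norm \<Omega> y + L2_norm \<Omega> (weak_grad \<Omega> y))"
proof -
  define w where "w = (\<lambda>t. z t - x t)"
  have w: "w \<in> test_functions \<Omega>" unfolding w_def by (intro test_diff z x)
  let ?l = "\<bar>L2_inner \<Omega> w y + \<mu> * L2_inner \<Omega> (grad z) (weak_grad \<Omega> y)\<bar>"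
  let ?r = "\<epsilon> * (L2_norm \<Omega> y + L2_norm \<Omega> (weak_grad \<Omega> y))"
  define C where "C = 2 * \<epsilon> + L2_norm \<Omega> w + \<bar>\<mu>\<bar> * L2_norm \<Omega> (grad z)"
  have C: "C \<ge> 0" using assms by (simp add: C_def)
  have L: "y \<in> L2 \<Omega>" "weak_grad \<Omega> y \<in> L2 \<Omega>" "w \<in> L2 \<Omega>" "grad z \<in> L2 \<Omega>"
    using H10_L2 y z w \<Omega> by (auto intro: test_L2 grad_L2)
  have key: "?l \<le> ?r + C * \<eta>" if \<eta>: "\<eta> > 0" for \<eta>
  proof -
    obtain \<psi> where \<psi>: "\<psi> \<in> test_functions \<Omega>" and a: "L2_norm \<Omega> (\<lambda>x. y x - \<psi> x) < \<eta>"
      and b: "L2_norm \<Omega> (\<lambda>x. weak_grad \<Omega> y x - grad \<psi> x) < \<eta>"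
      using H10_approx[OF y \<Omega> \<eta>] by blast
    have P: "\<psi> \<in> L2 \<Omega>" "grad \<psi> \<in> L2 \<Omega>" using \<psi> \<Omega> by (auto intro: test_L2 grad_L2)
    have 1: "L2_inner \<Omega> w y = L2_inner \<Omega> w \<psi> + L2_inner \<Omega> w (\<lambda>x. y x - \<psi> x)"
      using L2_inner_diff_right[OF L(1) P(1) L(3)] by simp
    have 2: "L2_inner \<Omega> (grad z) (weak_grad \<Omega> y)
        = L2_inner \<Omega> (grad z) (grad \<psi>) + L2_inner \<Omega> (grad z) (\<lambda>x. weak_grad \<Omega> y x - grad \<psi> x)"
      using L2_inner_diff_right[OF L(2) P(2) L(4)] by simp
    have 3: "\<bar>L2_inner \<Omega> w (\<lambda>x. y x - \<psi> x)\<bar> \<le> L2_norm \<Omega> w * \<eta>"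
      using L2_Cauchy_Schwarz[OF L(3) L2_diff[OF L(1) P(1)]] a
        mult_left_mono[of _ \<eta> "L2_norm \<Omega> w"] by (meson L2_norm_nonneg less_imp_le order_trans)
    have 4: "\<bar>L2_inner \<Omega> (grad z) (\<lambda>x. weak_grad \<Omega> y x - grad \<psi> x)\<bar> \<le> L2_norm \<Omega> (grad z) * \<eta>"
      using L2_Cauchy_Schwarz[OF L(4) L2_diff[OF L(2) P(2)]] b
        mult_left_mono[of _ \<eta> "L2_norm \<Omega> (grad z)"] by (meson L2_norm_nonneg less_imp_le order_trans)
    have 5: "\<bar>\<mu> * L2_inner \<Omega> (grad z) (\<lambda>x. weak_grad \<Omega> y x - grad \<psi> x)\<bar> \<le> \<bar>\<mu>\<bar> * L2_norm \<Omega> (grad z) * \<eta>"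
      using mult_left_mono[OF 4, of "\<bar>\<mu>\<bar>"] by (simp add: abs_mult mult.assoc)
    have "L2_norm \<Omega> \<psi> \<le> L2_norm \<Omega> y + \<eta>"
      using L2_norm_diff_le[OF P(1) L(1)] a L2_norm_scale[of \<Omega> "-1" "\<lambda>x. y x - \<psi> x"] by simp
    moreover have "L2_norm \<Omega> (grad \<psi>) \<le> L2_norm \<Omega> (weak_grad \<Omega> y) + \<eta>"
      using L2_norm_diff_le[OF P(2) L(2)] b L2_norm_scale[of \<Omega> "-1" "\<lambda>x. weak_grad \<Omega> y x - grad \<psi> x"] by simp
    ultimately have "\<epsilon> * (L2_norm \<Omega> \<psi> + L2_norm \<Omega> (grad \<psi>)) \<le> \<epsilon> * ((L2_norm \<Omega> y + \<eta>) + (L2_norm \<Omega> (weak_grad \<Omega> y) + \<eta>))"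
      using \<open>\<epsilon> \<ge> 0\<close> by (intro mult_left_mono add_mono)
    with bspec[OF res[unfolded residual_le_def w_def[symmetric]] \<psi>] 3 5 show ?thesis
      unfolding 1 2 C_def by (simp add: algebra_simps)
  qed
  have "?l \<le> ?r"
  proof (rule field_le_epsilon)
    fix e :: real assume "e > 0"
    then have "C * (e / (C + 1)) \<le> e"
      using C by (simp add: field_simps)
    with key[of "e / (C + 1)"] \<open>e > 0\<close> C show "?l \<le> ?r + e" by simp
  qed
  then show ?thesis by (simp add: w_def)
qed

subsection \<open>Approximate resolvents of the Dirichlet Laplacian\<close>

lemma L2_norm_mono:
  assumes "f \<in> L2 \<Omega>" "g \<in> L2 \<Omega>" "\<And>x. x \<in> \<Omega> \<Longrightarrow> norm (f x) \<le> norm (g x)"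
  shows "L2_norm \<Omega> f \<le> L2_norm \<Omega> g"
proof -
  have "L2_inner \<Omega> f f \<le> L2_inner \<Omega> g g"
    unfolding L2_inner_def
  proof (rule integral_mono[OF L2_integrable_inner[OF assms(1,1)] L2_integrable_inner[OF assms(2,2)]])
    fix x assume "x \<in> space (lebesgue_on \<Omega>)"
    then show "f x \<bullet> f x \<le> g x \<bullet> g x"
      using power_mono[OF assms(3) norm_ge_zero, of x 2] by (simp add: power2_norm_eq_inner)
  qed
  then show ?thesis by (simp add: L2_norm_def)
qed

text \<open>\<open>z\<close> almost minimises \<open>norm (z - x)\<^sup>2 + \<mu> * norm (grad z)\<^sup>2\<close>, so it approximates
  the resolvent \<open>(1 - \<mu> \<Delta>)\<^sup>-\<^sup>1 x\<close>; composing with \<open>s \<mapsto> sqrt (s\<^sup>2 + \<delta>\<^sup>2) - \<delta>\<close>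
  makes it nonnegative without increasing the functional by much. Working with almost minimisers in
  place of the resolvent avoids the completeness of \<open>H10\<close>.\<close>

lemma almost_minimiser:
  assumes x: "x \<in> test_functions \<Omega>" "\<And>y. x y \<ge> 0" and \<Omega>: "open \<Omega>" "bounded \<Omega>"
    and "\<mu> > 0" "\<kappa> > 0"
  obtains z where "z \<in> test_functions \<Omega>" "\<And>y. z y \<ge> 0"
    "\<mu> * (L2_norm \<Omega> (grad z))\<^sup>2 \<le> (L2_norm \<Omega> x)\<^sup>2 + 2 * \<kappa>"
    "\<And>\<phi>. \<phi> \<in> test_functions \<Omega> \<Longrightarrow>
      (L2_inner \<Omega> (\<lambda>y. z y - x y) \<phi> + \<mu> * L2_inner \<Omega> (grad z) (grad \<phi>))\<^sup>2
        \<le> 2 * \<kappa> * ((L2_norm \<Omega> \<phi>)\<^sup>2 + \<mu> * (L2_norm \<Omega> (grad \<phi>))\<^sup>2)"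
proof -
  let ?T = "test_functions \<Omega>"
  define I where "I z = (L2_norm \<Omega> (\<lambda>y. z y - x y))\<^sup>2 + \<mu> * (L2_norm \<Omega> (grad z))\<^sup>2" for z
  have I0: "I z \<ge> 0" for z using \<open>\<mu> > 0\<close> by (simp add: I_def)
  define i where "i = Inf (I ` ?T)"
  have bdd: "bdd_below (I ` ?T)" using I0 unfolding bdd_below_def by blast
  have ne: "I ` ?T \<noteq> {}" using test_zero by blast
  have il: "i \<le> I z" if "z \<in> ?T" for z
    unfolding i_def using bdd that by (intro cInf_lower) auto
  obtain z0 where z0: "z0 \<in> ?T" "I z0 < i + \<kappa>"
    using cInf_lessD[OF ne, of "i + \<kappa>"] \<open>\<kappa> > 0\<close> by (auto simp: i_def)
  define X where "X = (LINT y|lebesgue_on \<Omega>. x y)"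
  have xi: "integrable (lebesgue_on \<Omega>) x"
    using L2_integrable[OF test_L2[OF x(1) \<Omega>(1)] \<Omega>] .
  have X0: "X \<ge> 0" unfolding X_def using x(2) by simp
  \<comment> \<open>Smoothing the absolute value raises the functional by at most
    \<open>2 * \<delta> * X\<close>; this choice keeps it below \<open>\<kappa>\<close>, and the
    summand 1 covers \<open>X = 0\<close>.\<close>
  define \<delta> where "\<delta> = \<kappa> / (2 * X + 1)"
  have \<delta>: "\<delta> > 0" "2 * \<delta> * X \<le> \<kappa>"
    using \<open>\<kappa> > 0\<close> X0 by (auto simp: \<delta>_def field_simps)
  \<comment> \<open>Subtracting \<open>\<delta>\<close> makes \<open>z\<close> vanish where
    \<open>z0\<close> does, so the support stays compact.\<close>
  define z where "z y = sqrt ((z0 y)\<^sup>2 + \<delta>\<^sup>2) + (- \<delta>)" for y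
  have zT: "z \<in> ?T"
    unfolding z_def
    using test_compose[OF z0(1) smooth_add[OF smooth_sqrt_quadratic[OF \<delta>(1)] smooth_const[of "- \<delta>"]]] \<delta>(1)
    by simp
  have absz: "\<bar>z0 y\<bar> < sqrt ((z0 y)\<^sup>2 + \<delta>\<^sup>2)" "sqrt ((z0 y)\<^sup>2 + \<delta>\<^sup>2) \<le> \<bar>z0 y\<bar> + \<delta>" for y
    using abs_less_sqrt_quadratic[OF \<delta>(1)] sqrt_quadratic_le[OF \<delta>(1)] by auto
  have zpos: "z y \<ge> 0" for y
  proof -
    have "\<delta> \<le> sqrt ((z0 y)\<^sup>2 + \<delta>\<^sup>2)" using \<delta>(1) by (intro real_le_rsqrt) simp
    then show ?thesis by (simp add: z_def)
  qed
  have gradz: "grad z y = (z0 y / sqrt ((z0 y)\<^sup>2 + \<delta>\<^sup>2)) *\<^sub>R grad z0 y" for y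
    unfolding z_def
    using grad_compose[OF test_differentiable[OF z0(1)]
        DERIV_add[OF sqrt_quadratic_has_derivative[OF \<delta>(1)] DERIV_const[of "- \<delta>"]], of y] by simp
  have "L2_norm \<Omega> (grad z) \<le> L2_norm \<Omega> (grad z0)"
  proof (rule L2_norm_mono[OF grad_L2[OF zT \<Omega>(1)] grad_L2[OF z0(1) \<Omega>(1)]])
    fix y
    have "\<bar>z0 y\<bar> / sqrt ((z0 y)\<^sup>2 + \<delta>\<^sup>2) \<le> 1"
      using absz(1)[of y] \<delta>(1) by (subst divide_le_eq_1_pos) (auto simp: add_nonneg_pos)
    then have "(\<bar>z0 y\<bar> / sqrt ((z0 y)\<^sup>2 + \<delta>\<^sup>2)) * norm (grad z0 y) \<le> 1 * norm (grad z0 y)"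
      by (intro mult_right_mono) auto
    then show "norm (grad z y) \<le> norm (grad z0 y)" by (simp add: gradz)
  qed
  then have 1: "\<mu> * (L2_norm \<Omega> (grad z))\<^sup>2 \<le> \<mu> * (L2_norm \<Omega> (grad z0))\<^sup>2"
    using \<open>\<mu> > 0\<close> by (intro mult_left_mono power_mono) auto
  have 2: "(L2_norm \<Omega> (\<lambda>y. z y - x y))\<^sup>2 \<le> (L2_norm \<Omega> (\<lambda>y. z0 y - x y))\<^sup>2 + \<kappa>"
  proof -
    have d: "(\<lambda>y. z y - x y) \<in> L2 \<Omega>" "(\<lambda>y. z0 y - x y) \<in> L2 \<Omega>"
      using zT z0(1) x(1) \<Omega> by (auto intro: L2_diff test_L2)
    have "(LINT y|lebesgue_on \<Omega>. (z y - x y) \<bullet> (z y - x y))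
        \<le> (LINT y|lebesgue_on \<Omega>. (z0 y - x y) \<bullet> (z0 y - x y) + 2 * \<delta> * x y)"
    proof (rule integral_mono)
      show "integrable (lebesgue_on \<Omega>) (\<lambda>y. (z y - x y) \<bullet> (z y - x y))"
        by (rule L2_integrable_inner[OF d(1,1)])
      show "integrable (lebesgue_on \<Omega>) (\<lambda>y. (z0 y - x y) \<bullet> (z0 y - x y) + 2 * \<delta> * x y)"
        using L2_integrable_inner[OF d(2,2)] xi by simp
      fix y
      have "(z y)\<^sup>2 \<le> \<bar>z0 y\<bar>\<^sup>2"
        using zpos[of y] absz(2)[of y] by (intro power_mono) (auto simp: z_def)
      moreover have "(z0 y - \<delta>) * x y \<le> z y * x y"
        using absz(1)[of y] x(2) by (intro mult_right_mono) (auto simp: z_def)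
      ultimately show "(z y - x y) \<bullet> (z y - x y) \<le> (z0 y - x y) \<bullet> (z0 y - x y) + 2 * \<delta> * x y"
        by (simp add: algebra_simps power2_eq_square)
    qed
    also have "\<dots> = (LINT y|lebesgue_on \<Omega>. (z0 y - x y) \<bullet> (z0 y - x y)) + 2 * \<delta> * X"
      using L2_integrable_inner[OF d(2,2)] xi by (simp add: X_def)
    finally show ?thesis
      using \<delta>(2) by (simp add: L2_norm_power2 L2_inner_def)
  qed
  have Iz: "I z \<le> i + 2 * \<kappa>" using 1 2 z0(2) by (simp add: I_def)
  show ?thesis
  proof (rule that[OF zT zpos])
    have "I z \<le> I (\<lambda>y. 0) + 2 * \<kappa>" using Iz il[OF test_zero] by simp
    moreover have "I (\<lambda>y. 0) = (L2_norm \<Omega> x)\<^sup>2"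
    proof -
      have "grad (\<lambda>y. 0 :: real) = (\<lambda>y. 0 :: 'a)" by (simp add: grad_def fun_eq_iff)
      then show ?thesis using L2_norm_scale[of \<Omega> "-1" x] by (simp add: I_def)
    qed
    ultimately show "\<mu> * (L2_norm \<Omega> (grad z))\<^sup>2 \<le> (L2_norm \<Omega> x)\<^sup>2 + 2 * \<kappa>"
      using zero_le_power2[of "L2_norm \<Omega> (\<lambda>y. z y - x y)"] unfolding I_def by linarith
    fix \<phi> assume \<phi>: "\<phi> \<in> ?T"
    define L where "L = L2_inner \<Omega> (\<lambda>y. z y - x y) \<phi> + \<mu> * L2_inner \<Omega> (grad z) (grad \<phi>)"
    define N where "N = (L2_norm \<Omega> \<phi>)\<^sup>2 + \<mu> * (L2_norm \<Omega> (grad \<phi>))\<^sup>2"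
    \<comment> \<open>No competitor \<open>z + s \<phi>\<close> lies below the infimum
      \<open>i\<close>, and \<open>I z \<le> i + 2 * \<kappa>\<close>: one \<open>\<kappa>\<close>
      from the choice of \<open>z0\<close>, one from the smoothing. The discriminant then bounds the
      first variation \<open>L\<close>.\<close>
    have "0 \<le> 2 * \<kappa> + 2 * s * L + s\<^sup>2 * N" for s
    proof -
      have t: "(\<lambda>y. z y + s * \<phi> y) \<in> ?T" by (intro test_add test_mult zT \<phi>)
      have "(\<lambda>y. z y + s * \<phi> y - x y) = (\<lambda>y. (z y - x y) + s *\<^sub>R \<phi> y)" by (simp add: fun_eq_iff)
      moreover have "grad (\<lambda>y. z y + s * \<phi> y) = (\<lambda>y. grad z y + s *\<^sub>R grad \<phi> y)"
        using grad_add[OF test_differentiable[OF zT] test_differentiable[OF test_mult[OF \<phi>]]]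
          grad_mult[OF test_differentiable[OF \<phi>]] by (simp add: fun_eq_iff)
      ultimately have "I (\<lambda>y. z y + s * \<phi> y) = I z + 2 * s * L + s\<^sup>2 * N"
        using L2_inner_add_scale_self[OF L2_diff[OF test_L2[OF zT \<Omega>(1)] test_L2[OF x(1) \<Omega>(1)]] test_L2[OF \<phi> \<Omega>(1)], of s]
          L2_inner_add_scale_self[OF grad_L2[OF zT \<Omega>(1)] grad_L2[OF \<phi> \<Omega>(1)], of s]
        by (simp add: I_def L_def N_def L2_norm_power2 algebra_simps)
      with il[OF t] Iz show ?thesis by simp
    qed
    moreover have "N \<ge> 0" using \<open>\<mu> > 0\<close> by (simp add: N_def)
    ultimately have "L\<^sup>2 \<le> 2 * \<kappa> * N" by (rule quadratic_nonneg_discriminant)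
    then show "(L2_inner \<Omega> (\<lambda>y. z y - x y) \<phi> + \<mu> * L2_inner \<Omega> (grad z) (grad \<phi>))\<^sup>2
        \<le> 2 * \<kappa> * ((L2_norm \<Omega> \<phi>)\<^sup>2 + \<mu> * (L2_norm \<Omega> (grad \<phi>))\<^sup>2)"
      by (simp add: L_def N_def)
  qed
qed

text \<open>The mass of the resolvent is controlled by testing with \<open>sat \<delta> z\<close>, a smooth
  approximation of the indicator of \<open>z > 0\<close>.\<close>

lemma approximate_resolvent:
  assumes x: "x \<in> test_functions \<Omega>" "\<And>y. x y \<ge> 0" and \<Omega>: "open \<Omega>" "bounded \<Omega>"
    and "\<mu> > 0" "\<epsilon> > 0"
  obtains z where "z \<in> test_functions \<Omega>" "\<And>y. z y \<ge> 0"
    "residual_le \<Omega> \<mu> \<epsilon> x z"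
    "(LINT y|lebesgue_on \<Omega>. z y) \<le> (LINT y|lebesgue_on \<Omega>. x y) + \<epsilon>"
proof -
  let ?T = "test_functions \<Omega>"
  have lm: "\<Omega> \<in> lmeasurable" using \<Omega> by (simp add: lmeasurable_open)
  then interpret finite_measure "lebesgue_on \<Omega>" by (rule finite_measure_lebesgue_on)
  define m where "m = measure lebesgue \<Omega>"
  have m0: "m \<ge> 0" by (simp add: m_def)
  have ms: "measure (lebesgue_on \<Omega>) \<Omega> = m"
    using lm by (simp add: m_def measure_restrict_space fmeasurableD)
  \<comment> \<open>Half of the admissible mass gain pays for \<open>mult_sat_ge\<close>, integrated
    over the domain of measure \<open>m\<close>.\<close>
  define \<delta> where "\<delta> = \<epsilon> / (2 * (m + 1))"
  have \<delta>: "\<delta> > 0" "\<delta> * m \<le> \<epsilon> / 2"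
    using \<open>\<epsilon> > 0\<close> m0 by (auto simp: \<delta>_def field_simps)
  \<comment> \<open>A bound for the gradient of \<open>z\<close>, fixed before \<open>z\<close> and
    \<open>\<kappa>\<close> are chosen; this is why \<open>2 * \<kappa> \<le> 1\<close> is imposed
    below.\<close>
  define g where "g = sqrt (((L2_norm \<Omega> x)\<^sup>2 + 1) / \<mu>)"
  have g0: "g \<ge> 0" using \<open>\<mu> > 0\<close> by (simp add: g_def)
  define D where "D = sqrt m + g / \<delta> + 1"
  have D: "D > 0" unfolding D_def using m0 g0 \<delta>(1) by (intro add_nonneg_pos add_nonneg_nonneg) auto
  \<comment> \<open>The other half pays for the residual against the saturated test function, whose
    two norms add up to at most \<open>D\<close>.\<close>
  define \<epsilon>' where "\<epsilon>' = min \<epsilon> (\<epsilon> / (2 * D))"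
  have \<epsilon>': "\<epsilon>' > 0" "\<epsilon>' \<le> \<epsilon>" "\<epsilon>' * D \<le> \<epsilon> / 2"
  proof -
    show "\<epsilon>' > 0" "\<epsilon>' \<le> \<epsilon>" using \<open>\<epsilon> > 0\<close> D by (auto simp: \<epsilon>'_def)
    have "\<epsilon>' * D \<le> \<epsilon> / (2 * D) * D" using D by (intro mult_right_mono) (auto simp: \<epsilon>'_def)
    then show "\<epsilon>' * D \<le> \<epsilon> / 2" using D by simp
  qed
  \<comment> \<open>Chosen so that the quadratic residual bound of the almost minimiser becomes the
    linear one with constant \<open>\<epsilon>'\<close>.\<close>
  define \<kappa> where "\<kappa> = min (1 / 2) (\<epsilon>'\<^sup>2 / (2 * max 1 \<mu>))"
  have \<kappa>: "\<kappa> > 0" "2 * \<kappa> \<le> 1" "2 * \<kappa> * max 1 \<mu> \<le> \<epsilon>'\<^sup>2"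
  proof -
    show "\<kappa> > 0" "2 * \<kappa> \<le> 1" using \<epsilon>' by (auto simp: \<kappa>_def)
    have "2 * \<kappa> * max 1 \<mu> \<le> 2 * (\<epsilon>'\<^sup>2 / (2 * max 1 \<mu>)) * max 1 \<mu>"
      by (intro mult_right_mono) (auto simp: \<kappa>_def)
    also have "\<dots> = \<epsilon>'\<^sup>2" by (simp add: field_simps)
    finally show "2 * \<kappa> * max 1 \<mu> \<le> \<epsilon>'\<^sup>2" .
  qed
  obtain z where z: "z \<in> ?T" "\<And>y. z y \<ge> 0"
    and gz: "\<mu> * (L2_norm \<Omega> (grad z))\<^sup>2 \<le> (L2_norm \<Omega> x)\<^sup>2 + 2 * \<kappa>"
    and res: "\<And>\<phi>. \<phi> \<in> ?T \<Longrightarrow>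
      (L2_inner \<Omega> (\<lambda>y. z y - x y) \<phi> + \<mu> * L2_inner \<Omega> (grad z) (grad \<phi>))\<^sup>2
        \<le> 2 * \<kappa> * ((L2_norm \<Omega> \<phi>)\<^sup>2 + \<mu> * (L2_norm \<Omega> (grad \<phi>))\<^sup>2)"
    using almost_minimiser[OF x \<Omega> \<open>\<mu> > 0\<close> \<kappa>(1)] by blast
  have res': "\<bar>L2_inner \<Omega> (\<lambda>y. z y - x y) \<phi> + \<mu> * L2_inner \<Omega> (grad z) (grad \<phi>)\<bar>
        \<le> \<epsilon>' * (L2_norm \<Omega> \<phi> + L2_norm \<Omega> (grad \<phi>))" (is "\<bar>?L\<bar> \<le> \<epsilon>' * (?a + ?b)") if \<phi>: "\<phi> \<in> ?T" for \<phi>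
  proof -
    have "?a\<^sup>2 + \<mu> * ?b\<^sup>2 \<le> max 1 \<mu> * ?a\<^sup>2 + max 1 \<mu> * ?b\<^sup>2"
      using mult_right_mono[of 1 "max 1 \<mu>" "?a\<^sup>2"] by (intro add_mono mult_right_mono) auto
    also have "\<dots> \<le> max 1 \<mu> * (?a + ?b)\<^sup>2"
      unfolding distrib_left[symmetric] by (intro mult_left_mono) (auto simp: power2_sum)
    finally have "2 * \<kappa> * (?a\<^sup>2 + \<mu> * ?b\<^sup>2) \<le> 2 * \<kappa> * (max 1 \<mu> * (?a + ?b)\<^sup>2)"
      using \<kappa> by (intro mult_left_mono) auto
    also have "\<dots> \<le> \<epsilon>'\<^sup>2 * (?a + ?b)\<^sup>2"
      using mult_right_mono[OF \<kappa>(3), of "(?a + ?b)\<^sup>2"] by (simp add: mult.assoc)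
    finally have "?L\<^sup>2 \<le> (\<epsilon>' * (?a + ?b))\<^sup>2"
      using res[OF \<phi>] by (simp add: power_mult_distrib)
    then have "\<bar>?L\<bar> \<le> \<bar>\<epsilon>' * (?a + ?b)\<bar>" by (simp only: abs_le_square_iff)
    then show ?thesis using \<epsilon>' by (simp add: abs_mult)
  qed
  have L: "z \<in> L2 \<Omega>" "x \<in> L2 \<Omega>" "grad z \<in> L2 \<Omega>"
    using z x \<Omega> by (auto intro: test_L2 grad_L2)
  have gz': "L2_norm \<Omega> (grad z) \<le> g"
  proof -
    have "\<mu> * (L2_norm \<Omega> (grad z))\<^sup>2 \<le> (L2_norm \<Omega> x)\<^sup>2 + 1" using gz \<kappa> by linarith
    then show ?thesis
      using \<open>\<mu> > 0\<close> unfolding g_def by (intro real_le_rsqrt) (simp add: field_simps)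
  qed
  define \<phi> where "\<phi> y = sat \<delta> (z y)" for y
  define c where "c y = (1 - z y / sqrt ((z y)\<^sup>2 + \<delta>\<^sup>2)) / \<delta>" for y
  have \<phi>T: "\<phi> \<in> ?T"
    unfolding \<phi>_def using test_compose[OF z(1) smooth_sat[OF \<delta>(1)]] \<delta>(1) by simp
  have \<phi>L: "\<phi> \<in> L2 \<Omega>" "grad \<phi> \<in> L2 \<Omega>" using \<phi>T \<Omega> by (auto intro: test_L2 grad_L2)
  have g\<phi>: "grad \<phi> y = c y *\<^sub>R grad z y" for y
    unfolding \<phi>_def c_def
    by (rule grad_compose[OF test_differentiable[OF z(1)] sat_has_derivative[OF \<delta>(1)]])
  have c: "0 \<le> c y" "c y \<le> 1 / \<delta>" for y
    unfolding c_def using sat_deriv_nonneg[OF \<delta>(1)] sat_deriv_le[OF \<delta>(1) z(2)] by auto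
  have \<phi>b: "0 \<le> \<phi> y" "\<phi> y \<le> 1" for y
    unfolding \<phi>_def using sat_bounds[OF \<delta>(1) z(2)] by auto
  have "L2_norm \<Omega> \<phi> \<le> sqrt m"
  proof -
    have "L2_inner \<Omega> \<phi> \<phi> \<le> (LINT y|lebesgue_on \<Omega>. 1)"
      unfolding L2_inner_def
      by (rule integral_mono[OF L2_integrable_inner[OF \<phi>L(1,1)]])
        (use \<phi>b in \<open>auto intro: mult_le_one\<close>)
    then show ?thesis by (simp add: L2_norm_def ms)
  qed
  moreover have "L2_norm \<Omega> (grad \<phi>) \<le> g / \<delta>"
  proof -
    have "L2_norm \<Omega> (grad \<phi>) \<le> L2_norm \<Omega> (\<lambda>y. (1 / \<delta>) *\<^sub>R grad z y)"
      using c \<delta>(1) by (intro L2_norm_mono \<phi>L L2_scale L) (use mult_right_mono[OF c(2) norm_ge_zero] in \<open>auto simp: g\<phi>\<close>)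
    also have "\<dots> \<le> g / \<delta>"
      using \<delta>(1) gz' by (simp add: L2_norm_scale divide_right_mono del: scaleR_one)
    finally show ?thesis .
  qed
  ultimately have "\<epsilon>' * (L2_norm \<Omega> \<phi> + L2_norm \<Omega> (grad \<phi>)) \<le> \<epsilon>' * D"
    using \<epsilon>' by (intro mult_left_mono) (auto simp: D_def)
  then have e2: "L2_inner \<Omega> (\<lambda>y. z y - x y) \<phi> + \<mu> * L2_inner \<Omega> (grad z) (grad \<phi>) \<le> \<epsilon> / 2"
    using res'[OF \<phi>T] \<epsilon>'(3) by linarith
  \<comment> \<open>Since \<open>sat\<close> is nondecreasing, \<open>grad \<phi>\<close> is a
    nonnegative multiple of \<open>grad z\<close>: diffusion can only lower the mass, and its term
    is dropped.\<close>
  have "0 \<le> L2_inner \<Omega> (grad z) (grad \<phi>)"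
    unfolding L2_inner_def using c by (intro integral_nonneg_AE AE_I2) (simp add: g\<phi>)
  then have "0 \<le> \<mu> * L2_inner \<Omega> (grad z) (grad \<phi>)" using \<open>\<mu> > 0\<close> by simp
  with e2 have e3: "L2_inner \<Omega> z \<phi> \<le> L2_inner \<Omega> x \<phi> + \<epsilon> / 2"
    by (simp add: L2_inner_diff_left[OF L(1,2) \<phi>L(1)])
  have xi: "integrable (lebesgue_on \<Omega>) x" "integrable (lebesgue_on \<Omega>) z"
    using L2_integrable L \<Omega> by blast+
  have "L2_inner \<Omega> x \<phi> \<le> (LINT y|lebesgue_on \<Omega>. x y)"
    unfolding L2_inner_def using \<phi>b x(2)
    by (intro integral_mono L2_integrable_inner L \<phi>L xi) (simp add: mult_left_le)
  moreover have "(LINT y|lebesgue_on \<Omega>. z y) \<le> (LINT y|lebesgue_on \<Omega>. z y \<bullet> \<phi> y + \<delta>)"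
    using mult_sat_ge[OF \<delta>(1) z(2)]
    by (intro integral_mono xi Bochner_Integration.integrable_add L2_integrable_inner L \<phi>L)
      (auto simp: \<phi>_def)
  moreover have "(LINT y|lebesgue_on \<Omega>. z y \<bullet> \<phi> y + \<delta>) = L2_inner \<Omega> z \<phi> + \<delta> * m"
    using L2_integrable_inner[OF L(1) \<phi>L(1)] by (simp add: L2_inner_def ms)
  ultimately have mass: "(LINT y|lebesgue_on \<Omega>. z y) \<le> (LINT y|lebesgue_on \<Omega>. x y) + \<epsilon>"
    using e3 \<delta>(2) by linarith
  show ?thesis
  proof (rule that[OF z])
    have "\<epsilon>' * s \<le> \<epsilon> * s" if "s \<ge> 0" for s by (rule mult_right_mono[OF \<epsilon>'(2) that])
    with res' show "residual_le \<Omega> \<mu> \<epsilon> x z"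
      unfolding residual_le_def by (meson L2_norm_nonneg add_nonneg_nonneg order_trans)
  qed (rule mass)
qed

subsection \<open>Decay of the implicit Euler scheme\<close>

lemma resolvent_chain:
  assumes \<psi>: "\<psi> \<in> test_functions \<Omega>" "\<And>y. \<psi> y \<ge> 0" and \<Omega>: "open \<Omega>" "bounded \<Omega>"
    and "\<mu> > 0" "\<epsilon> > 0"
  obtains \<zeta> :: "nat \<Rightarrow> 'a::euclidean_space \<Rightarrow> real" where "\<zeta> 0 = \<psi>"
    "\<And>j. \<zeta> j \<in> test_functions \<Omega>" "\<And>j y. \<zeta> j y \<ge> 0"
    "\<And>j. residual_le \<Omega> \<mu> \<epsilon> (\<zeta> j) (\<zeta> (Suc j))"
    "\<And>j. (LINT y|lebesgue_on \<Omega>. \<zeta> j y) \<le> (LINT y|lebesgue_on \<Omega>. \<psi> y) + real j * \<epsilon>"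
proof -
  \<comment> \<open>The clause for \<open>n = 0\<close> anchors the dependent choice at the
    prescribed datum.\<close>
  define P where "P n z \<longleftrightarrow> (n = 0 \<longrightarrow> z = \<psi>) \<and> z \<in> test_functions \<Omega> \<and> (\<forall>y. z y \<ge> 0)"
    for n :: nat and z :: "'a \<Rightarrow> real"
  define Q where "Q x z \<longleftrightarrow> residual_le \<Omega> \<mu> \<epsilon> x z \<and>
    (LINT y|lebesgue_on \<Omega>. z y) \<le> (LINT y|lebesgue_on \<Omega>. x y) + \<epsilon>" for x z :: "'a \<Rightarrow> real"
  have "\<exists>\<zeta>. \<forall>n. P n (\<zeta> n) \<and> Q (\<zeta> n) (\<zeta> (Suc n))"
  proof (rule dependent_nat_choice)
    show "\<exists>x. P 0 x" using \<psi> by (auto simp: P_def)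
    fix x n assume "P n x"
    then have "x \<in> test_functions \<Omega>" "\<And>y. x y \<ge> 0" by (auto simp: P_def)
    then obtain z where "z \<in> test_functions \<Omega>" "\<And>y. z y \<ge> 0" "residual_le \<Omega> \<mu> \<epsilon> x z"
      "(LINT y|lebesgue_on \<Omega>. z y) \<le> (LINT y|lebesgue_on \<Omega>. x y) + \<epsilon>"
      using approximate_resolvent[OF _ _ \<Omega> \<open>\<mu> > 0\<close> \<open>\<epsilon> > 0\<close>] by blast
    then have "P (Suc n) z \<and> Q x z" by (simp add: P_def Q_def)
    then show "\<exists>y. P (Suc n) y \<and> Q x y" by blast
  qed
  then obtain \<zeta> where z: "\<And>n. P n (\<zeta> n)" "\<And>n. Q (\<zeta> n) (\<zeta> (Suc n))" by blast
  have z0: "\<zeta> 0 = \<psi>" using z(1)[of 0] by (simp add: P_def)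
  show ?thesis
  proof (rule that[of \<zeta>])
    show "(LINT y|lebesgue_on \<Omega>. \<zeta> j y) \<le> (LINT y|lebesgue_on \<Omega>. \<psi> y) + real j * \<epsilon>" for j
    proof (induction j)
      case (Suc j)
      then show ?case using z(2)[of j] by (simp add: Q_def algebra_simps)
    qed (simp add: z0)
  qed (use z z0 in \<open>auto simp: P_def Q_def\<close>)
qed

text \<open>The residual is tested with the increment \<open>w = z - x\<close>, using
  \<open>2 (grad z, grad w) = |grad z|^2 - |grad x|^2 + |grad w|^2\<close>. Summed over the steps,
  the right-hand side telescopes, so the squared gradient jumps are bounded by the gradient of the
  datum; this controls the interpolation in time.\<close>

lemma step_energy:
  assumes z: "z \<in> test_functions \<Omega>" and x: "x \<in> test_functions \<Omega>" and \<Omega>: "open \<Omega>"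
    and res: "residual_le \<Omega> \<mu> \<epsilon> x z" and "\<mu> > 0"
  shows "(L2_norm \<Omega> (\<lambda>y. grad z y - grad x y))\<^sup>2 \<le>
    2 * ((L2_norm \<Omega> (grad x))\<^sup>2 - (L2_norm \<Omega> (grad z))\<^sup>2) + \<epsilon>\<^sup>2 * (1 / \<mu> + 4 / \<mu>\<^sup>2)"
proof -
  define w where "w y = z y - x y" for y
  have wT: "w \<in> test_functions \<Omega>" unfolding w_def by (intro test_diff z x)
  have gw: "grad w = (\<lambda>y. grad z y - grad x y)"
    unfolding w_def using grad_diff_test[OF z x] by auto
  have L: "grad z \<in> L2 \<Omega>" "grad x \<in> L2 \<Omega>" "grad w \<in> L2 \<Omega>"
    using z x wT \<Omega> by (auto intro: grad_L2)
  define p where "p = L2_norm \<Omega> w"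
  define g where "g = L2_norm \<Omega> (grad w)"
  define A where "A = (L2_norm \<Omega> (grad z))\<^sup>2"
  define B where "B = (L2_norm \<Omega> (grad x))\<^sup>2"
  have "g\<^sup>2 = A - 2 * L2_inner \<Omega> (grad z) (grad x) + B"
    unfolding g_def A_def B_def L2_norm_power2 gw using L L2_diff[OF L(1,2)]
    by (simp add: L2_inner_diff_left L2_inner_diff_right L2_inner_commute[of \<Omega> "grad x" "grad z"])
  moreover have "L2_inner \<Omega> (grad z) (grad w) = A - L2_inner \<Omega> (grad z) (grad x)"
    unfolding gw A_def L2_norm_power2 using L by (simp add: L2_inner_diff_right)
  ultimately have e1: "L2_inner \<Omega> (grad z) (grad w) = (A - B + g\<^sup>2) / 2" by simp
  have "p\<^sup>2 + \<mu> * L2_inner \<Omega> (grad z) (grad w) \<le> \<epsilon> * (p + g)"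
  proof -
    have "\<bar>L2_inner \<Omega> w w + \<mu> * L2_inner \<Omega> (grad z) (grad w)\<bar> \<le> \<epsilon> * (p + g)"
      using bspec[OF res[unfolded residual_le_def] wT] by (simp add: p_def g_def w_def[abs_def])
    then show ?thesis by (simp add: p_def L2_norm_power2)
  qed
  then have "p\<^sup>2 + \<mu> * ((A - B + g\<^sup>2) / 2) \<le> \<epsilon> * p + \<epsilon> * g"
    by (simp add: e1 distrib_left)
  \<comment> \<open>The defect is absorbed by Young's inequality: its \<open>p\<close> part by the
    whole of \<open>p\<^sup>2\<close>, its \<open>g\<close> part by half of the
    \<open>g\<^sup>2\<close> term.\<close>
  moreover have "\<epsilon> * p \<le> p\<^sup>2 + \<epsilon>\<^sup>2 / 4"
    using zero_le_power2[of "p - \<epsilon> / 2"] by (simp add: power2_eq_square algebra_simps)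
  moreover have "\<epsilon> * g \<le> \<mu> / 4 * g\<^sup>2 + \<epsilon>\<^sup>2 / \<mu>"
  proof -
    have "0 \<le> \<mu> * (g / 2 - \<epsilon> / \<mu>)\<^sup>2" using \<open>\<mu> > 0\<close> by simp
    also have "\<dots> = \<mu> / 4 * g\<^sup>2 - \<epsilon> * g * (\<mu> / \<mu>) + (\<epsilon>\<^sup>2 / \<mu>) * (\<mu> / \<mu>)"
      by (simp add: power2_eq_square algebra_simps)
    also have "\<dots> = \<mu> / 4 * g\<^sup>2 - \<epsilon> * g + \<epsilon>\<^sup>2 / \<mu>" using \<open>\<mu> > 0\<close> by simp
    finally show ?thesis by simp
  qed
  ultimately have "\<mu> * ((A - B + g\<^sup>2) / 2) \<le> \<epsilon>\<^sup>2 / 4 + (\<mu> / 4 * g\<^sup>2 + \<epsilon>\<^sup>2 / \<mu>)"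
    by linarith
  then have "\<mu> * g\<^sup>2 \<le> \<mu> * (2 * (B - A) + \<epsilon>\<^sup>2 * (1 / \<mu> + 4 / \<mu>\<^sup>2))"
  proof -
    have "\<mu> * (2 * (B - A) + \<epsilon>\<^sup>2 * (1 / \<mu> + 4 / \<mu>\<^sup>2)) = 2 * (\<mu> * B) - 2 * (\<mu> * A) + \<epsilon>\<^sup>2 + 4 * (\<epsilon>\<^sup>2 / \<mu>)"
      using \<open>\<mu> > 0\<close> by (simp add: field_simps power2_eq_square)
    moreover have "\<mu> * ((A - B + g\<^sup>2) / 2) = (\<mu> * A - \<mu> * B + \<mu> * g\<^sup>2) / 2"
      by (simp add: algebra_simps)
    moreover have "X \<le> 2 * Q - 2 * P + F + 4 * E" if "(P - Q + X) / 2 \<le> F / 4 + (X / 4 + E)" for X P Q F E :: real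
      using that by simp
    note this[of "\<mu> * A" "\<mu> * B" "\<mu> * g\<^sup>2" "\<epsilon>\<^sup>2" "\<epsilon>\<^sup>2 / \<mu>"]
    ultimately show ?thesis
      using \<open>\<mu> * ((A - B + g\<^sup>2) / 2) \<le> \<epsilon>\<^sup>2 / 4 + (\<mu> / 4 * g\<^sup>2 + \<epsilon>\<^sup>2 / \<mu>)\<close> by simp
  qed
  then have "g\<^sup>2 \<le> 2 * (B - A) + \<epsilon>\<^sup>2 * (1 / \<mu> + 4 / \<mu>\<^sup>2)"
    using \<open>\<mu> > 0\<close> by simp
  then show ?thesis by (simp add: g_def A_def B_def gw)
qed

text \<open>An algebraic form of comparison with the integral of \<open>x powr (- 3 / 4)\<close>:
  with \<open>t\<close> and \<open>s\<close> the fourth roots of \<open>n + 1\<close> and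
  \<open>n\<close>, \<open>1 = t ^ 4 - s ^ 4 \<le> 4 * (t - s) * t ^ 3\<close>, so the new summand
  \<open>1 / t ^ 3\<close> is at most \<open>4 * t - 4 * s\<close>.\<close>

lemma sum_powr_le: "(\<Sum>j<n. real (Suc j) powr (- 3 / 4)) \<le> 4 * real n powr (1 / 4)"
proof (induction n)
  case (Suc n)
  define s where "s = real n powr (1 / 4)"
  define t where "t = real (Suc n) powr (1 / 4)"
  have st: "0 \<le> s" "s \<le> t" "t > 0" by (auto simp: s_def t_def intro: powr_mono2)
  have "s ^ 4 = real n" by (cases "n = 0") (auto simp: s_def powr_powr simp flip: powr_realpow)
  moreover have t4: "t ^ 4 = real (Suc n)" by (auto simp: t_def powr_powr simp flip: powr_realpow)
  ultimately have "1 = t ^ 4 - s ^ 4" by simp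
  also have "\<dots> = (t - s) * (t ^ 3 + t\<^sup>2 * s + t * s\<^sup>2 + s ^ 3)"
    by (simp add: algebra_simps power_numeral_reduce)
  also have "\<dots> \<le> (t - s) * (t ^ 3 + t\<^sup>2 * t + t * t\<^sup>2 + t ^ 3)"
    using st by (intro mult_left_mono add_mono power_mono mult_left_mono) auto
  also have "\<dots> = (4 * t - 4 * s) * t ^ 3" by (simp add: algebra_simps power_numeral_reduce)
  finally have "1 / t ^ 3 \<le> 4 * t - 4 * s" using st by (simp add: divide_le_eq)
  moreover have "real (Suc n) powr (- 3 / 4) = 1 / t ^ 3"
    by (simp add: t_def powr_powr powr_minus_divide[symmetric] flip: powr_realpow)
  ultimately show ?case using Suc by (simp add: s_def t_def)
qed simp

text \<open>\<open>C * s powr (- 3 / 4)\<close> is a barrier for \<open>q\<close> at time \<open>s\<close>: if \<open>q\<close> exceeded it after the step, then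
  Nash's inequality with \<open>r = a * sqrt s\<close> would make the gradient so large that the step decreases \<open>q\<close>
  by a factor \<open>1 + 2 * h / s\<close>, which is more than the decrease of the barrier.\<close>

lemma decay_step:
  fixes q q' g d h s \<rho> a C \<epsilon> :: real and j :: nat
  assumes pos: "q \<ge> 0" "g \<ge> 0" "d > 0" "h > 0" "\<epsilon> > 0"
    and en: "q\<^sup>2 + h * d * g\<^sup>2 \<le> q * q' + \<epsilon> * (q + g)"
    and nash: "\<And>r. 0 < r \<Longrightarrow> r \<le> 1 \<Longrightarrow> q\<^sup>2 \<le> 9 * r\<^sup>2 * g\<^sup>2 + 2 / r ^ 3"
    and \<epsilon>: "\<epsilon> \<le> h * d" "2 * \<epsilon> \<le> h"
    and a: "0 < a" "a \<le> 1" "108 * a\<^sup>2 \<le> d" and C: "C \<ge> 1" "C\<^sup>2 * a ^ 3 \<ge> 4"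
    and j: "j \<ge> 1" "real (Suc j) * h \<le> 1"
    and q': "q' \<le> C * (real j * h) powr (- 3 / 4)"
  shows "q \<le> C * (real (Suc j) * h) powr (- 3 / 4)"
proof (rule ccontr)
  define s where "s = real (Suc j) * h"
  have s: "0 < s" "s \<le> 1" using pos j by (auto simp: s_def)
  define \<rho> where "\<rho> = s powr (- 3 / 4)"
  \<comment> \<open>Times up to 1 keep the barrier at least 1, so the assumed violation gives
    \<open>q > 1\<close>; this lets constants be absorbed into multiples of
    \<open>q\<close>.\<close>
  have \<rho>: "\<rho> \<ge> 1" unfolding \<rho>_def using s powr_mono2'[of "-3/4" s 1] by simp
  assume "\<not> q \<le> C * (real (Suc j) * h) powr (- 3 / 4)"
  then have qB: "q > C * \<rho>" by (simp add: s_def \<rho>_def)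
  have "1 * 1 \<le> C * \<rho>" using C \<rho> by (intro mult_mono) auto
  then have q1: "q > 1" using qB by simp
  have \<rho>2: "\<rho>\<^sup>2 = 1 / (s * sqrt s)"
  proof -
    have "\<rho>\<^sup>2 = s powr (- (3 / 2))" by (simp add: \<rho>_def power2_eq_square flip: powr_add)
    also have "\<dots> = 1 / (s powr (1 + 1 / 2))" by (simp add: powr_minus_divide)
    also have "s powr (1 + 1 / 2) = s * sqrt s" using s by (subst powr_add) (simp add: powr_half_sqrt)
    finally show ?thesis .
  qed
  define r where "r = a * sqrt s"
  have r: "0 < r" "r \<le> 1" using a s by (auto simp: r_def intro: mult_le_one)
  have r2: "r\<^sup>2 = a\<^sup>2 * s" using s by (simp add: r_def power_mult_distrib)
  have r3: "2 / r ^ 3 = (2 / a ^ 3) * \<rho>\<^sup>2"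
  proof -
    have "r ^ 3 = a ^ 3 * (s * sqrt s)"
      using s by (simp add: r_def power3_eq_cube power_mult_distrib)
    then show ?thesis by (simp add: \<rho>2)
  qed
  have "C\<^sup>2 * \<rho>\<^sup>2 \<le> q\<^sup>2"
    using power_mono[of "C * \<rho>" q 2] qB C \<rho> by (simp add: power_mult_distrib)
  \<comment> \<open>Here the size of \<open>C\<close> enters: Nash's mass term is at most half of
    \<open>q\<^sup>2\<close>, and moving it to the left doubles the 9 to 18.\<close>
  moreover have "(4 / a ^ 3) * \<rho>\<^sup>2 \<le> C\<^sup>2 * \<rho>\<^sup>2"
    using C a by (intro mult_right_mono) (auto simp: field_simps)
  ultimately have "2 / r ^ 3 \<le> q\<^sup>2 / 2" unfolding r3 by simp
  then have g2: "q\<^sup>2 \<le> 18 * (a\<^sup>2 * s) * g\<^sup>2"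
    using nash[OF r] by (simp add: r2)
  \<comment> \<open>As 108 = 6 * 18, the dissipation is at least
    \<open>6 * (h / s) * q\<^sup>2\<close>. Half of it absorbs \<open>\<epsilon> * g\<close>; of the
    remaining three units one absorbs \<open>3 / 2 * \<epsilon>\<close>, and two are left for the
    contradiction.\<close>
  have "6 * (h / s) * q\<^sup>2 \<le> 6 * (h / s) * (18 * (a\<^sup>2 * s) * g\<^sup>2)"
    using g2 pos s by (intro mult_left_mono) auto
  also have "\<dots> = h * (108 * a\<^sup>2) * g\<^sup>2" using s by simp
  also have "\<dots> \<le> h * d * g\<^sup>2" using a pos by (intro mult_right_mono mult_left_mono) auto
  finally have 1: "6 * (h / s) * q\<^sup>2 \<le> h * d * g\<^sup>2" .
  have 2: "\<epsilon> * g \<le> h * d * g\<^sup>2 / 2 + \<epsilon> / 2 * q"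
  proof -
    have "\<epsilon> * g \<le> \<epsilon> * (g\<^sup>2 / 2 + 1 / 2)"
      using pos sum_squares_bound[of g 1] by (intro mult_left_mono) auto
    also have "\<dots> \<le> h * d * (g\<^sup>2 / 2) + \<epsilon> * (1 / 2)"
      using \<epsilon> unfolding distrib_left by (intro add_mono mult_right_mono) auto
    also have "\<epsilon> * (1 / 2) \<le> \<epsilon> / 2 * q" using q1 pos by simp
    finally show ?thesis by simp
  qed
  have "q\<^sup>2 + 3 * (h / s) * q\<^sup>2 \<le> q * q' + 3 / 2 * \<epsilon> * q"
    using en 1 2 unfolding distrib_left by linarith
  then have "q * (q + 3 * (h / s) * q) \<le> q * (q' + 3 / 2 * \<epsilon>)"
    by (simp add: algebra_simps power2_eq_square)
  then have "q + 3 * (h / s) * q \<le> q' + 3 / 2 * \<epsilon>" using q1 by simp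
  moreover have "3 / 2 * \<epsilon> \<le> (h / s) * q"
  proof -
    have "3 / 2 * \<epsilon> \<le> h * 1" using \<epsilon> pos by simp
    also have "\<dots> \<le> (h / s) * q"
      using s q1 pos by (intro mult_mono) (auto simp: le_divide_eq)
    finally show ?thesis .
  qed
  moreover have hs: "h / s = 1 / real (Suc j)" using pos by (simp add: s_def)
  ultimately have 3: "q * (1 + 2 / real (Suc j)) \<le> q'" by (simp add: algebra_simps)
  have "(real j * h) powr (- 3 / 4) = \<rho> * ((real j / real (Suc j)) powr (- 3 / 4))"
    using pos j by (simp add: \<rho>_def s_def mult.commute[of h] flip: powr_mult)
  also have "\<dots> \<le> \<rho> * (1 + 2 / real (Suc j))"
  proof (rule mult_left_mono)
    have "(real j / real (Suc j)) powr (- 3 / 4) \<le> (real j / real (Suc j)) powr (- 1)"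
      using j by (intro powr_mono') auto
    also have "\<dots> = 1 + 1 / real j" using j by (simp add: powr_minus_divide field_simps)
    \<comment> \<open>This is \<open>j + 1 \<le> 2 * j\<close>, so \<open>j \<ge> 1\<close>
      matters.\<close>
    also have "\<dots> \<le> 1 + 2 / real (Suc j)" using j by (simp add: field_simps)
    finally show "(real j / real (Suc j)) powr (- 3 / 4) \<le> 1 + 2 / real (Suc j)" .
  qed (use \<rho> in simp)
  finally have "q' \<le> C * (\<rho> * (1 + 2 / real (Suc j)))"
    using q' mult_left_mono[of _ _ C] C by (meson order_trans zero_le_one)
  with 3 have "q * (1 + 2 / real (Suc j)) \<le> (C * \<rho>) * (1 + 2 / real (Suc j))" by (simp add: mult.assoc)
  moreover have "1 + 2 / real (Suc j) > 0" by (simp add: add_pos_nonneg)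
  ultimately have "q \<le> C * \<rho>" using mult_right_le_imp_le by blast
  with qB show False by simp
qed

text \<open>The residual tested with \<open>z\<close> itself, the discrete energy identity;
  Cauchy-Schwarz replaces the mixed product by norms, leaving an inequality between numbers.\<close>

lemma step_decay_inequality:
  assumes z: "z \<in> test_functions \<Omega>" and x: "x \<in> test_functions \<Omega>" and \<Omega>: "open \<Omega>"
    and res: "residual_le \<Omega> \<mu> \<epsilon> x z"
  shows "(L2_norm \<Omega> z)\<^sup>2 + \<mu> * (L2_norm \<Omega> (grad z))\<^sup>2
    \<le> L2_norm \<Omega> z * L2_norm \<Omega> x + \<epsilon> * (L2_norm \<Omega> z + L2_norm \<Omega> (grad z))"
proof -
  have L: "z \<in> L2 \<Omega>" "x \<in> L2 \<Omega>" using z x \<Omega> by (auto intro: test_L2)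
  have "\<bar>L2_inner \<Omega> (\<lambda>y. z y - x y) z + \<mu> * L2_inner \<Omega> (grad z) (grad z)\<bar>
      \<le> \<epsilon> * (L2_norm \<Omega> z + L2_norm \<Omega> (grad z))"
    using bspec[OF res[unfolded residual_le_def] z] .
  moreover have "L2_inner \<Omega> (\<lambda>y. z y - x y) z = (L2_norm \<Omega> z)\<^sup>2 - L2_inner \<Omega> x z"
    using L by (simp add: L2_inner_diff_left L2_norm_power2)
  moreover have "L2_inner \<Omega> x z \<le> L2_norm \<Omega> z * L2_norm \<Omega> x"
    using L2_Cauchy_Schwarz[OF L(2,1)] by (simp add: mult.commute)
  ultimately show ?thesis by (simp add: L2_norm_power2)
qed

text \<open>For \<open>r \<le> 1\<close> the power \<open>1 / r ^ n\<close> is at most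
  \<open>1 / r ^ 3\<close>, so all admissible dimensions are treated as dimension 3 and share the
  decay rate 3/4.\<close>

lemma Nash_inequality_unit_mass:
  fixes z :: "'a::euclidean_space \<Rightarrow> real"
  assumes z: "z \<in> test_functions \<Omega>" "\<And>y. z y \<ge> 0" and \<Omega>: "open \<Omega>" and dim: "DIM('a) \<le> 3"
    and mass: "(LINT y|lebesgue_on \<Omega>. z y) \<le> 1" and r: "0 < r" "r \<le> 1"
  shows "(L2_norm \<Omega> z)\<^sup>2 \<le> 9 * r\<^sup>2 * (L2_norm \<Omega> (grad z))\<^sup>2 + 2 / r ^ 3"
proof -
  define m where "m = (LINT y|lebesgue_on \<Omega>. \<bar>z y\<bar>)"
  have m: "0 \<le> m" "m \<le> 1" using mass z(2) by (auto simp: m_def)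
  have "(L2_norm \<Omega> z)\<^sup>2 \<le> (real DIM('a) * r)\<^sup>2 * (L2_norm \<Omega> (grad z))\<^sup>2 + 2 / r ^ DIM('a) * m\<^sup>2"
    unfolding m_def by (rule Nash_inequality[OF z(1) \<Omega> r(1)])
  also have "\<dots> \<le> (3 * r)\<^sup>2 * (L2_norm \<Omega> (grad z))\<^sup>2 + 2 / r ^ 3 * 1"
  proof (intro add_mono mult_mono mult_right_mono power_mono)
    show "real DIM('a) \<le> 3" using dim by simp
    show "2 / r ^ DIM('a) \<le> 2 / r ^ 3"
      using r dim by (intro divide_left_mono power_decreasing) auto
    show "m\<^sup>2 \<le> 1" using m by (simp add: power_le_one)
  qed (use r in auto)
  finally show ?thesis by (simp add: power_mult_distrib)
qed

text \<open>Starts the decay induction at step 1: the barrier is infinite at time 0, where moreover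
  \<open>0 powr _\<close> is 0 by convention. One step is compared crudely with the datum, and a
  large \<open>N\<close> lifts the barrier at time \<open>1 / N\<close> above that.\<close>

lemma first_step_bound:
  fixes q q' g \<mu> \<epsilon> :: real
  assumes "q\<^sup>2 + \<mu> * g\<^sup>2 \<le> q * q' + \<epsilon> * (q + g)" "q' \<ge> 0" "0 < \<epsilon>" "\<epsilon> \<le> \<mu>" "\<epsilon> \<le> 1 / 2"
  shows "q \<le> q' + 1"
proof (cases "q \<le> 1")
  case False
  have "\<epsilon> * g \<le> \<epsilon> * (g\<^sup>2 / 2 + 1 / 2)"
    using assms sum_squares_bound[of g 1] by (intro mult_left_mono) auto
  also have "\<dots> \<le> \<mu> * g\<^sup>2 + \<epsilon> * q"
    using assms False unfolding distrib_left by (intro add_mono mult_mono mult_left_mono) auto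
  finally have "q * q \<le> q * (q' + 2 * \<epsilon>)"
    using assms(1) by (simp add: algebra_simps power2_eq_square)
  then have "q \<le> q' + 2 * \<epsilon>" using False by simp
  then show ?thesis using assms by simp
qed (use assms in simp)

text \<open>The dual problem: implicit Euler steps of length \<open>1 / N\<close> for the backward heat equation
  with final datum \<open>\<psi>\<close>, numbered backwards in time. The constant \<open>C\<close> in the bounds is
  independent of \<open>\<psi>\<close>.\<close>

definition euler_scheme ::
  "'a::euclidean_space set \<Rightarrow> real \<Rightarrow> nat \<Rightarrow> real \<Rightarrow> real \<Rightarrow> ('a \<Rightarrow> real) \<Rightarrow> (nat \<Rightarrow> 'a \<Rightarrow> real) \<Rightarrow> bool" where
  "euler_scheme \<Omega> d N C \<epsilon> \<psi> \<zeta> \<longleftrightarrow> \<zeta> 0 = \<psi> \<and>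
    (\<forall>j. \<zeta> j \<in> test_functions \<Omega> \<and> (\<forall>y. \<zeta> j y \<ge> 0) \<and> residual_le \<Omega> (d / real N) \<epsilon> (\<zeta> j) (\<zeta> (Suc j))) \<and>
    L2_norm \<Omega> (\<zeta> N) \<le> C \<and>
    (\<Sum>j<N. L2_norm \<Omega> (\<zeta> j) + L2_norm \<Omega> (\<zeta> (Suc j))) / real N \<le> 8 * C + L2_norm \<Omega> \<psi> / real N \<and>
    (\<Sum>j<N. (L2_norm \<Omega> (\<lambda>y. grad (\<zeta> (Suc j)) y - grad (\<zeta> j) y))\<^sup>2) \<le> 2 * (L2_norm \<Omega> (grad \<psi>))\<^sup>2 + 1"

text \<open>The barrier constant is fixed by \<open>d\<close> alone, before datum and step number;
  the datum only asks for a large \<open>N\<close>. The defect \<open>\<epsilon>\<close> is chosen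
  last and may be forced below any \<open>\<eta>\<close> that depends on \<open>N\<close>.\<close>

lemma euler_scheme_exists:
  fixes \<Omega> :: "'a::euclidean_space set"
  assumes \<Omega>: "open \<Omega>" "bounded \<Omega>" and dim: "DIM('a) \<le> 3" and d: "d > 0"
  obtains C :: real where "C \<ge> 1"
    "\<And>\<psi> N \<eta>. \<psi> \<in> test_functions \<Omega> \<Longrightarrow> (\<And>y. \<psi> y \<ge> 0) \<Longrightarrow> (LINT y|lebesgue_on \<Omega>. \<psi> y) \<le> 1 / 2 \<Longrightarrow>
      N \<ge> 1 \<Longrightarrow> L2_norm \<Omega> \<psi> + 1 \<le> C * real N powr (3 / 4) \<Longrightarrow> \<eta> > 0 \<Longrightarrow>
      \<exists>\<epsilon> \<zeta>. 0 < \<epsilon> \<and> \<epsilon> \<le> \<eta> \<and> euler_scheme \<Omega> d N C \<epsilon> \<psi> \<zeta>"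
proof -
  \<comment> \<open>Side length of the cubes in units of the square root of time: at most 1 so that
    cubes stay admissible, and with \<open>108 * a\<^sup>2 \<le> d\<close> for the decay
    step.\<close>
  define a where "a = min 1 (sqrt (d / 108))"
  have a: "0 < a" "a \<le> 1" using d by (auto simp: a_def)
  have a2: "108 * a\<^sup>2 \<le> d"
  proof -
    have "a\<^sup>2 \<le> (sqrt (d / 108))\<^sup>2" using a by (intro power_mono) (auto simp: a_def)
    then show ?thesis using d by simp
  qed
  define C where "C = 1 + 4 / a ^ 3"
  have C1: "C \<ge> 1" using a by (simp add: C_def)
  have C2: "C\<^sup>2 * a ^ 3 \<ge> 4"
  proof -
    have "C * a ^ 3 \<le> C * C * a ^ 3" using C1 a by (intro mult_right_mono) auto
    moreover have "C * a ^ 3 = a ^ 3 + 4" using a by (simp add: C_def distrib_right)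
    moreover have "a ^ 3 > 0" using a by simp
    ultimately show ?thesis unfolding power2_eq_square by linarith
  qed
  show ?thesis
  proof (rule that[OF C1])
    fix \<psi> :: "'a \<Rightarrow> real" and N :: nat and \<eta> :: real
    assume \<psi>: "\<psi> \<in> test_functions \<Omega>" "\<And>y. \<psi> y \<ge> 0" and mass: "(LINT y|lebesgue_on \<Omega>. \<psi> y) \<le> 1 / 2"
      and N: "N \<ge> 1" "L2_norm \<Omega> \<psi> + 1 \<le> C * real N powr (3 / 4)" and \<eta>: "\<eta> > 0"
    define h where "h = 1 / real N"
    have h: "h > 0" "real N * h = 1" "h \<le> 1" using N by (auto simp: h_def)
    define \<mu> where "\<mu> = d / real N"
    have \<mu>: "\<mu> > 0" "\<mu> = h * d" using N d by (auto simp: \<mu>_def h_def)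
    \<comment> \<open>The coefficient of \<open>\<epsilon>\<^sup>2\<close> accumulated by
      \<open>step_energy\<close> over \<open>N\<close> steps; \<open>\<epsilon> \<le> 1 / E\<close>
      keeps the total below 1.\<close>
    define E where "E = real N * (1 / \<mu> + 4 / \<mu>\<^sup>2)"
    have E: "E > 0" unfolding E_def using \<mu> N by (intro mult_pos_pos add_pos_pos) auto
    define \<epsilon> where "\<epsilon> = Min {\<eta>, \<mu>, h / 2, 1 / E}"
    have \<epsilon>: "\<epsilon> > 0" "\<epsilon> \<le> \<eta>" "\<epsilon> \<le> \<mu>" "\<epsilon> \<le> h / 2" "\<epsilon> \<le> 1 / E"
      using \<eta> \<mu> h E by (auto simp: \<epsilon>_def)
    obtain \<zeta> where \<zeta>: "\<zeta> 0 = \<psi>" "\<And>j. \<zeta> j \<in> test_functions \<Omega>" "\<And>j y. \<zeta> j y \<ge> 0"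
      and res: "\<And>j. residual_le \<Omega> \<mu> \<epsilon> (\<zeta> j) (\<zeta> (Suc j))"
      and ms: "\<And>j. (LINT y|lebesgue_on \<Omega>. \<zeta> j y) \<le> (LINT y|lebesgue_on \<Omega>. \<psi> y) + real j * \<epsilon>"
      using resolvent_chain[OF \<psi> \<Omega> \<mu>(1) \<epsilon>(1)] by blast
    define q where "q j = L2_norm \<Omega> (\<zeta> j)" for j
    define g where "g j = L2_norm \<Omega> (grad (\<zeta> j))" for j
    have en: "(q (Suc j))\<^sup>2 + \<mu> * (g (Suc j))\<^sup>2 \<le> q (Suc j) * q j + \<epsilon> * (q (Suc j) + g (Suc j))" for j
      unfolding q_def g_def by (rule step_decay_inequality[OF \<zeta>(2,2) \<Omega>(1) res])
    have mass1: "(LINT y|lebesgue_on \<Omega>. \<zeta> j y) \<le> 1" if "j \<le> N" for j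
    proof -
      \<comment> \<open>Up to \<open>N\<close> gains of at most \<open>h / 2\<close> add at most 1/2
        to the initial 1/2, so Nash's inequality for mass 1 applies at every step.\<close>
      have "real j * \<epsilon> \<le> real N * (h / 2)" using that \<epsilon> by (intro mult_mono) auto
      then show ?thesis using ms[of j] mass h by simp
    qed
    have decay: "q j \<le> C * (real j * h) powr (- 3 / 4)" if "j \<ge> 1" "j \<le> N" for j
      using that
    proof (induction j rule: nat_induct_at_least)
      case base
      have "q (Suc 0) \<le> q 0 + 1"
        using \<epsilon> h by (intro first_step_bound[OF en]) (auto simp: q_def)
      also have "\<dots> \<le> C * real N powr (3 / 4)" using N by (simp add: q_def \<zeta>)
      also have "real N powr (3 / 4) = h powr (- 3 / 4)"
        using N by (simp add: h_def powr_divide powr_minus_divide)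
      finally show ?case by simp
    next
      case (Suc j)
      show ?case
      proof (rule decay_step[where a = a and q' = "q j" and g = "g (Suc j)" and \<epsilon> = \<epsilon> and d = d])
        show "(q (Suc j))\<^sup>2 + h * d * (g (Suc j))\<^sup>2 \<le> q (Suc j) * q j + \<epsilon> * (q (Suc j) + g (Suc j))"
          using en[of j] by (simp add: \<mu>(2))
        show "(q (Suc j))\<^sup>2 \<le> 9 * r\<^sup>2 * (g (Suc j))\<^sup>2 + 2 / r ^ 3" if "0 < r" "r \<le> 1" for r
          unfolding q_def g_def
          by (rule Nash_inequality_unit_mass[OF \<zeta>(2,3) \<Omega>(1) dim mass1 that]) (rule Suc.prems)
        show "real (Suc j) * h \<le> 1"
          using mult_right_mono[of "real (Suc j)" "real N" h] Suc.prems h by simp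
        show "q j \<le> C * (real j * h) powr (- 3 / 4)" using Suc by simp
      qed (use \<epsilon> \<mu> h a a2 C1 C2 d Suc in \<open>auto simp: q_def g_def\<close>)
    qed
    have qN: "q N \<le> C" using decay[of N] N h by simp
    have "(\<Sum>j<N. q (Suc j)) \<le> (\<Sum>j<N. C * (real N powr (3 / 4) * real (Suc j) powr (- 3 / 4)))"
    proof (rule sum_mono)
      fix j assume "j \<in> {..<N}"
      then have "q (Suc j) \<le> C * (real (Suc j) * h) powr (- 3 / 4)" by (intro decay) auto
      also have "(real (Suc j) * h) powr (- 3 / 4) = real N powr (3 / 4) * real (Suc j) powr (- 3 / 4)"
        using N by (simp add: h_def powr_divide powr_minus_divide)
      finally show "q (Suc j) \<le> C * (real N powr (3 / 4) * real (Suc j) powr (- 3 / 4))" .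
    qed
    also have "\<dots> = C * (real N powr (3 / 4)) * (\<Sum>j<N. real (Suc j) powr (- 3 / 4))"
      by (simp add: sum_distrib_left mult.assoc)
    also have "\<dots> \<le> C * (real N powr (3 / 4)) * (4 * real N powr (1 / 4))"
      using C1 by (intro mult_left_mono sum_powr_le) auto
    also have "\<dots> = 4 * C * real N" using N by (simp flip: powr_add)
    finally have s1: "(\<Sum>j<N. q (Suc j)) \<le> 4 * C * real N" .
    \<comment> \<open>Beginning at index 0 instead of 1 costs the norm of the datum just once; after
      division by \<open>N\<close> it is negligible. The two sums of size \<open>4 * C * N\<close>
      give the 8.\<close>
    have "(\<Sum>j<N. q j) \<le> (\<Sum>j<Suc N. q j)" by (simp add: q_def)
    also have "\<dots> = q 0 + (\<Sum>j<N. q (Suc j))" by (rule sum.lessThan_Suc_shift)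
    finally have s2: "(\<Sum>j<N. q j + q (Suc j)) \<le> L2_norm \<Omega> \<psi> + 8 * C * real N"
      using s1 by (simp add: sum.distrib q_def \<zeta>)
    have sums: "(\<Sum>j<N. q j + q (Suc j)) / real N \<le> 8 * C + L2_norm \<Omega> \<psi> / real N"
    proof -
      have "(\<Sum>j<N. q j + q (Suc j)) / real N \<le> (L2_norm \<Omega> \<psi> + 8 * C * real N) / real N"
        by (rule divide_right_mono[OF s2]) simp
      also have "\<dots> = 8 * C + L2_norm \<Omega> \<psi> / real N" using N by (simp add: add_divide_distrib)
      finally show ?thesis .
    qed
    have "(\<Sum>j<n. (L2_norm \<Omega> (\<lambda>y. grad (\<zeta> (Suc j)) y - grad (\<zeta> j) y))\<^sup>2)
        \<le> 2 * ((g 0)\<^sup>2 - (g n)\<^sup>2) + real n * (\<epsilon>\<^sup>2 * (1 / \<mu> + 4 / \<mu>\<^sup>2))" for n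
    proof (induction n)
      case (Suc n)
      have "(L2_norm \<Omega> (\<lambda>y. grad (\<zeta> (Suc n)) y - grad (\<zeta> n) y))\<^sup>2
          \<le> 2 * ((g n)\<^sup>2 - (g (Suc n))\<^sup>2) + \<epsilon>\<^sup>2 * (1 / \<mu> + 4 / \<mu>\<^sup>2)"
        unfolding g_def by (rule step_energy[OF \<zeta>(2,2) \<Omega>(1) res \<mu>(1)])
      with Suc show ?case unfolding sum.lessThan_Suc of_nat_Suc distrib_right right_diff_distrib by linarith
    qed simp
    note grads_N = this[of N]
    have "(\<Sum>j<N. (L2_norm \<Omega> (\<lambda>y. grad (\<zeta> (Suc j)) y - grad (\<zeta> j) y))\<^sup>2)
        \<le> 2 * (g 0)\<^sup>2 + \<epsilon>\<^sup>2 * E"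
    proof -
      have "real N * (\<epsilon>\<^sup>2 * (1 / \<mu> + 4 / \<mu>\<^sup>2)) = \<epsilon>\<^sup>2 * E" by (simp add: E_def)
      then show ?thesis
        using grads_N zero_le_power2[of "g N"]
        unfolding right_diff_distrib by linarith
    qed
    also have "\<epsilon>\<^sup>2 * E \<le> 1"
    proof -
      have "\<epsilon> \<le> 1" using \<epsilon> h by linarith
      then have "\<epsilon>\<^sup>2 * E \<le> \<epsilon> * E"
        using \<epsilon> E by (intro mult_right_mono) (auto simp: power2_eq_square)
      also have "\<dots> \<le> 1 / E * E" using \<epsilon> E by (intro mult_right_mono) auto
      finally show ?thesis using E by simp
    qed
    finally have grads: "(\<Sum>j<N. (L2_norm \<Omega> (\<lambda>y. grad (\<zeta> (Suc j)) y - grad (\<zeta> j) y))\<^sup>2)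
        \<le> 2 * (L2_norm \<Omega> (grad \<psi>))\<^sup>2 + 1"
      by (simp add: g_def \<zeta>)
    have "euler_scheme \<Omega> d N C \<epsilon> \<psi> \<zeta>"
      using \<zeta> res qN sums grads by (simp add: euler_scheme_def \<mu>_def q_def)
    with \<epsilon> show "\<exists>\<epsilon> \<zeta>. 0 < \<epsilon> \<and> \<epsilon> \<le> \<eta> \<and> euler_scheme \<Omega> d N C \<epsilon> \<psi> \<zeta>" by blast
  qed
qed

subsection \<open>Weak derivatives in time\<close>

text \<open>A primitive of a mollifier, rising from \<open>0\<close> to \<open>1\<close> across \<open>[- r, r]\<close>. The limits
  \<open>- 2\<close> and \<open>2\<close> presuppose \<open>r \<le> 1\<close>.\<close>

definition bump_mass :: "real \<Rightarrow> real" where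
  "bump_mass r = integral {- 2..2::real} (bump 0 r)"

definition smooth_step :: "real \<Rightarrow> real \<Rightarrow> real" where
  "smooth_step r t = integral {- 2..t} (bump 0 r) / bump_mass r"

lemma bump_integrable_on: "bump 0 r integrable_on {s..t::real}"
  using smooth_continuous[OF smooth_bump] by (rule integrable_continuous_real)

lemma bump_zero_real:
  fixes t :: real
  assumes "r > 0" "\<bar>t\<bar> \<ge> r"
  shows "bump 0 r t = 0"
  using assms by (simp add: bump_eq_0_iff)

lemma bump_mass_pos:
  assumes "0 < r" "r \<le> 1"
  shows "bump_mass r > 0"
proof (rule ccontr)
  have "bump_mass r \<ge> 0"
    unfolding bump_mass_def by (intro integral_nonneg bump_integrable_on bump_nonneg)
  moreover assume "\<not> bump_mass r > 0"
  ultimately have "integral {- 2..2::real} (bump 0 r) = 0" by (simp add: bump_mass_def)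
  then have "(bump 0 r has_integral 0) (cbox (- 2) (2::real))"
    using integrable_integral[OF bump_integrable_on[of r "- 2" 2]] by simp
  from has_integral_0_cbox_imp_0[OF _ _ this, of 0]
  have "bump 0 r (0::real) = 0"
    by (simp add: bump_nonneg smooth_continuous[OF smooth_bump])
  then show False using assms by (simp add: bump_eq_0_iff)
qed

lemma smooth_step_zero:
  assumes "0 < r" "t \<le> - r"
  shows "smooth_step r t = 0"
proof -
  have "integral {- 2..t} (bump 0 r) = integral {- 2..t} (\<lambda>t. 0)"
    using assms by (intro Henstock_Kurzweil_Integration.integral_cong bump_zero_real) auto
  then show ?thesis by (simp add: smooth_step_def)
qed

lemma smooth_step_le_one:
  assumes "0 < r" "r \<le> 1"
  shows "0 \<le> smooth_step r t" "smooth_step r t \<le> 1" "r \<le> t \<Longrightarrow> smooth_step r t = 1"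
proof -
  note c = bump_mass_pos[OF assms]
  show "0 \<le> smooth_step r t"
    unfolding smooth_step_def
    by (intro divide_nonneg_nonneg integral_nonneg bump_integrable_on bump_nonneg less_imp_le[OF c])
  have combine: "integral {- 2..s} (bump 0 r) + integral {s..u} (bump 0 r) = integral {- 2..u} (bump 0 r)"
    if "- 2 \<le> s" "s \<le> u" for s u :: real
    using that by (intro Henstock_Kurzweil_Integration.integral_combine bump_integrable_on)
  have zero: "integral {s..u} (bump 0 r) = 0" if "r \<le> s" for s u :: real
  proof -
    have "integral {s..u} (bump 0 r) = integral {s..u} (\<lambda>t. 0)"
      using that assms by (intro Henstock_Kurzweil_Integration.integral_cong bump_zero_real) auto
    then show ?thesis by simp
  qed
  show one: "smooth_step r t = 1" if "r \<le> t" for t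
  proof -
    have "integral {- 2..t} (bump 0 r) = integral {- 2..r} (bump 0 r)"
      using combine[of r t] zero[of r t] that assms by simp
    moreover have "bump_mass r = integral {- 2..r} (bump 0 r)"
      using combine[of r 2] zero[of r 2] assms by (simp add: bump_mass_def)
    ultimately show ?thesis using c by (simp add: smooth_step_def)
  qed
  show "smooth_step r t \<le> 1"
  proof -
    consider "t < - 2" | "- 2 \<le> t" "t \<le> 2" | "r \<le> t" using assms by linarith
    then show ?thesis
    proof cases
      case 1
      then show ?thesis using smooth_step_zero[OF assms(1)] assms by simp
    next
      case 2
      have "0 \<le> integral {t..2} (bump 0 r)"
        by (intro integral_nonneg bump_integrable_on bump_nonneg)
      with combine[OF 2] show ?thesis
        using c by (simp add: smooth_step_def bump_mass_def divide_le_eq)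
    qed (simp add: one)
  qed
qed

lemma smooth_step_has_derivative:
  assumes "0 < r" "r \<le> 1"
  shows "(smooth_step r has_real_derivative bump 0 r t / bump_mass r) (at t)"
proof (cases "t > - 2")
  case True
  have "((\<lambda>s. integral {- 2..s} (bump 0 r)) has_real_derivative bump 0 r t) (at t within {- 2..t + 1})"
    using True by (intro integral_has_real_derivative smooth_continuous smooth_bump) auto
  then have "((\<lambda>s. integral {- 2..s} (bump 0 r)) has_real_derivative bump 0 r t) (at t)"
    using True by (simp add: at_within_Icc_at)
  then show ?thesis unfolding smooth_step_def by (rule DERIV_cdivide)
next
  case False
  \<comment> \<open>To the left of \<open>- r\<close> the step is constantly 0; this also covers
    upper limits below \<open>- 2\<close>, where the interval of integration is empty.\<close>
  have "((\<lambda>s. 0) has_real_derivative bump 0 r t / bump_mass r) (at t)"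
    using False assms by (simp add: bump_zero_real)
  then show ?thesis
    by (rule has_field_derivative_transform_within_open[where S = "{..<- 1}"])
      (use False assms smooth_step_zero in auto)
qed

lemma smooth_smooth_step:
  assumes "0 < r" "r \<le> 1"
  shows "smooth (smooth_step r)"
proof (rule smooth_realI[OF smooth_step_has_derivative[OF assms]])
  have "smooth (\<lambda>t. (1 / bump_mass r) * bump 0 r t)" by (intro smooth_mult smooth_const smooth_bump)
  then show "smooth (\<lambda>t. bump 0 r t / bump_mass r)" by simp
qed

section \<open>Approximate identities, cutoffs and the fundamental theorem of calculus for weak
  derivatives in time\<close>

lemma bump_shift: "bump 0 r (t - a) = bump a r t"
  by (simp add: bump_def)

lemma bump_integral:
  fixes a \<tau> :: real
  assumes "0 < r" "r \<le> 1" "r < a" "a + r < \<tau>"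
  shows "(LINT t|lebesgue_on {0<..<\<tau>}. bump a r t) = bump_mass r"
proof -
  have c: "ccs {0<..<\<tau>} (bump a r)"
    using assms by (intro ccs_test bump_test) (auto simp: cball_eq_atLeastAtMost)
  have c0: "ccs {- 2..2} (bump (0::real) r)"
    using assms by (intro ccs_test bump_test) (auto simp: cball_eq_atLeastAtMost)
  have "(LINT t|lebesgue_on {0<..<\<tau>}. bump a r t) = (LINT t|lborel. bump 0 r (t + (- a)))"
    using c by (simp add: ccs_integral_on bump_shift[of r _ a])
  also have "\<dots> = (LINT t|lborel. bump (0::real) r t)"
    by (rule integral_translate_lborel[OF c0])
  also have "\<dots> = (LINT t|lebesgue_on {- 2..2}. bump (0::real) r t)"
    using c0 by (simp add: ccs_integral_on)
  also have "\<dots> = bump_mass r"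
    unfolding bump_mass_def using c0
    by (intro lebesgue_integral_eq_integral ccs_integrable_on) auto
  finally show ?thesis .
qed

lemma mollifier_tendsto:
  fixes f :: "real \<Rightarrow> real"
  assumes f: "continuous_on {0<..<\<tau>} f" and a: "0 < a" "a < \<tau>"
    and r: "\<And>n. 0 < r n" "\<And>n. r n \<le> 1" "\<And>n. r n < a" "\<And>n. a + r n < \<tau>" "r \<longlonglongrightarrow> 0"
  shows "(\<lambda>n. LINT t|lebesgue_on {0<..<\<tau>}. f t * (bump a (r n) t / bump_mass (r n))) \<longlonglongrightarrow> f a"
proof (rule LIMSEQ_I)
  fix e :: real assume "e > 0"
  let ?M = "lebesgue_on {0<..<\<tau>}"
  have "isCont f a" using f a by (simp add: continuous_on_eq_continuous_at)
  then obtain \<delta> where \<delta>: "\<delta> > 0" "\<And>t. \<bar>t - a\<bar> < \<delta> \<Longrightarrow> \<bar>f t - f a\<bar> < e / 2"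
    using \<open>e > 0\<close> unfolding continuous_at_eps_delta by (metis half_gt_zero dist_real_def)
  have "\<forall>\<^sub>F n in sequentially. r n < \<delta>" using order_tendstoD(2)[OF r(5) \<delta>(1)] .
  then obtain n0 where n0: "\<And>n. n \<ge> n0 \<Longrightarrow> r n < \<delta>" by (auto simp: eventually_sequentially)
  have fm: "f \<in> borel_measurable ?M"
    using f by (intro continuous_imp_measurable_on_sets_lebesgue) auto
  have "norm ((LINT t|?M. f t * (bump a (r n) t / bump_mass (r n))) - f a) < e" if n: "n \<ge> n0" for n
  proof -
    define k where "k t = bump a (r n) t / bump_mass (r n)" for t
    have c: "bump_mass (r n) > 0" using r by (intro bump_mass_pos)
    have k0: "k t \<ge> 0" for t using c by (simp add: k_def bump_nonneg)
    have kz: "k t = 0" if "\<not> \<bar>t - a\<bar> < \<delta>" for t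
      using that n0[OF n] r(1)[of n] by (simp add: k_def bump_eq_0_iff dist_real_def abs_minus_commute)
    have cc: "ccs {0<..<\<tau>} (bump a (r n))"
      using r(1,3,4)[of n] by (intro ccs_test bump_test) (auto simp: cball_eq_atLeastAtMost)
    have ki: "integrable ?M k"
      unfolding k_def using ccs_integrable_on[OF cc] by simp
    have k1: "(LINT t|?M. k t) = 1"
      unfolding k_def using bump_integral[of "r n" a \<tau>] r c by simp
    have le: "\<bar>(f t - f a) * k t\<bar> \<le> e / 2 * k t" for t
    proof (cases "\<bar>t - a\<bar> < \<delta>")
      case True
      from mult_right_mono[OF less_imp_le[OF \<delta>(2)[OF True]] k0[of t]] show ?thesis
        by (simp add: abs_mult k0)
    qed (simp add: kz)
    have di: "integrable ?M (\<lambda>t. (f t - f a) * k t)"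
    proof (rule Bochner_Integration.integrable_bound)
      show "integrable ?M (\<lambda>t. e / 2 * k t)" using ki by simp
      show "(\<lambda>t. (f t - f a) * k t) \<in> borel_measurable ?M"
        using fm ki by (intro borel_measurable_times borel_measurable_diff) auto
      show "AE t in ?M. norm ((f t - f a) * k t) \<le> norm (e / 2 * k t)"
        using le abs_ge_self order_trans by (intro AE_I2) (simp only: real_norm_def, blast)
    qed
    have "(LINT t|?M. f t * k t) = (LINT t|?M. (f t - f a) * k t + f a * k t)"
      by (simp add: algebra_simps)
    also have "\<dots> = (LINT t|?M. (f t - f a) * k t) + f a"
      using di ki k1 by simp
    finally have "(LINT t|?M. f t * k t) - f a = (LINT t|?M. (f t - f a) * k t)" by simp
    also have "\<bar>\<dots>\<bar> \<le> (LINT t|?M. e / 2 * k t)"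
      using integral_abs_bound_integral[OF di, of "\<lambda>t. e / 2 * k t"] ki le by simp
    also have "\<dots> = e / 2" using k1 by simp
    finally show ?thesis using \<open>e > 0\<close> by (simp add: k_def)
  qed
  then show "\<exists>n0. \<forall>n\<ge>n0. norm ((LINT t|?M. f t * (bump a (r n) t / bump_mass (r n))) - f a) < e" by blast
qed

text \<open>\<open>F\<close> is only locally integrable, so the transitions are kept so narrow that
  all cutoffs live in one compact set \<open>K\<close> inside the open interval; there domination is
  possible. Pointwise convergence to the indicator of [a,b] may fail at the two end points, a null
  set.\<close>

lemma cutoff_tendsto:
  fixes F :: "real \<Rightarrow> real"
  assumes F: "locally_integrable {0<..<\<tau>} F" and ab: "0 < a" "a < b" "b < \<tau>" and p: "continuous_on UNIV p"
    and r: "\<And>n. 0 < r n" "\<And>n. r n \<le> 1" "\<And>n. r n \<le> a / 2" "\<And>n. r n \<le> (\<tau> - b) / 2" "r \<longlonglongrightarrow> 0"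
  shows "(\<lambda>n. LINT t|lebesgue_on {0<..<\<tau>}. F t * (p t * (smooth_step (r n) (t - a) - smooth_step (r n) (t - b))))
    \<longlonglongrightarrow> (LINT t|lebesgue_on {a..b}. F t * p t)"
proof -
  let ?M = "lebesgue_on {0<..<\<tau>}"
  define K where "K = {a / 2..b + (\<tau> - b) / 2}"
  have K: "compact K" "K \<subseteq> {0<..<\<tau>}" using ab by (auto simp: K_def field_simps)
  define cut where "cut n t = smooth_step (r n) (t - a) - smooth_step (r n) (t - b)" for n t
  have cutb: "\<bar>cut n t\<bar> \<le> 1" for n t
    using smooth_step_le_one(1,2)[OF r(1,2), of n "t - a"] smooth_step_le_one(1,2)[OF r(1,2), of n "t - b"]
    by (auto simp: cut_def abs_le_iff)
  have cutz: "cut n t = 0" if "t \<notin> K" for n t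
  proof (cases "t < a / 2")
    case True
    have "t - a \<le> - r n" "t - b \<le> - r n" using True r(3)[of n] ab by (auto simp: field_simps)
    then show ?thesis using smooth_step_zero[OF r(1)] by (simp add: cut_def)
  next
    case False
    then have "r n \<le> t - a" "r n \<le> t - b" using that r(4)[of n] ab by (auto simp: K_def field_simps)
    then show ?thesis using smooth_step_le_one(3)[OF r(1,2)] by (simp add: cut_def)
  qed
  have cutc: "continuous_on UNIV (cut n)" for n
  proof -
    have "continuous_on UNIV (smooth_step (r n))"
      by (intro smooth_continuous smooth_smooth_step r)
    then have "continuous_on UNIV (\<lambda>t. smooth_step (r n) (t - c))" for c
      by (rule continuous_on_compose2) (auto intro!: continuous_intros)
    then show ?thesis unfolding cut_def by (intro continuous_on_diff)
  qed
  have "compact (p ` K)" by (intro compact_continuous_image K continuous_on_subset[OF p]) auto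
  then obtain B where B: "\<And>t. t \<in> K \<Longrightarrow> \<bar>p t\<bar> \<le> B"
    using compact_imp_bounded bounded_iff by (metis imageI real_norm_def)
  have FK: "integrable lebesgue (\<lambda>t. indicator K t *\<^sub>R F t)"
    using F K by (simp add: locally_integrable_def set_integrable_def)
  have SM: "{0<..<\<tau>} \<inter> space lebesgue \<in> sets lebesgue" "{a..b} \<inter> space lebesgue \<in> sets lebesgue" by auto
  have "(\<lambda>n. LINT t|lebesgue. (indicator K t *\<^sub>R F t) * (p t * cut n t))
      \<longlonglongrightarrow> (LINT t|lebesgue. (indicator K t *\<^sub>R F t) * (p t * indicator {a..b} t))"
  proof (rule integral_dominated_convergence[where w = "\<lambda>t. \<bar>B\<bar> * \<bar>indicator K t *\<^sub>R F t\<bar>"])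
    have pm: "p \<in> borel_measurable lebesgue" using p by (simp add: borel_measurable_continuous_onI measurable_completion)
    have cm: "cut n \<in> borel_measurable lebesgue" for n
      using cutc by (simp add: borel_measurable_continuous_onI measurable_completion)
    show "(\<lambda>t. (indicator K t *\<^sub>R F t) * (p t * cut n t)) \<in> borel_measurable lebesgue" for n
      using FK by (intro borel_measurable_times pm cm) auto
    show "(\<lambda>t. (indicator K t *\<^sub>R F t) * (p t * indicator {a..b} t)) \<in> borel_measurable lebesgue"
      using FK by (intro borel_measurable_times pm borel_measurable_indicator) auto
    show "integrable lebesgue (\<lambda>t. \<bar>B\<bar> * \<bar>indicator K t *\<^sub>R F t\<bar>)"
      using FK by simp
    show "AE t in lebesgue. norm ((indicator K t *\<^sub>R F t) * (p t * cut n t)) \<le> \<bar>B\<bar> * \<bar>indicator K t *\<^sub>R F t\<bar>" for n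
    proof (rule AE_I2)
      fix t
      have "\<bar>p t\<bar> * \<bar>cut n t\<bar> \<le> \<bar>B\<bar> * 1" if "t \<in> K"
        using B[OF that] cutb by (intro mult_mono) auto
      then have "\<bar>F t\<bar> * (\<bar>p t\<bar> * \<bar>cut n t\<bar>) \<le> \<bar>F t\<bar> * \<bar>B\<bar>" if "t \<in> K"
        using that by (intro mult_left_mono) auto
      then show "norm ((indicator K t *\<^sub>R F t) * (p t * cut n t)) \<le> \<bar>B\<bar> * \<bar>indicator K t *\<^sub>R F t\<bar>"
        by (auto simp: indicator_def abs_mult mult.commute)
    qed
    have "negligible {a, b}" by simp
    then have "AE t in lebesgue. t \<notin> {a, b}" by (intro AE_not_in) (simp add: negligible_iff_null_sets)
    then show "AE t in lebesgue. (\<lambda>n. (indicator K t *\<^sub>R F t) * (p t * cut n t))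
        \<longlonglongrightarrow> (indicator K t *\<^sub>R F t) * (p t * indicator {a..b} t)"
    proof eventually_elim
      case (elim t)
      have step: "\<forall>\<^sub>F n in sequentially. smooth_step (r n) s = indicator {0..} s" if "s \<noteq> 0" for s
      proof -
        have "\<forall>\<^sub>F n in sequentially. r n < \<bar>s\<bar>"
          using order_tendstoD(2)[OF r(5), of "\<bar>s\<bar>"] that by simp
        then show ?thesis
        proof eventually_elim
          case (elim n)
          then show ?case
            using smooth_step_zero[OF r(1), of s n] smooth_step_le_one(3)[OF r(1,2), of n s]
            by (cases "s \<ge> 0") auto
        qed
      qed
      have "\<forall>\<^sub>F n in sequentially. cut n t = indicator {a..b} t"
      proof -
        have "t - a \<noteq> 0" "t - b \<noteq> 0" using elim by auto
        from step[OF this(1)] step[OF this(2)] show ?thesis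
        proof eventually_elim
        case (elim n)
        then show ?case using ab \<open>t - b \<noteq> 0\<close> by (auto simp: cut_def indicator_def)
        qed
      qed
      then show ?case
        by (intro tendsto_mult_left tendsto_eventually)
    qed
  qed
  moreover have "(LINT t|lebesgue. (indicator K t *\<^sub>R F t) * (p t * cut n t))
      = (LINT t|?M. F t * (p t * cut n t))" for n
    unfolding integral_restrict_space[OF SM(1)]
    by (intro Bochner_Integration.integral_cong) (use K(2) cutz in \<open>auto simp: indicator_def\<close>)
  moreover have "(LINT t|lebesgue. (indicator K t *\<^sub>R F t) * (p t * indicator {a..b} t))
      = (LINT t|lebesgue_on {a..b}. F t * p t)"
    unfolding integral_restrict_space[OF SM(2)]
    by (intro Bochner_Integration.integral_cong) (use ab in \<open>auto simp: indicator_def K_def field_simps\<close>)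
  ultimately show ?thesis by (simp add: cut_def)
qed

text \<open>Test with the affine weight times a smoothed indicator of [a,b]: the derivative of the
  cutoff is a difference of mollifiers at \<open>a\<close> and \<open>b\<close>, which yields the
  boundary values by continuity of \<open>y\<close>. Affine weights suffice because the dual
  function is affine in time on each step.\<close>

lemma has_weak_deriv_linear_weight:
  fixes y F :: "real \<Rightarrow> real"
  assumes y: "continuous_on {0<..<\<tau>} y" and D: "has_weak_deriv {0<..<\<tau>} 1 y F"
    and ab: "0 < a" "a < b" "b < \<tau>"
  shows "integrable (lebesgue_on {a..b}) (\<lambda>t. y t * \<beta>)"
    "integrable (lebesgue_on {a..b}) (\<lambda>t. F t * (\<alpha> + \<beta> * t))"
    "(\<alpha> + \<beta> * b) * y b - (\<alpha> + \<beta> * a) * y a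
      = (LINT t|lebesgue_on {a..b}. y t * \<beta>) + (LINT t|lebesgue_on {a..b}. F t * (\<alpha> + \<beta> * t))"
proof -
  let ?M = "lebesgue_on {0<..<\<tau>}"
  define p where "p t = \<alpha> + \<beta> * t" for t :: real
  have ps: "smooth p"
    unfolding p_def by (intro smooth_add smooth_const smooth_linear bounded_linear_mult_right)
  have pd: "(p has_real_derivative \<beta>) (at t)" for t
    unfolding p_def by (auto intro!: derivative_eq_intros)
  have F: "locally_integrable {0<..<\<tau>} F" and yl: "locally_integrable {0<..<\<tau>} y"
    and weak: "\<And>\<theta>. \<theta> \<in> test_functions {0<..<\<tau>} \<Longrightarrow>
      (LINT t|?M. y t * dir_deriv 1 \<theta> t) = - (LINT t|?M. F t * \<theta> t)"
    using D by (auto simp: has_weak_deriv_def)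
  have sub: "compact {a..b}" "{a..b} \<subseteq> {0<..<\<tau>}" using ab by auto
  have SM: "{a..b} \<inter> space lebesgue \<in> sets lebesgue" by auto
  have Fi: "integrable (lebesgue_on {a..b}) F"
    using F sub unfolding locally_integrable_def set_integrable_def integrable_restrict_space[OF SM] by blast
  have yi: "integrable (lebesgue_on {a..b}) y"
    using yl sub unfolding locally_integrable_def set_integrable_def integrable_restrict_space[OF SM] by blast
  show "integrable (lebesgue_on {a..b}) (\<lambda>t. y t * \<beta>)" using yi by simp
  have "compact (p ` {a..b})"
    by (intro compact_continuous_image smooth_continuous ps) auto
  then obtain B where B: "\<And>t. t \<in> {a..b} \<Longrightarrow> \<bar>p t\<bar> \<le> B"
    using compact_imp_bounded bounded_iff by (metis imageI real_norm_def)
  show "integrable (lebesgue_on {a..b}) (\<lambda>t. F t * (\<alpha> + \<beta> * t))"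
  proof (rule Bochner_Integration.integrable_bound)
    show "integrable (lebesgue_on {a..b}) (\<lambda>t. B * F t)" using Fi by simp
    have "p \<in> borel_measurable (lebesgue_on {a..b})"
      by (intro continuous_imp_measurable_on_sets_lebesgue smooth_continuous ps) auto
    then show "(\<lambda>t. F t * (\<alpha> + \<beta> * t)) \<in> borel_measurable (lebesgue_on {a..b})"
      using Fi unfolding p_def by (intro borel_measurable_times) auto
    show "AE t in lebesgue_on {a..b}. norm (F t * (\<alpha> + \<beta> * t)) \<le> norm (B * F t)"
    proof (rule AE_I2)
      fix t assume "t \<in> space (lebesgue_on {a..b})"
      then have "\<bar>p t\<bar> \<le> \<bar>B\<bar>" using B[of t] by simp
      from mult_right_mono[OF this abs_ge_zero[of "F t"]]
      show "norm (F t * (\<alpha> + \<beta> * t)) \<le> norm (B * F t)" by (simp add: p_def abs_mult mult.commute)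
    qed
  qed
  \<comment> \<open>An upper bound on the mollification radius that keeps both transitions away from
    0 and \<open>\<tau>\<close> and within the range required of \<open>smooth_step\<close>.\<close>
  define R where "R = min 1 (min (a / 2) ((\<tau> - b) / 2))"
  have "R > 0" using ab by (simp add: R_def)
  have R: "R \<le> 1" "R \<le> a / 2" "R \<le> (\<tau> - b) / 2"
    unfolding R_def by (rule min.cobounded1, rule min.coboundedI2[OF min.cobounded1], rule min.coboundedI2[OF min.cobounded2])
  define r where "r n = R * (1 / real (Suc n))" for n
  have r0: "0 < r n" for n using \<open>R > 0\<close> by (simp add: r_def)
  have rR: "r n \<le> R" for n using \<open>R > 0\<close> mult_left_mono[of "1 / real (Suc n)" 1 R] by (simp add: r_def)
  have r: "r n \<le> 1" "r n \<le> a / 2" "r n \<le> (\<tau> - b) / 2" for n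
    using order_trans[OF rR R(1)] order_trans[OF rR R(2)] order_trans[OF rR R(3)] by auto
  have r5: "r \<longlonglongrightarrow> 0"
    unfolding r_def using tendsto_mult_right[OF LIMSEQ_Suc[OF lim_1_over_n], of R] by simp
  have ra: "r n < a" "a + r n < \<tau>" "r n < b" "b + r n < \<tau>" for n
    using r(2,3)[of n] r0[of n] ab by (auto simp: field_simps)
  define cut where "cut n t = smooth_step (r n) (t - a) - smooth_step (r n) (t - b)" for n t
  define k where "k n c t = bump c (r n) t / bump_mass (r n)" for n and c t :: real
  have cd: "(cut n has_real_derivative k n a t - k n b t) (at t)" for n t
  proof -
    have "((\<lambda>t. t - c) has_real_derivative 1) (at t)" for c
      using DERIV_diff[OF DERIV_ident DERIV_const[of c]] by simp
    from DERIV_chain2[OF smooth_step_has_derivative[OF r0 r(1)] this]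
    have "((\<lambda>t. smooth_step (r n) (t - c)) has_real_derivative k n c t) (at t)" for c
      by (simp add: k_def bump_shift)
    from DERIV_diff[OF this this] show ?thesis by (simp add: cut_def[abs_def])
  qed
  have cs: "smooth (cut n)" for n
  proof (rule smooth_realI[OF cd])
    have "smooth (\<lambda>t. (1 / bump_mass (r n)) * bump a (r n) t + (- 1 / bump_mass (r n)) * bump b (r n) t)"
      by (intro smooth_add smooth_mult smooth_const smooth_bump)
    then show "smooth (\<lambda>t. k n a t - k n b t)" by (simp add: k_def)
  qed
  have T: "(\<lambda>t. p t * cut n t) \<in> test_functions {0<..<\<tau>}" for n
  proof (rule test_functionsI[where K = "{a / 2..b + (\<tau> - b) / 2}"])
    show "smooth (\<lambda>t. p t * cut n t)" by (intro smooth_mult ps cs)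
    show "{a / 2..b + (\<tau> - b) / 2} \<subseteq> {0<..<\<tau>}" using ab by (auto simp: field_simps)
    fix t assume t: "t \<notin> {a / 2..b + (\<tau> - b) / 2}"
    have "cut n t = 0"
    proof (cases "t < a / 2")
      case True
      have "t - a \<le> - r n" "t - b \<le> - r n" using True r(2)[of n] ab by (auto simp: field_simps)
      then show ?thesis using smooth_step_zero[OF r0] by (simp add: cut_def)
    next
      case False
      then have "r n \<le> t - a" "r n \<le> t - b" using t r(3)[of n] ab by (auto simp: field_simps)
      then show ?thesis using smooth_step_le_one(3)[OF r0 r(1)] by (simp add: cut_def)
    qed
    then show "p t * cut n t = 0" by simp
  qed auto
  have dT: "dir_deriv 1 (\<lambda>t. p t * cut n t) t = \<beta> * cut n t + (p t * k n a t - p t * k n b t)" for n t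
    using dir_deriv_real[OF DERIV_mult[OF pd[of t] cd[of n t]], of 1] by (simp add: algebra_simps)
  have ym: "y \<in> borel_measurable ?M"
    using y by (intro continuous_imp_measurable_on_sets_lebesgue) auto
  have locint: "integrable ?M (\<lambda>t. y t * \<theta> t)" if \<theta>: "ccs {0<..<\<tau>} \<theta>" for \<theta>
  proof -
    obtain K where K: "compact K" "K \<subseteq> {0<..<\<tau>}" "\<And>t. t \<notin> K \<Longrightarrow> \<theta> t = 0"
      using \<theta> by (auto simp: ccs_def)
    obtain C where C: "\<And>t. \<bar>\<theta> t\<bar> \<le> C" using ccs_bounded[OF \<theta>] by (metis real_norm_def)
    have yK: "integrable lebesgue (\<lambda>t. indicator K t *\<^sub>R y t)"
      using yl K unfolding locally_integrable_def set_integrable_def by blast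
    have eqf: "(\<lambda>t. indicator {0<..<\<tau>} t *\<^sub>R (indicator K t *\<^sub>R y t)) = (\<lambda>t. indicator K t *\<^sub>R y t)"
      using K(2) by (auto simp: indicator_def fun_eq_iff)
    have "integrable ?M (\<lambda>t. indicator K t *\<^sub>R y t)"
      by (subst integrable_restrict_space) (simp, simp only: eqf yK)
    then have i: "integrable ?M (\<lambda>t. C * (indicator K t *\<^sub>R y t))" by simp
    show ?thesis
    proof (rule Bochner_Integration.integrable_bound[OF i])
      show "(\<lambda>t. y t * \<theta> t) \<in> borel_measurable ?M"
        using ym ccs_integrable_on[OF \<theta>] by (intro borel_measurable_times) auto
      show "AE t in ?M. norm (y t * \<theta> t) \<le> norm (C * (indicator K t *\<^sub>R y t))"
      proof (rule AE_I2)
        fix t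
        have "\<bar>\<theta> t\<bar> \<le> \<bar>C\<bar>" using C[of t] by simp
        from mult_right_mono[OF this abs_ge_zero[of "y t"]]
        show "norm (y t * \<theta> t) \<le> norm (C * (indicator K t *\<^sub>R y t))"
          using K(3)[of t] by (cases "t \<in> K") (auto simp: abs_mult mult.commute)
      qed
    qed
  qed
  have kc: "ccs {0<..<\<tau>} (k n c)" if "r n < c" "c + r n < \<tau>" for n c
  proof -
    have "ccs {0<..<\<tau>} (bump c (r n))"
      using that r0[of n] by (intro ccs_test bump_test) (auto simp: cball_eq_atLeastAtMost)
    moreover have "continuous_on UNIV (\<lambda>s::real. s / bump_mass (r n))"
      using bump_mass_pos[OF r0 r(1), of n]
      by (intro continuous_on_divide continuous_on_id continuous_on_const) auto
    ultimately show ?thesis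
      unfolding k_def by (rule ccs_compose) simp
  qed
  have pk: "ccs {0<..<\<tau>} (\<lambda>t. p t * k n c t)" if "r n < c" "c + r n < \<tau>" for n c
    using ccs_inner[OF kc[OF that] smooth_continuous[OF ps]] by (simp add: mult.commute)
  have cutT: "ccs {0<..<\<tau>} (\<lambda>t. \<beta> * cut n t)" for n
  proof -
    have "ccs {0<..<\<tau>} (dir_deriv 1 (\<lambda>t. p t * cut n t))"
      by (intro ccs_test test_dir_deriv T) auto
    moreover have "(\<lambda>t. \<beta> * cut n t) = (\<lambda>t. dir_deriv 1 (\<lambda>t. p t * cut n t) t - (p t * k n a t - p t * k n b t))"
      by (simp add: dT)
    ultimately show ?thesis
      using ccs_diff[of _ "dir_deriv 1 (\<lambda>t. p t * cut n t)", OF _ ccs_diff[OF pk[OF ra(1,2)] pk[OF ra(3,4)]]] by simp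
  qed
  have eq: "(LINT t|?M. y t * (\<beta> * cut n t)) + (LINT t|?M. (y t * p t) * k n a t) - (LINT t|?M. (y t * p t) * k n b t)
      = - (LINT t|?M. F t * (p t * cut n t))" for n
  proof -
    have "(LINT t|?M. y t * dir_deriv 1 (\<lambda>t. p t * cut n t) t)
      = (LINT t|?M. y t * (\<beta> * cut n t) + (y t * (p t * k n a t) - y t * (p t * k n b t)))"
      by (simp add: dT algebra_simps)
    also have "\<dots> = (LINT t|?M. y t * (\<beta> * cut n t)) + ((LINT t|?M. y t * (p t * k n a t)) - (LINT t|?M. y t * (p t * k n b t)))"
      using locint[OF cutT] locint[OF pk[OF ra(1,2)]] locint[OF pk[OF ra(3,4)]] by simp
    finally show ?thesis using weak[OF T[of n]] by (simp add: mult.assoc)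
  qed
  have yp: "continuous_on {0<..<\<tau>} (\<lambda>t. y t * p t)"
    by (intro continuous_on_mult y smooth_continuous ps)
  have l1: "(\<lambda>n. LINT t|?M. y t * (\<beta> * cut n t)) \<longlonglongrightarrow> (LINT t|lebesgue_on {a..b}. y t * \<beta>)"
    unfolding cut_def by (rule cutoff_tendsto[OF yl ab continuous_on_const r0 r r5])
  have l2: "(\<lambda>n. LINT t|?M. F t * (p t * cut n t)) \<longlonglongrightarrow> (LINT t|lebesgue_on {a..b}. F t * p t)"
    unfolding cut_def by (rule cutoff_tendsto[OF F ab smooth_continuous[OF ps] r0 r r5])
  have l3: "(\<lambda>n. LINT t|?M. (y t * p t) * k n a t) \<longlonglongrightarrow> y a * p a"
    unfolding k_def using ab by (intro mollifier_tendsto[OF yp] r0 r ra r5) auto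
  have l4: "(\<lambda>n. LINT t|?M. (y t * p t) * k n b t) \<longlonglongrightarrow> y b * p b"
    unfolding k_def using ab by (intro mollifier_tendsto[OF yp] r0 r ra r5) auto
  have "(LINT t|lebesgue_on {a..b}. y t * \<beta>) + y a * p a - y b * p b = - (LINT t|lebesgue_on {a..b}. F t * p t)"
    by (rule LIMSEQ_unique[OF tendsto_diff[OF tendsto_add[OF l1 l3] l4]])
      (unfold eq, rule tendsto_minus[OF l2])
  then show "(\<alpha> + \<beta> * b) * y b - (\<alpha> + \<beta> * a) * y a
      = (LINT t|lebesgue_on {a..b}. y t * \<beta>) + (LINT t|lebesgue_on {a..b}. F t * (\<alpha> + \<beta> * t))"
    by (simp add: p_def algebra_simps)
qed

subsection \<open>The duality estimate\<close>

lemma lebesgue_on_subinterval: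
  fixes f :: "real \<Rightarrow> real"
  assumes "integrable (lebesgue_on {a..b}) f" "a \<le> c" "e \<le> b"
  shows "integrable (lebesgue_on {c..e}) f"
  by (rule integrable_subinterval[OF assms(1)]) (use assms in auto)

text \<open>\<open>y' \<le> d \<Delta> y + f\<close> weakly on \<open>(0,3)\<close>, where \<open>f\<close> has \<open>L\<^sup>2\<close> norm at most \<open>H\<close> and
  enters only through its pairing \<open>F\<close> with \<open>z\<close>; \<open>e\<close> bounds the gradient norm of \<open>y\<close>.\<close>

definition heat_subsolution ::
  "'a::euclidean_space set \<Rightarrow> real \<Rightarrow> real \<Rightarrow> real \<Rightarrow> (real \<Rightarrow> real) \<Rightarrow> (real \<Rightarrow> 'a \<Rightarrow> real) \<Rightarrow> bool" where
  "heat_subsolution \<Omega> d R H e y \<longleftrightarrow> H \<ge> 0 \<and>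
    (\<forall>t\<in>{0..3}. y t \<in> L2 \<Omega> \<and> L2_norm \<Omega> (y t) \<le> R) \<and>
    (\<forall>z\<in>test_functions \<Omega>. continuous_on {0..3} (\<lambda>t. L2_inner \<Omega> (y t) z)) \<and>
    (AE t in lebesgue_on {0..3}. y t \<in> H10 \<Omega> \<and> L2_norm \<Omega> (weak_grad \<Omega> (y t)) \<le> e t) \<and>
    integrable (lebesgue_on {0..3}) (\<lambda>t. (e t)\<^sup>2) \<and>
    (\<forall>z\<in>{z \<in> test_functions \<Omega>. \<forall>x. z x \<ge> 0}. \<exists>F.
      has_weak_deriv {0<..<3} 1 (\<lambda>t. L2_inner \<Omega> (y t) z)
        (\<lambda>t. - (d * L2_inner \<Omega> (weak_grad \<Omega> (y t)) (weak_grad \<Omega> z)) + F t) \<and>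
      (\<forall>t\<in>{0..3}. F t \<le> H * L2_norm \<Omega> z))"

text \<open>The test function is \<open>l q + (1 - l) p\<close> with \<open>l = (t - a) / h\<close>:
  it runs from the later iterate \<open>p\<close> at time \<open>a\<close> to \<open>q\<close> at
  time \<open>b\<close>. By the residual its time derivative \<open>(q - p) / h\<close> is nearly
  \<open>- d \<Delta> p\<close>, while the equation supplies the interpolated gradient. What remains
  is \<open>d * l\<close> times the gradient of \<open>y\<close> paired with
  \<open>grad p - grad q\<close>, split by Young's inequality with weight
  \<open>\<kappa>\<close>.\<close>

lemma step_inequality:
  fixes y :: "real \<Rightarrow> 'a::euclidean_space \<Rightarrow> real" and e :: "real \<Rightarrow> real"
  assumes \<Omega>: "open \<Omega>" "bounded \<Omega>" and d: "d > 0" and h: "h > 0" and "\<epsilon> > 0" and "\<kappa> > 0"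
    and ab: "0 < a" "b = a + h" "b < 3"
    and sub: "heat_subsolution \<Omega> d R H e y"
    and q: "q \<in> test_functions \<Omega>" "\<And>x. q x \<ge> 0" and p: "p \<in> test_functions \<Omega>" "\<And>x. p x \<ge> 0"
    and res: "residual_le \<Omega> (h * d) \<epsilon> q p"
  shows "L2_inner \<Omega> (y b) q - L2_inner \<Omega> (y a) p \<le>
    (\<kappa> + \<epsilon> / h) * (LINT t|lebesgue_on {a..b}. (e t)\<^sup>2)
    + h * (d\<^sup>2 / (4 * \<kappa>) * (L2_norm \<Omega> (\<lambda>x. grad p x - grad q x))\<^sup>2
        + \<epsilon> / h * (R + 1) + H * (L2_norm \<Omega> q + L2_norm \<Omega> p))"
proof -
  have "H \<ge> 0" and yR: "\<And>t. t \<in> {0..3} \<Longrightarrow> L2_norm \<Omega> (y t) \<le> R"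
    and cont: "\<And>z. z \<in> test_functions \<Omega> \<Longrightarrow> continuous_on {0..3} (\<lambda>t. L2_inner \<Omega> (y t) z)"
    and H10: "AE t in lebesgue_on {0..3}. y t \<in> H10 \<Omega> \<and> L2_norm \<Omega> (weak_grad \<Omega> (y t)) \<le> e t"
    and e2: "integrable (lebesgue_on {0..3}) (\<lambda>t. (e t)\<^sup>2)"
    using sub by (simp_all add: heat_subsolution_def)
  obtain F where F': "\<forall>z\<in>{z \<in> test_functions \<Omega>. \<forall>x. z x \<ge> 0}.
      has_weak_deriv {0<..<3} 1 (\<lambda>t. L2_inner \<Omega> (y t) z)
        (\<lambda>t. - (d * L2_inner \<Omega> (weak_grad \<Omega> (y t)) (weak_grad \<Omega> z)) + F z t) \<and>
      (\<forall>t\<in>{0..3}. F z t \<le> H * L2_norm \<Omega> z)"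
    using sub unfolding heat_subsolution_def by (elim conjE) (drule bchoice, erule exE)
  define m where "m z t = L2_inner \<Omega> (y t) z" for z t
  define G where "G z t = - (d * L2_inner \<Omega> (weak_grad \<Omega> (y t)) (weak_grad \<Omega> z)) + F z t" for z t
  define W where "W = L2_norm \<Omega> (\<lambda>x. grad p x - grad q x)"
  define c0 where "c0 = d\<^sup>2 / (4 * \<kappa>) * W\<^sup>2 + \<epsilon> / h * (R + 1) + H * (L2_norm \<Omega> q + L2_norm \<Omega> p)"
  have ab': "a < b" using ab h by simp
  have mc: "continuous_on {0<..<3} (m z)" if "z \<in> test_functions \<Omega>" for z
    unfolding m_def using cont[OF that] by (rule continuous_on_subset) auto
  have wd: "has_weak_deriv {0<..<3} 1 (m z) (G z)" if "z \<in> test_functions \<Omega>" "\<And>x. z x \<ge> 0" for z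
    unfolding m_def G_def using F' that by simp
  \<comment> \<open>Weights \<open>(t - a) / h\<close> for \<open>q\<close> and
    \<open>(b - t) / h\<close> for \<open>p\<close>: the boundary terms reduce to
    \<open>m q b\<close> and \<open>m p a\<close>.\<close>
  note Lq = has_weak_deriv_linear_weight(1)[OF mc[OF q(1)] wd[OF q] ab(1) ab' ab(3), where \<beta> = "1 / h"]
    has_weak_deriv_linear_weight(2,3)[OF mc[OF q(1)] wd[OF q] ab(1) ab' ab(3), where \<alpha> = "- a / h" and \<beta> = "1 / h"]
  note Lp = has_weak_deriv_linear_weight(1)[OF mc[OF p(1)] wd[OF p] ab(1) ab' ab(3), where \<beta> = "- 1 / h"]
    has_weak_deriv_linear_weight(2,3)[OF mc[OF p(1)] wd[OF p] ab(1) ab' ab(3), where \<alpha> = "b / h" and \<beta> = "- 1 / h"]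
  let ?M = "lebesgue_on {a..b}"
  define f where "f t = (m q t * (1 / h) + G q t * (- a / h + 1 / h * t)) + (m p t * (- 1 / h) + G p t * (b / h + - 1 / h * t))" for t
  have fi: "integrable ?M f"
    unfolding f_def using Lq(1,2) Lp(1,2) by (intro Bochner_Integration.integrable_add)
  have ends: "- a / h + 1 / h * b = 1" "- a / h + 1 / h * a = 0" "b / h + - 1 / h * b = 0" "b / h + - 1 / h * a = 1"
    using ab h by (auto simp: field_simps)
  have "(LINT t|?M. f t) = ((LINT t|?M. m q t * (1 / h)) + (LINT t|?M. G q t * (- a / h + 1 / h * t)))
      + ((LINT t|?M. m p t * (- 1 / h)) + (LINT t|?M. G p t * (b / h + - 1 / h * t)))"
    unfolding f_def using Lq(1,2) Lp(1,2)
    by (simp only: Bochner_Integration.integral_add Bochner_Integration.integrable_add)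
  also have "\<dots> = m q b - m p a" using Lq(3) Lp(3) unfolding ends by simp
  finally have fint: "(LINT t|?M. f t) = m q b - m p a" .
  have ei: "integrable ?M (\<lambda>t. (e t)\<^sup>2)"
    using ab ab' by (intro lebesgue_on_subinterval[OF e2]) auto
  have M: "measure ?M {a..b} = h"
    using ab h by (simp add: measure_restrict_space)
  interpret finite_measure ?M by (rule finite_measure_lebesgue_on) auto
  have AEab: "AE t in ?M. y t \<in> H10 \<Omega> \<and> L2_norm \<Omega> (weak_grad \<Omega> (y t)) \<le> e t"
  proof -
    have "AE t in lebesgue. t \<in> {0..3} \<longrightarrow> y t \<in> H10 \<Omega> \<and> L2_norm \<Omega> (weak_grad \<Omega> (y t)) \<le> e t"
      using H10 by (subst (asm) AE_restrict_space_iff) auto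
    then have "AE t in lebesgue. t \<in> {a..b} \<longrightarrow> y t \<in> H10 \<Omega> \<and> L2_norm \<Omega> (weak_grad \<Omega> (y t)) \<le> e t"
      by eventually_elim (use ab in auto)
    then show ?thesis by (subst AE_restrict_space_iff) auto
  qed
  have L: "q \<in> L2 \<Omega>" "p \<in> L2 \<Omega>" "grad q \<in> L2 \<Omega>" "grad p \<in> L2 \<Omega>"
    using q p \<Omega> by (auto intro: test_L2 grad_L2)
  have ineq: "f t \<le> (\<kappa> + \<epsilon> / h) * (e t)\<^sup>2 + c0"
    if t: "t \<in> {a..b}" and yt: "y t \<in> H10 \<Omega>" and et: "L2_norm \<Omega> (weak_grad \<Omega> (y t)) \<le> e t" for t
  proof -
    have t3: "t \<in> {0..3}" using t ab by auto
    define l where "l = (t - a) / h"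
    have l: "0 \<le> l" "l \<le> 1" using t ab h by (auto simp: l_def field_simps)
    have wl: "- a / h + 1 / h * t = l" "b / h + - 1 / h * t = 1 - l"
      using ab h by (auto simp: l_def field_simps)
    have yL: "y t \<in> L2 \<Omega>" "weak_grad \<Omega> (y t) \<in> L2 \<Omega>" using H10_L2[OF yt] by auto
    have e0: "e t \<ge> 0" using et L2_norm_nonneg order_trans by blast
    define gq where "gq = L2_inner \<Omega> (weak_grad \<Omega> (y t)) (grad q)"
    define gp where "gp = L2_inner \<Omega> (weak_grad \<Omega> (y t)) (grad p)"
    define gw where "gw = L2_inner \<Omega> (weak_grad \<Omega> (y t)) (\<lambda>x. grad p x - grad q x)"
    have wg: "L2_inner \<Omega> (weak_grad \<Omega> (y t)) (weak_grad \<Omega> z) = L2_inner \<Omega> (weak_grad \<Omega> (y t)) (grad z)"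
      if "z \<in> test_functions \<Omega>" for z
      using weak_grad_test[OF that \<Omega>] weak_grad_H1(1)[OF weak_grad_test(1)[OF that \<Omega>]]
        yL(2) grad_L2[OF that \<Omega>(1)] by (intro L2_inner_cong) auto
    have gw: "gw = gp - gq" unfolding gw_def gp_def gq_def by (rule L2_inner_diff_right[OF L(4,3) yL(2)])
    have "\<bar>gw\<bar> \<le> L2_norm \<Omega> (weak_grad \<Omega> (y t)) * W"
      unfolding gw_def W_def by (rule L2_Cauchy_Schwarz[OF yL(2) L2_diff[OF L(4,3)]])
    also have "\<dots> \<le> e t * W" using et by (intro mult_right_mono) (auto simp: W_def)
    finally have gwb: "\<bar>gw\<bar> \<le> e t * W" .
    have "d * (l * gw) \<le> d * (e t * W)"
    proof (rule mult_left_mono)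
      have "l * gw \<le> 1 * \<bar>gw\<bar>" using l abs_ge_self[of gw] by (metis abs_ge_zero abs_mult abs_of_nonneg abs_ge_self mult_right_mono order_trans)
      then show "l * gw \<le> e t * W" using gwb by simp
    qed (use d in simp)
    also have "\<dots> \<le> \<kappa> * (e t)\<^sup>2 + d\<^sup>2 / (4 * \<kappa>) * W\<^sup>2"
    proof -
      have "0 \<le> \<kappa> * (e t - d * W / (2 * \<kappa>))\<^sup>2" using \<open>\<kappa> > 0\<close> by simp
      also have "\<dots> = \<kappa> * (e t)\<^sup>2 + d\<^sup>2 / (4 * \<kappa>) * W\<^sup>2 - d * (e t * W)"
        using \<open>\<kappa> > 0\<close> by (simp add: field_simps power2_eq_square)
      finally show ?thesis by simp
    qed
    finally have 1: "d * (l * gw) \<le> \<kappa> * (e t)\<^sup>2 + d\<^sup>2 / (4 * \<kappa>) * W\<^sup>2" .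
    have r1: "\<bar>L2_inner \<Omega> (\<lambda>x. p x - q x) (y t) + h * d * L2_inner \<Omega> (grad p) (weak_grad \<Omega> (y t))\<bar>
        \<le> \<epsilon> * (L2_norm \<Omega> (y t) + L2_norm \<Omega> (weak_grad \<Omega> (y t)))"
      using \<open>\<epsilon> > 0\<close> by (intro residual_bound_H10[OF p(1) q(1) \<Omega> _ res yt]) simp
    have r2: "L2_inner \<Omega> (\<lambda>x. p x - q x) (y t) = m p t - m q t"
      using L2_inner_diff_left[OF L(2,1) yL(1)] by (simp add: m_def L2_inner_commute)
    have r3: "L2_inner \<Omega> (grad p) (weak_grad \<Omega> (y t)) = gp" by (simp add: gp_def L2_inner_commute)
    have r4: "\<epsilon> * (L2_norm \<Omega> (y t) + L2_norm \<Omega> (weak_grad \<Omega> (y t))) \<le> \<epsilon> * ((R + 1) + (e t)\<^sup>2)"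
    proof (rule mult_left_mono)
      \<comment> \<open>Converts the linear occurrence of the gradient bound into its integrable
        square; the extra 1 is the one in \<open>R + 1\<close>.\<close>
      have "e t \<le> 1 + (e t)\<^sup>2" using sum_squares_bound[of "e t" 1] e0 by (simp add: power2_eq_square)
      then show "L2_norm \<Omega> (y t) + L2_norm \<Omega> (weak_grad \<Omega> (y t)) \<le> (R + 1) + (e t)\<^sup>2"
        using yR[OF t3] et by simp
    qed (use \<open>\<epsilon> > 0\<close> in simp)
    have "m q t - m p t - h * d * gp \<le> \<epsilon> * ((R + 1) + (e t)\<^sup>2)"
      using order_trans[OF r1 r4] unfolding r2 r3 abs_le_iff by linarith
    then have "(m q t - m p t - h * d * gp) / h \<le> \<epsilon> * ((R + 1) + (e t)\<^sup>2) / h"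
      using h by (intro divide_right_mono) auto
    then have 2: "m q t / h - m p t / h - d * gp \<le> \<epsilon> / h * (R + 1) + \<epsilon> / h * (e t)\<^sup>2"
      using h by (simp add: diff_divide_distrib add_divide_distrib distrib_left)
    have Fq: "F q t \<le> H * L2_norm \<Omega> q" and Fp: "F p t \<le> H * L2_norm \<Omega> p"
      using F' q p t3 by auto
    have "l * F q t \<le> l * (H * L2_norm \<Omega> q)" using Fq l by (intro mult_left_mono) auto
    also have "\<dots> \<le> H * L2_norm \<Omega> q" using l \<open>H \<ge> 0\<close> by (intro mult_left_le_one_le) auto
    finally have 3: "l * F q t \<le> H * L2_norm \<Omega> q" .
    have "(1 - l) * F p t \<le> (1 - l) * (H * L2_norm \<Omega> p)" using Fp l by (intro mult_left_mono) auto
    also have "\<dots> \<le> H * L2_norm \<Omega> p" using l \<open>H \<ge> 0\<close> by (intro mult_left_le_one_le) auto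
    finally have 4: "(1 - l) * F p t \<le> H * L2_norm \<Omega> p" .
    have "f t = (m q t / h - m p t / h - d * gp) + d * (l * gw) + l * F q t + (1 - l) * F p t"
      unfolding f_def wl G_def wg[OF q(1)] wg[OF p(1)] gq_def[symmetric] gp_def[symmetric] gw
      by (simp add: algebra_simps)
    also have "\<dots> \<le> (\<epsilon> / h * (R + 1) + \<epsilon> / h * (e t)\<^sup>2) + (\<kappa> * (e t)\<^sup>2 + d\<^sup>2 / (4 * \<kappa>) * W\<^sup>2)
        + H * L2_norm \<Omega> q + H * L2_norm \<Omega> p"
      using 1 2 3 4 by linarith
    also have "\<dots> = (\<kappa> + \<epsilon> / h) * (e t)\<^sup>2 + c0" by (simp add: c0_def algebra_simps)
    finally show ?thesis .
  qed
  have "(LINT t|?M. f t) \<le> (LINT t|?M. (\<kappa> + \<epsilon> / h) * (e t)\<^sup>2 + c0)"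
  proof (rule integral_mono_AE[OF fi])
    show "integrable ?M (\<lambda>t. (\<kappa> + \<epsilon> / h) * (e t)\<^sup>2 + c0)" using ei by simp
    show "AE t in ?M. f t \<le> (\<kappa> + \<epsilon> / h) * (e t)\<^sup>2 + c0"
      using AEab AE_space[of ?M] by eventually_elim (auto intro: ineq)
  qed
  also have "\<dots> = (\<kappa> + \<epsilon> / h) * (LINT t|?M. (e t)\<^sup>2) + h * c0"
    using ei M by simp
  finally show ?thesis unfolding fint by (simp add: m_def c0_def W_def)
qed

lemma integral_telescope:
  fixes f :: "real \<Rightarrow> real"
  assumes "integrable (lebesgue_on {0..3}) f" "h > 0" "real n * h \<le> 1"
  shows "(\<Sum>j<n. LINT t|lebesgue_on {2 - real (Suc j) * h..2 - real j * h}. f t)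
    = (LINT t|lebesgue_on {2 - real n * h..2}. f t)"
  using assms(3)
proof (induction n)
  case 0
  have "(LINT t|lebesgue_on {2..2}. f t) = 0"
    by (subst integral_restrict_space) (auto intro!: integral_eq_zero_AE AE_I[where N = "{2}"] simp: indicator_def)
  then show ?case by simp
next
  case (Suc n)
  have le: "real n * h \<le> real (Suc n) * h" using assms(2) by (intro mult_right_mono) auto
  have i: "integrable (lebesgue_on {2 - real (Suc n) * h..2}) f"
    using Suc.prems by (intro lebesgue_on_subinterval[OF assms(1)]) auto
  have "(LINT t|lebesgue_on {2 - real (Suc n) * h..2}. f t)
      = (LINT t|lebesgue_on {2 - real (Suc n) * h..2 - real n * h}. f t) + (LINT t|lebesgue_on {2 - real n * h..2}. f t)"
    using le assms(2) by (intro Equivalence_Measurable_On_Borel.integral_combine[OF i]) auto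
  with Suc le show ?case by simp
qed

text \<open>The order of choices matters: \<open>\<kappa>\<close> from the gradient energy
  \<open>E\<close> of \<open>y\<close>, then \<open>N\<close> from \<open>\<kappa>\<close> and the
  datum, then the defect from \<open>N\<close>. Thus \<open>E\<close> and the norms of the datum
  occur only in vanishing errors, and the final bound sees \<open>R\<close> and \<open>H\<close>
  alone.\<close>

lemma duality_estimate:
  fixes \<Omega> :: "'a::euclidean_space set"
  assumes \<Omega>: "open \<Omega>" "bounded \<Omega>" and dim: "DIM('a) \<le> 3" and d: "d > 0"
  obtains C :: real where "C \<ge> 1"
    "\<And>y R H e \<psi>. heat_subsolution \<Omega> d R H e y \<Longrightarrow>
      \<psi> \<in> test_functions \<Omega> \<Longrightarrow> (\<And>x. \<psi> x \<ge> 0) \<Longrightarrow> (LINT x|lebesgue_on \<Omega>. \<psi> x) \<le> 1 / 2 \<Longrightarrow>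
      L2_inner \<Omega> (y 2) \<psi> \<le> R * C + 8 * C * H"
proof -
  obtain C :: real where C: "C \<ge> 1"
    and scheme: "\<And>\<psi> N \<eta>. \<psi> \<in> test_functions \<Omega> \<Longrightarrow> (\<And>y. \<psi> y \<ge> 0) \<Longrightarrow> (LINT y|lebesgue_on \<Omega>. \<psi> y) \<le> 1 / 2 \<Longrightarrow>
      N \<ge> 1 \<Longrightarrow> L2_norm \<Omega> \<psi> + 1 \<le> C * real N powr (3 / 4) \<Longrightarrow> \<eta> > 0 \<Longrightarrow>
      \<exists>\<epsilon> \<zeta>. 0 < \<epsilon> \<and> \<epsilon> \<le> \<eta> \<and> euler_scheme \<Omega> d N C \<epsilon> \<psi> \<zeta>"
    using euler_scheme_exists[OF \<Omega> dim d] by blast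
  show ?thesis
  proof (rule that[OF C])
    fix y :: "real \<Rightarrow> 'a \<Rightarrow> real" and R H :: real and e :: "real \<Rightarrow> real" and \<psi> :: "'a \<Rightarrow> real"
    assume sub: "heat_subsolution \<Omega> d R H e y"
      and \<psi>: "\<psi> \<in> test_functions \<Omega>" "\<And>x. \<psi> x \<ge> 0" "(LINT x|lebesgue_on \<Omega>. \<psi> x) \<le> 1 / 2"
    have H: "H \<ge> 0" and yR: "\<And>t. t \<in> {0..3} \<Longrightarrow> y t \<in> L2 \<Omega> \<and> L2_norm \<Omega> (y t) \<le> R"
      and e2: "integrable (lebesgue_on {0..3}) (\<lambda>t. (e t)\<^sup>2)"
      using sub by (simp_all add: heat_subsolution_def)
    have R0: "R \<ge> 0" using yR[of 0] order_trans[OF L2_norm_nonneg, of \<Omega> "y 0" R] by simp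
    define E where "E = (LINT t|lebesgue_on {0..3}. (e t)\<^sup>2)"
    have E0: "E \<ge> 0" by (simp add: E_def)
    define P where "P = 2 * (L2_norm \<Omega> (grad \<psi>))\<^sup>2 + 1"
    define x where "x = L2_norm \<Omega> \<psi> + 1"
    have x1: "x \<ge> 1" by (simp add: x_def)
    show "L2_inner \<Omega> (y 2) \<psi> \<le> R * C + 8 * C * H"
    proof (rule field_le_epsilon)
      fix \<delta>' :: real assume "\<delta>' > 0"
      \<comment> \<open>Four errors share \<open>\<delta>'\<close>: \<open>\<kappa> * E\<close>, the
        gradient jumps \<open>h * Q\<close>, the defects, and the datum's part
        \<open>H * (x * h)\<close> of the source term.\<close>
      define \<delta> where "\<delta> = \<delta>' / 4"
      have \<delta>: "\<delta> > 0" using \<open>\<delta>' > 0\<close> by (simp add: \<delta>_def)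
      define \<kappa> where "\<kappa> = \<delta> / (E + 1)"
      have \<kappa>: "\<kappa> > 0" "\<kappa> * E \<le> \<delta>" using \<delta> E0 by (auto simp: \<kappa>_def field_simps)
      define Q where "Q = d\<^sup>2 / (4 * \<kappa>) * P"
      have Q0: "Q \<ge> 0" unfolding Q_def P_def using \<kappa> by simp
      \<comment> \<open>The summand \<open>x\<^sup>2\<close> meets the condition for the decay
        estimate, the two quotients make the jump and datum errors small, and 1 makes
        \<open>N\<close> positive.\<close>
      obtain N :: nat where N: "x\<^sup>2 + Q / \<delta> + H * x / \<delta> + 1 \<le> real N" using real_arch_simple by blast
      have nn: "Q / \<delta> \<ge> 0" "H * x / \<delta> \<ge> 0" "x\<^sup>2 \<ge> 0" using Q0 \<delta> H x1 by auto
      have N1: "real N \<ge> 1" and NQ: "Q / \<delta> \<le> real N" and NH: "H * x / \<delta> \<le> real N" and Nx: "x\<^sup>2 \<le> real N"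
        using N nn by linarith+
      have Nn: "N \<ge> 1" using N1 by simp
      define h where "h = 1 / real N"
      have h: "h > 0" "real N * h = 1" "h \<le> 1" using N1 by (auto simp: h_def)
      have Qh: "h * Q \<le> \<delta>" and Hh: "H * (x * h) \<le> \<delta>"
        using NQ NH \<delta> N1 by (auto simp: h_def field_simps)
      have "x \<le> sqrt (real N)" using Nx by (rule real_le_rsqrt)
      also have "\<dots> = real N powr (1 / 2)" by (simp add: powr_half_sqrt)
      also have "\<dots> \<le> real N powr (3 / 4)" using N1 by (intro powr_mono) auto
      also have "\<dots> \<le> C * real N powr (3 / 4)" using mult_right_mono[OF C, of "real N powr (3 / 4)"] by simp
      finally have NC: "L2_norm \<Omega> \<psi> + 1 \<le> C * real N powr (3 / 4)" by (simp add: x_def)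
      define \<eta> where "\<eta> = h * \<delta> / (E + R + 1)"
      have \<eta>: "\<eta> > 0" using h \<delta> E0 R0 by (simp add: \<eta>_def)
      obtain \<epsilon> \<zeta> where \<epsilon>: "0 < \<epsilon>" "\<epsilon> \<le> \<eta>" and \<zeta>: "\<zeta> 0 = \<psi>" "\<And>j. \<zeta> j \<in> test_functions \<Omega>" "\<And>j y. \<zeta> j y \<ge> 0"
        and res: "\<And>j. residual_le \<Omega> (d / real N) \<epsilon> (\<zeta> j) (\<zeta> (Suc j))"
        and \<zeta>N: "L2_norm \<Omega> (\<zeta> N) \<le> C"
        and sums: "(\<Sum>j<N. L2_norm \<Omega> (\<zeta> j) + L2_norm \<Omega> (\<zeta> (Suc j))) / real N \<le> 8 * C + L2_norm \<Omega> \<psi> / real N"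
        and grads: "(\<Sum>j<N. (L2_norm \<Omega> (\<lambda>y. grad (\<zeta> (Suc j)) y - grad (\<zeta> j) y))\<^sup>2) \<le> P"
        using scheme[OF \<psi> Nn NC \<eta>] unfolding P_def euler_scheme_def by blast
      \<comment> \<open>Iterate \<open>j\<close> sits at this time; the times descend from 2 to
        \<open>s N = 1\<close>, inside (0,3).\<close>
      define s where "s j = 2 - real j * h" for j
      define W where "W j = (L2_norm \<Omega> (\<lambda>y. grad (\<zeta> (Suc j)) y - grad (\<zeta> j) y))\<^sup>2" for j
      define n2 where "n2 j = L2_norm \<Omega> (\<zeta> j) + L2_norm \<Omega> (\<zeta> (Suc j))" for j
      define I where "I j = (LINT t|lebesgue_on {s (Suc j)..s j}. (e t)\<^sup>2)" for j
      define m where "m j = L2_inner \<Omega> (y (s j)) (\<zeta> j)" for j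
      have step: "m j - m (Suc j) \<le> (\<kappa> + \<epsilon> / h) * I j + h * (d\<^sup>2 / (4 * \<kappa>) * W j + \<epsilon> / h * (R + 1) + H * n2 j)"
        if j: "j < N" for j
        unfolding m_def I_def W_def n2_def
      proof (rule step_inequality[OF \<Omega> d h(1) \<epsilon>(1) \<kappa>(1) _ _ _ sub \<zeta>(2,3,2,3)])
        have "real (Suc j) * h \<le> real N * h" using j h by (intro mult_right_mono) auto
        then show "0 < s (Suc j)" using h by (simp add: s_def)
        show "s j = s (Suc j) + h" by (simp add: s_def algebra_simps)
        have "0 \<le> real j * h" using h by simp
        then show "s j < 3" unfolding s_def by linarith
        show "residual_le \<Omega> (h * d) \<epsilon> (\<zeta> j) (\<zeta> (Suc j))" using res[of j] by (simp add: h_def)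
      qed
      have lin: "(\<Sum>j<N. x1 * I j + h * (x2 * W j + x3 + H * n2 j))
          = x1 * (\<Sum>j<N. I j) + h * x2 * (\<Sum>j<N. W j) + (real N * h) * x3 + H * (h * (\<Sum>j<N. n2 j))"
        for x1 x2 x3 :: real
        by (simp add: sum.distrib sum_distrib_left distrib_left mult_ac)
      have "m 0 - m N = (\<Sum>j<N. m j - m (Suc j))" by (simp add: sum_lessThan_telescope')
      also have "\<dots> \<le> (\<Sum>j<N. (\<kappa> + \<epsilon> / h) * I j + h * (d\<^sup>2 / (4 * \<kappa>) * W j + \<epsilon> / h * (R + 1) + H * n2 j))"
        by (intro sum_mono step) simp
      also have "\<dots> = (\<kappa> + \<epsilon> / h) * (\<Sum>j<N. I j) + h * (d\<^sup>2 / (4 * \<kappa>)) * (\<Sum>j<N. W j)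
          + (real N * h) * (\<epsilon> / h * (R + 1)) + H * (h * (\<Sum>j<N. n2 j))"
        by (rule lin)
      also have "\<dots> \<le> (\<kappa> + \<epsilon> / h) * E + h * Q + \<epsilon> / h * (R + 1) + H * (8 * C + x * h)"
      proof (intro add_mono)
        have "(\<Sum>j<N. I j) = (LINT t|lebesgue_on {2 - real N * h..2}. (e t)\<^sup>2)"
          unfolding I_def s_def by (rule integral_telescope[OF e2 h(1)]) (simp add: h)
        also have "\<dots> \<le> E"
          unfolding E_def using e2
          by (intro integral_mono_lebesgue_on_AE) (auto simp: h)
        finally show "(\<kappa> + \<epsilon> / h) * (\<Sum>j<N. I j) \<le> (\<kappa> + \<epsilon> / h) * E"
          using \<kappa> \<epsilon> h by (intro mult_left_mono) (auto intro!: add_nonneg_nonneg)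
        have "h * (d\<^sup>2 / (4 * \<kappa>)) * (\<Sum>j<N. W j) \<le> h * (d\<^sup>2 / (4 * \<kappa>)) * P"
          using grads h \<kappa> unfolding W_def by (intro mult_left_mono) auto
        then show "h * (d\<^sup>2 / (4 * \<kappa>)) * (\<Sum>j<N. W j) \<le> h * Q" by (simp add: Q_def)
        show "real N * h * (\<epsilon> / h * (R + 1)) \<le> \<epsilon> / h * (R + 1)" using h by simp
        have "h * (\<Sum>j<N. n2 j) \<le> 8 * C + L2_norm \<Omega> \<psi> * h"
          using sums unfolding n2_def by (simp add: h_def)
        also have "\<dots> \<le> 8 * C + x * h" using h by (simp add: x_def)
        finally show "H * (h * (\<Sum>j<N. n2 j)) \<le> H * (8 * C + x * h)" using H by (intro mult_left_mono)
      qed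
      finally have main: "m 0 - m N \<le> (\<kappa> + \<epsilon> / h) * E + h * Q + \<epsilon> / h * (R + 1) + H * (8 * C + x * h)" .
      have eh: "\<epsilon> / h * (E + (R + 1)) \<le> \<delta>"
      proof -
        have "\<epsilon> / h * (E + (R + 1)) \<le> \<eta> / h * (E + (R + 1))"
          using \<epsilon> h E0 R0 by (intro mult_right_mono divide_right_mono) auto
        also have "\<dots> = \<delta>" using h E0 R0 by (simp add: \<eta>_def add.assoc)
        finally show ?thesis .
      qed
      have mN: "m N \<le> R * C"
      proof -
        have sN: "s N \<in> {0..3}" using h by (simp add: s_def)
        have "m N \<le> L2_norm \<Omega> (y (s N)) * L2_norm \<Omega> (\<zeta> N)"
          unfolding m_def using L2_Cauchy_Schwarz[of "y (s N)" \<Omega> "\<zeta> N"] yR[OF sN] test_L2[OF \<zeta>(2) \<Omega>(1)]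
          by (simp add: abs_le_iff)
        also have "\<dots> \<le> R * C" using yR[OF sN] \<zeta>N R0 by (intro mult_mono) auto
        finally show ?thesis .
      qed
      have "m 0 = L2_inner \<Omega> (y 2) \<psi>" by (simp add: m_def s_def \<zeta>)
      then have "L2_inner \<Omega> (y 2) \<psi> \<le> R * C + (\<kappa> * E + h * Q + \<epsilon> / h * (E + (R + 1)) + H * (x * h)) + 8 * C * H"
        using main mN by (simp add: algebra_simps)
      also have "\<dots> \<le> R * C + (\<delta> + \<delta> + \<delta> + \<delta>) + 8 * C * H"
        using \<kappa>(2) Qh eh Hh by (intro add_mono) auto
      finally show "L2_inner \<Omega> (y 2) \<psi> \<le> R * C + 8 * C * H + \<delta>'" by (simp add: \<delta>_def)
    qed
  qed
qed

text \<open>Rescaling a nonnegative test function to mass 1/2 gives a bound by \<open>2 * M\<close>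
  times its mass; the one-sided fundamental lemma then applies to \<open>2 * M - u\<close>.\<close>

lemma le_AE_of_duality:
  fixes u :: "'a::euclidean_space \<Rightarrow> real"
  assumes \<Omega>: "open \<Omega>" "bounded \<Omega>" and u: "u \<in> L2 \<Omega>"
    and dual: "\<And>\<psi>. \<psi> \<in> test_functions \<Omega> \<Longrightarrow> (\<And>x. \<psi> x \<ge> 0) \<Longrightarrow> (LINT x|lebesgue_on \<Omega>. \<psi> x) \<le> 1 / 2 \<Longrightarrow>
      L2_inner \<Omega> u \<psi> \<le> M"
  shows "AE x in lebesgue_on \<Omega>. u x \<le> 2 * M"
proof -
  have "\<Omega> \<in> lmeasurable" using \<Omega> by (simp add: lmeasurable_open)
  then interpret finite_measure "lebesgue_on \<Omega>" by (rule finite_measure_lebesgue_on)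
  have ui: "integrable (lebesgue_on \<Omega>) u" by (rule L2_integrable[OF u \<Omega>])
  have "AE x in lebesgue_on \<Omega>. 0 \<le> 2 * M - u x"
  proof (rule fundamental_lemma_nonneg[OF \<Omega>(1)])
    show "integrable (lebesgue_on \<Omega>) (\<lambda>x. 2 * M - u x)" using ui by simp
    fix \<psi> :: "'a \<Rightarrow> real" assume \<psi>: "\<psi> \<in> test_functions \<Omega>" "\<And>x. \<psi> x \<ge> 0"
    have \<psi>i: "integrable (lebesgue_on \<Omega>) \<psi>" "integrable (lebesgue_on \<Omega>) (\<lambda>x. u x * \<psi> x)"
      using L2_integrable[OF test_L2[OF \<psi>(1) \<Omega>(1)] \<Omega>] L2_integrable_mult[OF u test_L2[OF \<psi>(1) \<Omega>(1)]] by auto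
    define m where "m = (LINT x|lebesgue_on \<Omega>. \<psi> x)"
    define v where "v = L2_inner \<Omega> u \<psi>"
    have m0: "m \<ge> 0" using \<psi> by (simp add: m_def)
    have scaled: "c * v \<le> M" if "c \<ge> 0" "c * m \<le> 1 / 2" for c
    proof -
      have "L2_inner \<Omega> u (\<lambda>x. c * \<psi> x) \<le> M"
        using that \<psi> by (intro dual test_mult) (auto simp: m_def)
      moreover have "L2_inner \<Omega> u (\<lambda>x. c * \<psi> x) = c * v"
        using L2_inner_mult_left[of \<Omega> c \<psi> u] by (simp add: v_def L2_inner_commute)
      ultimately show ?thesis by simp
    qed
    have "v \<le> 2 * M * m"
    proof (cases "m = 0")
      case True
      have "v \<le> 0"
      proof (rule ccontr)
        assume "\<not> v \<le> 0"
        \<comment> \<open>At mass zero every multiple is admissible; this one would push the pairing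
          to \<open>\<bar>M\<bar> + 1\<close>.\<close>
        then have "(\<bar>M\<bar> + 1) / v * v \<le> M" using True by (intro scaled) auto
        with \<open>\<not> v \<le> 0\<close> show False by simp
      qed
      with True show ?thesis by simp
    next
      case False
      with m0 have "m > 0" by simp
      then show ?thesis using scaled[of "1 / (2 * m)"] by (simp add: field_simps)
    qed
    then show "0 \<le> (LINT x|lebesgue_on \<Omega>. (2 * M - u x) * \<psi> x)"
      using \<psi>i by (simp add: left_diff_distrib v_def m_def L2_inner_def)
  qed
  then show ?thesis by eventually_elim simp
qed

subsection \<open>Boundedness of the attractor\<close>

lemma compactin_L2_bounded:
  fixes K :: "('a::euclidean_space \<Rightarrow> 'b::euclidean_space) set"
  assumes K: "compactin (L2_topology \<Omega>) K" "K \<subseteq> L2 \<Omega>"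
  shows "\<exists>R\<ge>0. \<forall>g\<in>K. L2_norm \<Omega> g \<le> R"
proof -
  define U where "U n = {h :: 'a \<Rightarrow> 'b. h \<in> L2 \<Omega> \<and> L2_dist \<Omega> (\<lambda>x. 0) h < real n + 1}" for n :: nat
  have dist: "L2_dist \<Omega> (\<lambda>x. 0) h = L2_norm \<Omega> h" for h :: "'a \<Rightarrow> 'b"
    using L2_norm_scale[of \<Omega> "-1" h] by (simp add: L2_dist_def)
  have op: "openin (L2_topology \<Omega>) (U n)" for n
    unfolding L2_topology_def
  proof (rule topology_generated_by_Basis)
    show "U n \<in> {{h \<in> L2 \<Omega>. L2_dist \<Omega> f h < r} |f r. f \<in> L2 \<Omega> \<and> 0 < r}"
      unfolding mem_Collect_eq
      by (intro exI[of _ "\<lambda>x. 0"] exI[of _ "real n + 1"] conjI) (simp_all add: U_def)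
  qed
  have cover: "K \<subseteq> \<Union> (range U)"
  proof
    fix h assume "h \<in> K"
    obtain n :: nat where "L2_norm \<Omega> h \<le> real n" using real_arch_simple by blast
    with \<open>h \<in> K\<close> K have "h \<in> U n" by (auto simp: U_def dist)
    then show "h \<in> \<Union> (range U)" by blast
  qed
  have "\<exists>\<F>. finite \<F> \<and> \<F> \<subseteq> range U \<and> K \<subseteq> \<Union> \<F>"
    by (rule compactinD[OF K(1) _ cover]) (use op in blast)
  then obtain \<F> where \<F>: "finite \<F>" "\<F> \<subseteq> range U" "K \<subseteq> \<Union> \<F>" by blast
  obtain N where N: "finite N" "\<F> = U ` N" using finite_subset_image[OF \<F>(1,2)] by blast
  \<comment> \<open>A sum of the radii instead of their maximum, so that an empty subcover needs no
    separate case.\<close>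
  have "L2_norm \<Omega> g \<le> (\<Sum>n\<in>N. real n + 1)" if "g \<in> K" for g
  proof -
    have "g \<in> \<Union> (U ` N)" using subsetD[OF \<F>(3) that] N(2) by simp
    then obtain n where n: "n \<in> N" "g \<in> U n" by (rule UN_E)
    then have "L2_norm \<Omega> g \<le> real n + 1" by (simp add: U_def dist)
    also have "\<dots> \<le> (\<Sum>n\<in>N. real n + 1)" using n N by (intro member_le_sum) auto
    finally show ?thesis .
  qed
  moreover have "(\<Sum>n\<in>N. real n + 1) \<ge> 0" by (rule sum_nonneg) simp
  ultimately show ?thesis by blast
qed

text \<open>A vector test function concentrated in one component; testing the system with it
  isolates the scalar equation of that component.\<close>

definition single :: "'m \<Rightarrow> ('a \<Rightarrow> real) \<Rightarrow> 'a \<Rightarrow> real^'m" where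
  "single i z x = z x *\<^sub>R axis i 1"

lemma single_nth: "single i z x $ j = (if j = i then z x else 0)"
  by (auto simp: single_def axis_def)

lemma inner_single: "v \<bullet> single i z x = v $ i * z x"
  by (simp add: single_def inner_axis)

lemma L2_inner_single: "L2_inner \<Omega> g (single i z) = L2_inner \<Omega> (\<lambda>x. g x $ i) z"
  by (simp add: L2_inner_def inner_single)

lemma single_L2:
  assumes "z \<in> L2 \<Omega>"
  shows "single i z \<in> L2 \<Omega>"
proof (rule L2_I[OF _ L2_integrable_power2[OF assms]])
  show "single i z \<in> borel_measurable (lebesgue_on \<Omega>)"
    unfolding single_def using L2_measurable[OF assms] by (intro borel_measurable_scaleR) auto
qed (simp add: single_def norm_axis_1)

lemma single_E_space:
  assumes "z \<in> test_functions \<Omega>" "open \<Omega>" "bounded \<Omega>"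
  shows "single i z \<in> E_space \<Omega>"
proof -
  have "(\<lambda>x. single i z x $ j) \<in> H10 \<Omega>" for j
    using test_H10[OF assms] test_H10[OF test_zero assms(2,3)] by (cases "j = i") (simp_all add: single_nth)
  then show ?thesis by (simp add: E_space_def)
qed

lemma A_op_single:
  fixes d :: "real^3"
  assumes "open \<Omega>" "bounded \<Omega>"
  shows "A_op \<Omega> d g (single i z) = - (d $ i * L2_inner \<Omega> (weak_grad \<Omega> (\<lambda>x. g x $ i)) (weak_grad \<Omega> z))"
proof -
  \<comment> \<open>The other components contribute \<open>weak_grad\<close> of the zero function, a
    chosen representative that vanishes only almost everywhere.\<close>
  have zero: "L2_inner \<Omega> v (weak_grad \<Omega> (\<lambda>x. 0)) = 0" for v
  proof -
    have "grad (\<lambda>x. 0 :: real) = (\<lambda>x. 0 :: 'a)" by (simp add: grad_def fun_eq_iff)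
    with weak_grad_test(2)[OF test_zero assms]
    have "AE x in lebesgue_on \<Omega>. weak_grad \<Omega> (\<lambda>x. 0) x = 0" by simp
    then have "AE x in lebesgue_on \<Omega>. v x \<bullet> weak_grad \<Omega> (\<lambda>x. 0) x = 0" by eventually_elim simp
    then show ?thesis unfolding L2_inner_def by (rule integral_eq_zero_AE)
  qed
  have "(\<Sum>j\<in>UNIV. d $ j * L2_inner \<Omega> (weak_grad \<Omega> (\<lambda>x. g x $ j)) (weak_grad \<Omega> (\<lambda>x. single i z x $ j)))
      = (\<Sum>j\<in>UNIV. if j = i then d $ i * L2_inner \<Omega> (weak_grad \<Omega> (\<lambda>x. g x $ i)) (weak_grad \<Omega> z) else 0)"
    by (intro sum.cong) (auto simp: single_nth zero)
  then show ?thesis by (simp add: A_op_def)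
qed

text \<open>If the left-hand integrand is not integrable, its integral is \<open>0\<close> and the bound is trivial.\<close>

lemma reaction_bound:
  fixes f :: "real^3 \<Rightarrow> real^3"
  assumes f: "\<And>p. (\<And>i. p $ i \<ge> 0) \<Longrightarrow> f p $ i \<le> L * norm p" and "L \<ge> 0"
    and g: "g \<in> H_plus \<Omega>" and z: "z \<in> L2 \<Omega>" "\<And>x. z x \<ge> 0"
  shows "L2_inner \<Omega> (\<lambda>x. f (g x)) (single i z) \<le> L * L2_norm \<Omega> g * L2_norm \<Omega> z"
proof (cases "integrable (lebesgue_on \<Omega>) (\<lambda>x. f (g x) $ i * z x)")
  case True
  have gL: "g \<in> L2 \<Omega>" and "\<forall>i. AE x in lebesgue_on \<Omega>. 0 \<le> g x $ i"
    using g by (auto simp: H_plus_def)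
  then have pos: "AE x in lebesgue_on \<Omega>. \<forall>i. 0 \<le> g x $ i" by (simp add: AE_all_countable)
  have nL: "(\<lambda>x. norm (g x)) \<in> L2 \<Omega>"
  proof (rule L2_I[OF _ L2_integrable_power2[OF gL]])
    show "(\<lambda>x. norm (g x)) \<in> borel_measurable (lebesgue_on \<Omega>)"
      using L2_measurable[OF gL] by measurable
  qed simp
  have "L2_inner \<Omega> (\<lambda>x. f (g x)) (single i z) = (LINT x|lebesgue_on \<Omega>. f (g x) $ i * z x)"
    by (simp add: L2_inner_def inner_single)
  also have "\<dots> \<le> (LINT x|lebesgue_on \<Omega>. L * (norm (g x) * z x))"
  proof (rule integral_mono_AE[OF True])
    show "integrable (lebesgue_on \<Omega>) (\<lambda>x. L * (norm (g x) * z x))"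
      using L2_integrable_mult[OF nL z(1)] by simp
    show "AE x in lebesgue_on \<Omega>. f (g x) $ i * z x \<le> L * (norm (g x) * z x)"
      using pos
    proof eventually_elim
      case (elim x)
      then have "f (g x) $ i \<le> L * norm (g x)" by (intro f) auto
      from mult_right_mono[OF this z(2)[of x]] show ?case by (simp add: mult.assoc)
    qed
  qed
  also have "\<dots> = L * L2_inner \<Omega> (\<lambda>x. norm (g x)) z" by (simp add: L2_inner_def)
  also have "\<dots> \<le> L * (L2_norm \<Omega> (\<lambda>x. norm (g x)) * L2_norm \<Omega> z)"
    using L2_Cauchy_Schwarz[OF nL z(1)] \<open>L \<ge> 0\<close> by (intro mult_left_mono) (auto simp: abs_le_iff)
  also have "L2_norm \<Omega> (\<lambda>x. norm (g x)) = L2_norm \<Omega> g"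
    by (simp add: L2_norm_def L2_inner_def power2_norm_eq_inner[symmetric] power2_eq_square)
  finally show ?thesis by (simp add: mult.assoc)
next
  case False
  then have "L2_inner \<Omega> (\<lambda>x. f (g x)) (single i z) = 0"
    by (simp add: L2_inner_def inner_single not_integrable_integral_eq)
  then show ?thesis using \<open>L \<ge> 0\<close> by simp
qed

text \<open>The gradient norms enter the duality estimate only through square integrability, so
  \<open>M\<close> is uniform over all solutions staying in the ball of radius \<open>R\<close>.
  Testing with nonnegative functions uses an upper bound of the reaction alone.\<close>

lemma weak_solution_bounded_component:
  fixes \<Omega> :: "'a::euclidean_space set" and f :: "real^3 \<Rightarrow> real^3" and d :: "real^3"
  assumes \<Omega>: "open \<Omega>" "bounded \<Omega>" and dim: "DIM('a) \<le> 3" and d: "d $ i > 0"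
    and f: "\<And>p. (\<And>i. p $ i \<ge> 0) \<Longrightarrow> f p $ i \<le> L * norm p" and L: "L \<ge> 0" and R: "R \<ge> 0"
  shows "\<exists>M. \<forall>g0 g. weak_solution \<Omega> d f 3 g0 g \<and> (\<forall>t\<in>{0..3}. g t \<in> H_plus \<Omega> \<and> L2_norm \<Omega> (g t) \<le> R)
    \<longrightarrow> (AE x in lebesgue_on \<Omega>. g 2 x $ i \<le> M)"
proof -
  obtain C :: real where C: "C \<ge> 1"
    and dual: "\<And>y R H e \<psi>. heat_subsolution \<Omega> (d $ i) R H e y \<Longrightarrow>
      \<psi> \<in> test_functions \<Omega> \<Longrightarrow> (\<And>x. \<psi> x \<ge> 0) \<Longrightarrow> (LINT x|lebesgue_on \<Omega>. \<psi> x) \<le> 1 / 2 \<Longrightarrow>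
      L2_inner \<Omega> (y 2) \<psi> \<le> R * C + 8 * C * H"
    using duality_estimate[OF \<Omega> dim d] by blast
  define M where "M = R * C + 8 * C * (L * R)"
  have "AE x in lebesgue_on \<Omega>. g 2 x $ i \<le> 2 * M"
    if sol: "weak_solution \<Omega> d f 3 g0 g" and g: "\<And>t. t \<in> {0..3} \<Longrightarrow> g t \<in> H_plus \<Omega> \<and> L2_norm \<Omega> (g t) \<le> R"
    for g0 g
  proof -
    have gL: "g t \<in> L2 \<Omega>" if "t \<in> {0..3}" for t using g[OF that] by (simp add: H_plus_def)
    have cw: "continuous_on {0..3} (\<lambda>t. L2_inner \<Omega> (g t) h)" if "h \<in> L2 \<Omega>" for h
      using sol that by (auto simp: weak_solution_def Cw_H_def)
    have wd: "has_weak_deriv {0<..<3} 1 (\<lambda>t. L2_inner \<Omega> (g t) \<phi>)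
        (\<lambda>t. A_op \<Omega> d (g t) \<phi> + L2_inner \<Omega> (\<lambda>x. f (g t x)) \<phi>)" if "\<phi> \<in> E_space \<Omega>" for \<phi>
      using sol that by (auto simp: weak_solution_def)
    have tE: "AE t in lebesgue_on {0..3}. g t \<in> E_space \<Omega>"
    proof -
      obtain s where "AE t in lebesgue_on {0..3}. g t \<in> E_space \<Omega> \<and>
             (\<lambda>k::nat. E_norm \<Omega> (\<lambda>x. s k t x - g t x)) \<longlonglongrightarrow> 0"
        using sol by (auto simp: weak_solution_def L2_time_E_def)
      then show ?thesis by eventually_elim simp
    qed
    have "heat_subsolution \<Omega> (d $ i) R (L * R) (\<lambda>t. E_norm \<Omega> (g t)) (\<lambda>t x. g t x $ i)"
      unfolding heat_subsolution_def
    proof (intro conjI ballI)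
        show "(\<lambda>x. g t x $ i) \<in> L2 \<Omega>" "L2_norm \<Omega> (\<lambda>x. g t x $ i) \<le> R" if "t \<in> {0..3}" for t
          using L2_component[OF gL[OF that]] L2_norm_component_le[OF gL[OF that], of i] g[OF that] by auto
        show "continuous_on {0..3} (\<lambda>t. L2_inner \<Omega> (\<lambda>x. g t x $ i) z)" if "z \<in> test_functions \<Omega>" for z
          using cw[OF single_L2[OF test_L2[OF that \<Omega>(1)], of i]] by (simp add: L2_inner_single)
        show "AE t in lebesgue_on {0..3}. (\<lambda>x. g t x $ i) \<in> H10 \<Omega> \<and>
            L2_norm \<Omega> (weak_grad \<Omega> (\<lambda>x. g t x $ i)) \<le> E_norm \<Omega> (g t)"
          using tE
        proof eventually_elim
          case (elim t)
          have "(L2_norm \<Omega> (weak_grad \<Omega> (\<lambda>x. g t x $ i)))\<^sup>2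
              \<le> (\<Sum>j\<in>UNIV. (L2_norm \<Omega> (weak_grad \<Omega> (\<lambda>x. g t x $ j)))\<^sup>2)"
            by (intro member_le_sum) auto
          then show ?case
            using elim unfolding E_norm_def by (auto simp: E_space_def intro: real_le_rsqrt)
        qed
        show "integrable (lebesgue_on {0..3}) (\<lambda>t. (E_norm \<Omega> (g t))\<^sup>2)"
          using sol by (auto simp: weak_solution_def L2_time_E_def)
        show "L * R \<ge> 0" using L R by simp
        fix z assume "z \<in> {z \<in> test_functions \<Omega>. \<forall>x. z x \<ge> 0}"
        then have z: "z \<in> test_functions \<Omega>" "\<And>x. z x \<ge> 0" by auto
        show "\<exists>F. has_weak_deriv {0<..<3} 1 (\<lambda>t. L2_inner \<Omega> (\<lambda>x. g t x $ i) z)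
            (\<lambda>t. - (d $ i * L2_inner \<Omega> (weak_grad \<Omega> (\<lambda>x. g t x $ i)) (weak_grad \<Omega> z)) + F t) \<and>
          (\<forall>t\<in>{0..3}. F t \<le> L * R * L2_norm \<Omega> z)"
        proof (intro exI conjI ballI)
          show "has_weak_deriv {0<..<3} 1 (\<lambda>t. L2_inner \<Omega> (\<lambda>x. g t x $ i) z)
            (\<lambda>t. - (d $ i * L2_inner \<Omega> (weak_grad \<Omega> (\<lambda>x. g t x $ i)) (weak_grad \<Omega> z))
              + L2_inner \<Omega> (\<lambda>x. f (g t x)) (single i z))"
            using wd[OF single_E_space[OF z(1) \<Omega>, of i]] by (simp add: A_op_single[OF \<Omega>] L2_inner_single)
          fix t :: real assume t: "t \<in> {0..3}"
          have "L2_inner \<Omega> (\<lambda>x. f (g t x)) (single i z) \<le> L * L2_norm \<Omega> (g t) * L2_norm \<Omega> z"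
            using g[OF t] by (intro reaction_bound f L test_L2[OF z(1) \<Omega>(1)] z) auto
          also have "\<dots> \<le> L * R * L2_norm \<Omega> z"
            using g[OF t] L by (intro mult_right_mono mult_left_mono) auto
          finally show "L2_inner \<Omega> (\<lambda>x. f (g t x)) (single i z) \<le> L * R * L2_norm \<Omega> z" .
        qed
    qed
    from dual[OF this] show ?thesis
      unfolding M_def by (intro le_AE_of_duality[OF \<Omega>] L2_component gL) auto
  qed
  then show ?thesis by blast
qed

lemma oregonator_f_component_le:
  assumes "a1 > 0" "a3 > 0" "b1 > 0" "b2 > 0" "c2 > 0" "c3 > 0" "F > 0" "G1 > 0" "G2 > 0"
    and p: "\<And>i. p $ i \<ge> 0"
  shows "oregonator_f a1 a3 b1 b2 c2 c3 F G1 G2 p $ i \<le> (a1 + b1 + c2 + a3) * norm p"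
proof -
  have n: "p $ j \<le> norm p" for j
    using component_le_norm_cart[of p j] by (simp add: abs_le_iff)
  have m: "a * p $ j \<le> a * norm p" if "a > 0" for a j
    using n that by (intro mult_left_mono) auto
  have pos: "0 \<le> F * (p $ 1)\<^sup>2" "0 \<le> G1 * p $ 1 * p $ 2" "0 \<le> b2 * p $ 2" "0 \<le> G2 * p $ 1 * p $ 2"
    "0 \<le> c3 * p $ 3" "0 \<le> a1 * norm p" "0 \<le> b1 * norm p" "0 \<le> c2 * norm p" "0 \<le> a3 * norm p"
    using assms by auto
  have "i = 1 \<or> i = 2 \<or> i = 3" using exhaust_3 by blast
  then show ?thesis
    using m[OF \<open>a1 > 0\<close>, of 1] m[OF \<open>b1 > 0\<close>, of 2] m[OF \<open>c2 > 0\<close>, of 3] m[OF \<open>a3 > 0\<close>, of 1] pos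
    by (elim disjE) (simp_all add: oregonator_f_def Let_def distrib_right)
qed

theorem theorem4:
  fixes \<Omega> :: "(real^'n) set"
    and d1 d2 d3 a1 a3 b1 b2 c2 c3 F G1 G2 :: real
    and S :: "real \<Rightarrow> (real^'n \<Rightarrow> real^3) \<Rightarrow> (real^'n \<Rightarrow> real^3)"
    and \<A> :: "(real^'n \<Rightarrow> real^3) set"
  assumes "CARD('n) \<le> 3"
    and "bounded_lipschitz_domain \<Omega>"
    and "d1 > 0" "d2 > 0" "d3 > 0" "a1 > 0" "a3 > 0" "b1 > 0" "b2 > 0" "c2 > 0" "c3 > 0"
    and "F > 0" "G1 > 0" "G2 > 0"
    and "is_weak_semiflow \<Omega> (vector [d1, d2, d3]) (oregonator_f a1 a3 b1 b2 c2 c3 F G1 G2) S"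
    and "is_global_attractor \<Omega> S \<A>"
  shows "\<A> \<subseteq> Linf \<Omega> \<and> (\<exists>M::real. \<forall>g\<in>\<A>. Linf_norm \<Omega> g \<le> ereal M)"
proof -
  let ?f = "oregonator_f a1 a3 b1 b2 c2 c3 F G1 G2" and ?d = "vector [d1, d2, d3] :: real^3"
  have \<Omega>: "open \<Omega>" "bounded \<Omega>" using assms(2) by (auto simp: bounded_lipschitz_domain_def)
  have dim: "DIM(real^'n) \<le> 3" using assms(1) by simp
  have dpos: "?d $ i > 0" for i
    using exhaust_3[of i] assms(3-5) by auto
  define L where "L = a1 + b1 + c2 + a3"
  have L: "L \<ge> 0" using assms by (simp add: L_def)
  have fL: "?f p $ i \<le> L * norm p" if "\<And>i. p $ i \<ge> 0" for p i
    unfolding L_def using that assms by (intro oregonator_f_component_le) auto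
  have attr: "\<A> \<subseteq> H_plus \<Omega>" "compactin (L2_topology \<Omega>) \<A>"
    and inv: "\<And>t. t \<ge> 0 \<Longrightarrow> ae_closure \<Omega> (S t ` \<A>) = ae_closure \<Omega> \<A>"
    using assms(16) by (auto simp: is_global_attractor_def)
  have AL2: "\<A> \<subseteq> L2 \<Omega>" using attr(1) by (auto simp: H_plus_def)
  obtain R where R: "R \<ge> 0" "\<And>g. g \<in> \<A> \<Longrightarrow> L2_norm \<Omega> g \<le> R"
    using compactin_L2_bounded[OF attr(2) AL2] by blast
  have sol: "global_weak_solution \<Omega> ?d ?f g0 (\<lambda>t. S t g0)" "\<And>t. t \<ge> 0 \<Longrightarrow> S t g0 \<in> H_plus \<Omega>"
    if "g0 \<in> \<A>" for g0
    using assms(15) attr(1) that by (auto simp: is_weak_semiflow_def)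
  have SR: "L2_norm \<Omega> (S t g0) \<le> R" if g0: "g0 \<in> \<A>" and t: "t \<ge> 0" for g0 t
  proof -
    \<comment> \<open>Invariance holds for equivalence classes: the orbit need not lie in the
      attractor as a set of functions, but it agrees almost everywhere with an element of it, which
      suffices for the norm.\<close>
    have "S t g0 \<in> ae_closure \<Omega> (S t ` \<A>)"
      using g0 by (auto simp: ae_closure_def ae_eq_def)
    then obtain g where g: "g \<in> \<A>" "ae_eq \<Omega> (S t g0) g"
      using inv[OF t] by (auto simp: ae_closure_def)
    have "S t g0 \<in> L2 \<Omega>" using sol(2)[OF g0 t] by (simp add: H_plus_def)
    then have "L2_norm \<Omega> (S t g0) = L2_norm \<Omega> g"
      using g AL2 by (intro L2_norm_cong) (auto simp: ae_eq_def)
    with R(2)[OF g(1)] show ?thesis by simp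
  qed
  have ex: "\<exists>M. \<forall>i. \<forall>g0 g. weak_solution \<Omega> ?d ?f 3 g0 g \<and> (\<forall>t\<in>{0..3}. g t \<in> H_plus \<Omega> \<and> L2_norm \<Omega> (g t) \<le> R)
    \<longrightarrow> (AE x in lebesgue_on \<Omega>. g 2 x $ i \<le> M i)"
    by (intro choice allI weak_solution_bounded_component[OF \<Omega> dim dpos fL L R(1)])
  obtain M where M: "\<forall>i. \<forall>g0 g. weak_solution \<Omega> ?d ?f 3 g0 g \<and> (\<forall>t\<in>{0..3}. g t \<in> H_plus \<Omega> \<and> L2_norm \<Omega> (g t) \<le> R)
    \<longrightarrow> (AE x in lebesgue_on \<Omega>. g 2 x $ i \<le> M i)"
    using ex by (rule exE)
  define B where "B = (\<Sum>i\<in>UNIV. M i)"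
  have bound: "g \<in> borel_measurable (lebesgue_on \<Omega>)" "Linf_norm \<Omega> g \<le> ereal B" if g: "g \<in> \<A>" for g
  proof -
    show gm: "g \<in> borel_measurable (lebesgue_on \<Omega>)" using g AL2 by (auto intro: L2_measurable)
    \<comment> \<open>Every element of the attractor is, almost everywhere, the time 2 value of an
      orbit starting in it; time 2 is where the component bound is available.\<close>
    have "g \<in> ae_closure \<Omega> (S 2 ` \<A>)"
      using g inv[of 2] by (auto simp: ae_closure_def ae_eq_def)
    then obtain g0 where g0: "g0 \<in> \<A>" "AE x in lebesgue_on \<Omega>. g x = S 2 g0 x"
      by (auto simp: ae_closure_def ae_eq_def)
    have ws: "weak_solution \<Omega> ?d ?f 3 g0 (\<lambda>t. S t g0)"
      using sol(1)[OF g0(1)] by (simp add: global_weak_solution_def)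
    have "AE x in lebesgue_on \<Omega>. S 2 g0 x $ i \<le> M i" for i
      using sol(2)[OF g0(1)] SR[OF g0(1)] ws by (intro M[rule_format]) auto
    then have "AE x in lebesgue_on \<Omega>. \<forall>i. S 2 g0 x $ i \<le> M i" by (simp add: AE_all_countable)
    moreover have "AE x in lebesgue_on \<Omega>. \<forall>i. 0 \<le> S 2 g0 x $ i"
      using sol(2)[OF g0(1), of 2] by (simp add: H_plus_def AE_all_countable)
    ultimately have "AE x in lebesgue_on \<Omega>. ereal (norm (g x)) \<le> ereal B"
      using g0(2)
    proof eventually_elim
      case (elim x)
      have "norm (g x) \<le> (\<Sum>i\<in>UNIV. \<bar>g x $ i\<bar>)" by (rule norm_le_l1_cart)
      also have "\<dots> \<le> B" unfolding B_def using elim by (intro sum_mono) simp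
      finally show ?case by simp
    qed
    then show "Linf_norm \<Omega> g \<le> ereal B"
      unfolding Linf_norm_def using gm by (intro esssup_I) auto
  qed
  have "Linf_norm \<Omega> g < \<infinity>" if "g \<in> \<A>" for g
    using bound(2)[OF that] by (rule le_less_trans) simp
  with bound show ?thesis by (auto simp: Linf_def)
qed

end
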